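(* In the exceptional case of the combinatorics $\vec m=(1,3,4,3,1,0)$, the iterated pull-back $f\mapsto T(f)$ does not usually converge to a single map. Instead, from a generic starting point, it converges to a pair of maps $(f,g)$ for which $T(f)=g$ and $T(g)=f$. In fact the composition $T\circ T$ has a global attractor consisting of a one-parameter family of conjugacy classes, and the fixed point of $T$ is just one point in this one-parameter family.
   Context: Let $\widehat{\mathbb R}=\mathbb R\cup\{\infty\}$ and let $G=\mathrm{PSL}_2(\mathbb R)$ be the group of orientation preserving real fractional linear transformations. A real quadratic map is a rational map of degree two with real coefficients and with both critical points in $\widehat{\mathbb R}$; its image $f(\widehat{\mathbb R})$ is a closed arc bounded by the two critical values. Two such maps are conjugate if they correspond under an element of $G$. $X_n$ is the set of $(n+1)$-tuples $\vec x=(x_0,\dots,x_n)$ of distinct points of $\widehat{\mathbb R}$ in positive cyclic order, with the diagonal $G$-action. The pull-back $T:X_5/G\to X_5/G$ for $\vec m=(m_0,\dots,m_5)=(1,3,4,3,1,0)$: the critical indices are $5$ (smallest entry $m_5=0$) and $2$ (largest entry $m_2=4$). Given $\vec x\in X_5$, choose a real quadratic map $f$ for which $f(\widehat{\mathbb R})$ is the arc running in the positive direction from $x_0$ to $x_4$. The critical points of $f$ divide $\widehat{\mathbb R}$ into a half-circle on which $f$ preserves orientation and one on which it reverses orientation, giving two branches $f_+^{-1}$ and $f_-^{-1}$ of $f^{-1}$ on $f(\widehat{\mathbb R})$ with values in these half-circles. Put $y_j=f_\pm^{-1}(x_{m_j})$, using $f_+^{-1}$ for $j=0,1$ and $f_-^{-1}$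 for $j=3,4$ (for $j=2,5$ the two branches agree). The class of $\vec y$ in $X_5/G$ depends only on the class of $\vec x$, and $T([\vec x])=[\vec y]$. Pull-back in terms of maps: a point $[\vec x]\in X_5/G$ determines a real quadratic map up to conjugacy, namely the map $f$ with critical points $x_2,x_5$, with $f(x_2)=x_4$ and $f(x_5)=x_0$, and with fixed point $x_3$ (since $m_3=3$). This $f$ is a permitted choice in the construction above. If $f$ is the map determined by $[\vec x]$, then $T(f)$ denotes the map determined by $T([\vec x])$. *)

theory Defs
  imports "HOL-Analysis.Analysis" "HOL-Computational_Algebra.Polynomial"
begin

subsection \<open>The extended line and rational maps\<close>

text \<open>
  The one-point compactification of a field \<open>'a\<close> is modelled by \<open>'a option\<close>, where
  \<^const>\<open>None\<close> is the point at infinity. For \<open>'a = real\<close> this is the circle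
  of real numbers together with infinity, for \<open>'a = complex\<close> it is the Riemann sphere.
\<close>

type_synonym rhat = "real option"

definition rhat_top :: "rhat topology" where
  "rhat_top = topology (\<lambda>U. open {r. Some r \<in> U} \<and> (None \<in> U \<longrightarrow> compact {r. Some r \<notin> U}))"

lemma istopology_rhat:
  "istopology (\<lambda>U :: rhat set. open {r. Some r \<in> U} \<and> (None \<in> U \<longrightarrow> compact {r. Some r \<notin> U}))"
  unfolding istopology_def
proof (intro conjI allI impI)
  fix S T :: "rhat set"
  assume S: "open {r. Some r \<in> S} \<and> (None \<in> S \<longrightarrow> compact {r. Some r \<notin> S})"
    and T: "open {r. Some r \<in> T} \<and> (None \<in> T \<longrightarrow> compact {r. Some r \<notin> T})"
  have "{r. Some r \<in> S \<inter> T} = {r. Some r \<in> S} \<inter> {r. Some r \<in> T}"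
    "{r. Some r \<notin> S \<inter> T} = {r. Some r \<notin> S} \<union> {r. Some r \<notin> T}" by auto
  then show "open {r. Some r \<in> S \<inter> T}" "None \<in> S \<inter> T \<Longrightarrow> compact {r. Some r \<notin> S \<inter> T}"
    using S T by (auto intro: open_Int compact_Un)
next
  fix \<K> :: "rhat set set"
  assume K: "\<forall>K\<in>\<K>. open {r. Some r \<in> K} \<and> (None \<in> K \<longrightarrow> compact {r. Some r \<notin> K})"
  have eq: "{r. Some r \<in> \<Union>\<K>} = (\<Union>K\<in>\<K>. {r. Some r \<in> K})" by auto
  show op: "open {r. Some r \<in> \<Union>\<K>}" unfolding eq using K by blast
  assume "None \<in> \<Union>\<K>"
  then obtain K where k: "K \<in> \<K>" "compact {r. Some r \<notin> K}" using K by auto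
  have "{r. Some r \<notin> \<Union>\<K>} = {r. Some r \<notin> K} \<inter> - {r. Some r \<in> \<Union>\<K>}"
    using k(1) by auto
  then show "compact {r. Some r \<notin> \<Union>\<K>}"
    using compact_Int_closed[OF k(2), of "- {r. Some r \<in> \<Union>\<K>}"] op by (simp add: closed_Compl)
qed

lemma openin_rhat_top:
  "openin rhat_top U \<longleftrightarrow> open {r. Some r \<in> U} \<and> (None \<in> U \<longrightarrow> compact {r. Some r \<notin> U})"
  unfolding rhat_top_def by (simp add: topology_inverse'[OF istopology_rhat])

lemma topspace_rhat_top [simp]: "topspace rhat_top = UNIV"
proof -
  have "openin rhat_top UNIV" by (simp add: openin_rhat_top)
  then show ?thesis using openin_subset by fastforce
qed

text \<open>
  The map \<open>p / q\<close>. At infinity its value is read off from the coefficients of the top degree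
  \<open>max (degree p) (degree q)\<close>; this number is the degree of the map if \<open>p\<close> and \<open>q\<close> are coprime.
\<close>

definition rat_map :: "'a::field poly \<Rightarrow> 'a poly \<Rightarrow> 'a option \<Rightarrow> 'a option" where
  "rat_map p q z =
     (case z of
        Some x \<Rightarrow> if poly q x = 0 then None else Some (poly p x / poly q x)
      | None \<Rightarrow> let n = max (degree p) (degree q) in
                if coeff q n = 0 then None else Some (coeff p n / coeff q n))"

text \<open>
  Critical points are zeros of the derivative in local coordinates. \<open>local_param c\<close>
  is the inverse of the coordinate \<open>z - c\<close> (or \<open>1 / z\<close> if \<open>c\<close> is infinity), and
  \<open>local_coord v\<close> is that coordinate at \<open>v\<close>; its value at a point outside the
  chart is irrelevant.
\<close>

definition local_param :: "'a::field option \<Rightarrow> 'a \<Rightarrow> 'a option" where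
  "local_param c w =
     (case c of Some z \<Rightarrow> Some (z + w) | None \<Rightarrow> if w = 0 then None else Some (1 / w))"

definition local_coord :: "'a::field option \<Rightarrow> 'a option \<Rightarrow> 'a" where
  "local_coord v u =
     (case v of
        Some z \<Rightarrow> (case u of Some x \<Rightarrow> x - z | None \<Rightarrow> 0)
      | None \<Rightarrow> (case u of Some x \<Rightarrow> 1 / x | None \<Rightarrow> 0))"

definition critical_point :: "('a::real_normed_field option \<Rightarrow> 'a option) \<Rightarrow> 'a option \<Rightarrow> bool" where
  "critical_point f c \<longleftrightarrow>
     ((\<lambda>w. local_coord (f c) (f (local_param c w))) has_field_derivative 0) (at 0)"


subsection \<open>Real quadratic maps and their conjugacy classes\<close>

text \<open>
  All critical points on the Riemann sphere are required to be real. The map itself is recorded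
  by its restriction to the extended real line, which determines it.
\<close>

definition real_quadratic_pair :: "real poly \<Rightarrow> real poly \<Rightarrow> bool" where
  "real_quadratic_pair p q \<longleftrightarrow>
     coprime p q \<and> max (degree p) (degree q) = 2 \<and>
     (\<forall>c. critical_point (rat_map (map_poly complex_of_real p) (map_poly complex_of_real q)) c
          \<longrightarrow> c \<in> range (map_option complex_of_real))"

definition real_quadratic_map :: "(rhat \<Rightarrow> rhat) \<Rightarrow> bool" where
  "real_quadratic_map f \<longleftrightarrow> (\<exists>p q. real_quadratic_pair p q \<and> f = rat_map p q)"

definition PSL2R :: "(rhat \<Rightarrow> rhat) set" where
  "PSL2R = {rat_map [:b, a:] [:d, c:] | a b c d. a * d - b * c = 1}"

definition conj_class :: "(rhat \<Rightarrow> rhat) \<Rightarrow> (rhat \<Rightarrow> rhat) set" where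
  "conj_class f = {g. real_quadratic_map g \<and> (\<exists>\<phi>\<in>PSL2R. g \<circ> \<phi> = \<phi> \<circ> f)}"

definition quotient_topology :: "'a topology \<Rightarrow> ('a \<Rightarrow> 'b) \<Rightarrow> 'b topology" where
  "quotient_topology X h =
     topology (\<lambda>U. U \<subseteq> h ` topspace X \<and> openin X {x \<in> topspace X. h x \<in> U})"

lemma istopology_quotient:
  "istopology (\<lambda>U. U \<subseteq> h ` topspace X \<and> openin X {x \<in> topspace X. h x \<in> U})"
  unfolding istopology_def
proof (intro conjI allI impI)
  fix S T
  assume S: "S \<subseteq> h ` topspace X \<and> openin X {x \<in> topspace X. h x \<in> S}"
    and T: "T \<subseteq> h ` topspace X \<and> openin X {x \<in> topspace X. h x \<in> T}"
  show "S \<inter> T \<subseteq> h ` topspace X" using S by auto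
  have "{x \<in> topspace X. h x \<in> S \<inter> T} = {x \<in> topspace X. h x \<in> S} \<inter> {x \<in> topspace X. h x \<in> T}"
    by auto
  then show "openin X {x \<in> topspace X. h x \<in> S \<inter> T}" using S T by (simp add: openin_Int)
next
  fix \<K>
  assume K: "\<forall>K\<in>\<K>. K \<subseteq> h ` topspace X \<and> openin X {x \<in> topspace X. h x \<in> K}"
  show "\<Union>\<K> \<subseteq> h ` topspace X" using K by blast
  have eq: "{x \<in> topspace X. h x \<in> \<Union>\<K>} = (\<Union>K\<in>\<K>. {x \<in> topspace X. h x \<in> K})" by auto
  show "openin X {x \<in> topspace X. h x \<in> \<Union>\<K>}" unfolding eq using K by blast
qed

lemma openin_quotient_topology:
  "openin (quotient_topology X h) U \<longleftrightarrow>
     U \<subseteq> h ` topspace X \<and> openin X {x \<in> topspace X. h x \<in> U}"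
  unfolding quotient_topology_def by (simp add: topology_inverse'[OF istopology_quotient])

lemma topspace_quotient_topology [simp]:
  "topspace (quotient_topology X h) = h ` topspace X"
proof (rule antisym)
  show "topspace (quotient_topology X h) \<subseteq> h ` topspace X"
    using openin_quotient_topology[of X h "topspace (quotient_topology X h)"] by simp
  have "{x \<in> topspace X. h x \<in> h ` topspace X} = topspace X" by auto
  then have "openin (quotient_topology X h) (h ` topspace X)"
    by (simp add: openin_quotient_topology)
  then show "h ` topspace X \<subseteq> topspace (quotient_topology X h)" by (rule openin_subset)
qed

lemma quotient_map_quotient_topology: "quotient_map X (quotient_topology X h) h"
  by (auto simp: quotient_map_def openin_quotient_topology)

text \<open>
  Real quadratic maps are topologized by their coefficients. As \<open>p\<close> and \<open>q\<close> are
  determined only up to a common factor, this is a quotient of a subspace of six-dimensional space.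
\<close>

fun poly3 :: "real \<times> real \<times> real \<Rightarrow> real poly" where
  "poly3 (a0, a1, a2) = [:a0, a1, a2:]"

definition quad_map_top :: "(rhat \<Rightarrow> rhat) topology" where
  "quad_map_top =
     quotient_topology
       (top_of_set {(a, b). real_quadratic_pair (poly3 a) (poly3 b)})
       (\<lambda>(a, b). rat_map (poly3 a) (poly3 b))"

definition conj_class_top :: "(rhat \<Rightarrow> rhat) set topology" where
  "conj_class_top = quotient_topology quad_map_top conj_class"


subsection \<open>Cyclic order and configurations of points\<close>

text \<open>
  Infinity is placed above all real numbers, by way of \<^typ>\<open>ereal\<close>; the cyclic order
  obtained from the linear one does not depend on where the circle is cut.
\<close>

definition rhat_ereal :: "rhat \<Rightarrow> ereal" where
  "rhat_ereal z = (case z of Some r \<Rightarrow> ereal r | None \<Rightarrow> \<infinity>)"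

definition pos_cyclic :: "rhat \<Rightarrow> rhat \<Rightarrow> rhat \<Rightarrow> bool" where
  "pos_cyclic u v w \<longleftrightarrow>
     (let a = rhat_ereal u; b = rhat_ereal v; c = rhat_ereal w
      in a < b \<and> b < c \<or> b < c \<and> c < a \<or> c < a \<and> a < b)"

definition pos_arc :: "rhat \<Rightarrow> rhat \<Rightarrow> rhat set" where
  "pos_arc a b = {a, b} \<union> {z. pos_cyclic a z b}"

definition preserves_orientation_on :: "(rhat \<Rightarrow> rhat) \<Rightarrow> rhat set \<Rightarrow> bool" where
  "preserves_orientation_on f H \<longleftrightarrow>
     (\<forall>u\<in>H. \<forall>v\<in>H. \<forall>w\<in>H. pos_cyclic u v w \<longrightarrow> pos_cyclic (f u) (f v) (f w))"

definition reverses_orientation_on :: "(rhat \<Rightarrow> rhat) \<Rightarrow> rhat set \<Rightarrow> bool" where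
  "reverses_orientation_on f H \<longleftrightarrow>
     (\<forall>u\<in>H. \<forall>v\<in>H. \<forall>w\<in>H. pos_cyclic u v w \<longrightarrow> pos_cyclic (f w) (f v) (f u))"

text \<open>An \<open>(n + 1)\<close>-tuple is a function on \<open>{..n}\<close>, extended by \<^const>\<open>undefined\<close>.\<close>

definition configs :: "nat \<Rightarrow> (nat \<Rightarrow> rhat) set" where
  "configs n =
     {x \<in> extensional {..n}. inj_on x {..n} \<and>
        (\<forall>i j k. i < j \<and> j < k \<and> k \<le> n \<longrightarrow> pos_cyclic (x i) (x j) (x k))}"

definition config_class :: "nat \<Rightarrow> (nat \<Rightarrow> rhat) \<Rightarrow> (nat \<Rightarrow> rhat) set" where
  "config_class n x = {\<lambda>i\<in>{..n}. g (x i) | g. g \<in> PSL2R}"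

definition configs_top :: "nat \<Rightarrow> (nat \<Rightarrow> rhat) topology" where
  "configs_top n = subtopology (product_topology (\<lambda>_. rhat_top) {..n}) (configs n)"

definition moduli_top :: "nat \<Rightarrow> (nat \<Rightarrow> rhat) set topology" where
  "moduli_top n = quotient_topology (configs_top n) (config_class n)"


subsection \<open>The pull-back for the combinatorics (1, 3, 4, 3, 1, 0)\<close>

definition m_vec :: "nat \<Rightarrow> nat" where
  "m_vec j = [1, 3, 4, 3, 1, 0] ! j"

text \<open>
  \<open>Hp\<close> and \<open>Hm\<close> are the closed half-circles bounded by the critical points. At the indices
  2 and 5, where the branches agree, the branch on \<open>Hp\<close> is used.
\<close>

definition is_pullback :: "(nat \<Rightarrow> rhat) \<Rightarrow> (nat \<Rightarrow> rhat) \<Rightarrow> bool" where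
  "is_pullback x y \<longleftrightarrow>
     (\<exists>f c d Hp Hm.
        real_quadratic_map f \<and> range f = pos_arc (x 0) (x 4) \<and>
        c \<noteq> d \<and> {z. critical_point f z} = {c, d} \<and>
        Hp = pos_arc c d \<and> Hm = pos_arc d c \<and>
        preserves_orientation_on f Hp \<and> reverses_orientation_on f Hm \<and>
        y = (\<lambda>j\<in>{..5}. inv_into (if j \<in> {3, 4} then Hm else Hp) f (x (m_vec j))))"

definition pullback_T :: "(nat \<Rightarrow> rhat) set \<Rightarrow> (nat \<Rightarrow> rhat) set" where
  "pullback_T C = (THE D. \<exists>x\<in>C. \<exists>y. is_pullback x y \<and> D = config_class 5 y)"

definition determines_map :: "(nat \<Rightarrow> rhat) \<Rightarrow> (rhat \<Rightarrow> rhat) \<Rightarrow> bool" where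
  "determines_map x f \<longleftrightarrow>
     real_quadratic_map f \<and> critical_point f (x 2) \<and> critical_point f (x 5) \<and>
     f (x 2) = x 4 \<and> f (x 5) = x 0 \<and> f (x 3) = x 3"

definition map_class :: "(nat \<Rightarrow> rhat) set \<Rightarrow> (rhat \<Rightarrow> rhat) set" where
  "map_class C = (THE F. \<exists>x\<in>C. \<exists>f. determines_map x f \<and> F = conj_class f)"


subsection \<open>Attractors\<close>

text \<open>
  As usual for a global attractor, except that \<open>A\<close> is closed rather than compact (a
  noncompact attractor cannot be avoided here), and that attraction is required for compact sets
  of initial points.
\<close>

definition global_attractor :: "'a topology \<Rightarrow> ('a \<Rightarrow> 'a) \<Rightarrow> 'a set \<Rightarrow> bool" where
  "global_attractor X S A \<longleftrightarrow>
     closedin X A \<and> S ` A = A \<and>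
     (\<forall>K U. compactin X K \<and> openin X U \<and> A \<subseteq> U
        \<longrightarrow> (\<forall>\<^sub>F n in sequentially. (S ^^ n) ` K \<subseteq> U))"

end

theory Submission
  imports Defs
begin

text \<open>
  Every real quadratic map is \<open>\<psi> \<circ> sq \<circ> \<phi>\<close> with Moebius \<open>\<psi>\<close>, \<open>\<phi>\<close> and \<open>sq z = z\<^sup>2\<close>.
  Normalizing \<open>x\<^sub>0 = 0\<close> and \<open>x\<^sub>4 = \<infinity>\<close>, the pulled back points are, up to \<open>G\<close>,
  \<open>(s, 1, \<infinity>, -1, -s, 0)\<close> with \<open>s\<^sup>2 = x\<^sub>1 / x\<^sub>3\<close>: they depend on a single cross ratio. So \<open>T\<close> already
  maps the whole moduli space onto the one-parameter family of these symmetric classes, on which it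
  acts by the involution \<open>s \<mapsto> (1 - s) / (1 + s)\<close>, whose only fixed point is \<open>\<surd>2 - 1\<close>. The map
  determined by the symmetric class is \<open>-s (z\<^sup>2 + t) / (z\<^sup>2 - t)\<close> with \<open>t = (1 - s) / (1 + s)\<close>, and a
  continuous conjugation invariant of quadratic maps, strictly monotone in \<open>s\<close>, shows both that the
  family embeds into the space of conjugacy classes and that the two limits differ.
\<close>

text \<open>The collapse to one parameter happens because \<open>m_vec\<close> takes only the values
  0, 1, 3, 4: the points with indices 2 and 5 are forgotten, and the other four have a single cross
  ratio. All limits are therefore limits of eventually constant sequences, and the work lies
  elsewhere. \<open>pullback_T\<close> and \<open>map_class\<close> are definite descriptions, so
  independence of the chosen quadratic map, of the labelling of its critical points and of the
  representative must be shown for arbitrary admissible data; this is what the normal form is for.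
  Both spaces of classes are quotients, and no separation property of them is established:
  closedness and limits are tested by continuous real functions, built from chord lengths on
  configurations and from coefficients on quadratic maps. Points may lie at infinity, which is why
  determinants of homogeneous coordinates replace differences. A starting class is exceptional when
  its image under T is the fixed point, that is, when its cross ratio is
  \<open>(sqrt 2 - 1)\<^sup>2\<close>; from every other class the even and the odd iterates settle
  on two different classes.\<close>

section \<open>Homogeneous coordinates and Moebius transformations\<close>

text \<open>The determinant of the homogeneous representatives \<open>(x, 1)\<close> of \<open>Some x\<close> and \<open>(1, 0)\<close> of \<open>None\<close>.\<close>

definition hdet :: "rhat \<Rightarrow> rhat \<Rightarrow> real" where
  "hdet u v = (case u of Some x \<Rightarrow> (case v of Some y \<Rightarrow> x - y | None \<Rightarrow> - 1)
                     | None \<Rightarrow> (case v of Some y \<Rightarrow> 1 | None \<Rightarrow> 0))"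

lemma hdet_simps [simp]:
  "hdet (Some x) (Some y) = x - y" "hdet (Some x) None = - 1"
  "hdet None (Some y) = 1" "hdet None None = 0"
  by (simp_all add: hdet_def)

lemma hdet_eq_0_iff [simp]: "hdet u v = 0 \<longleftrightarrow> u = v"
  by (cases u; cases v) auto

lemma hdet_self [simp]: "hdet u u = 0"
  by simp

lemma pos_cyclic_simps [simp]:
  "pos_cyclic (Some a) (Some b) (Some c) \<longleftrightarrow> a < b \<and> b < c \<or> b < c \<and> c < a \<or> c < a \<and> a < b"
  "pos_cyclic None (Some b) (Some c) \<longleftrightarrow> b < c"
  "pos_cyclic (Some a) None (Some c) \<longleftrightarrow> c < a"
  "pos_cyclic (Some a) (Some b) None \<longleftrightarrow> a < b"
  "\<not> pos_cyclic None None w" "\<not> pos_cyclic None v None" "\<not> pos_cyclic u None None"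
  by (cases u; cases v; cases w; auto simp: pos_cyclic_def rhat_ereal_def)+

text \<open>Every point occurs in two of the three factors, so rescaling its homogeneous
  representative multiplies the product by a square. The sign is thus well defined, and invariance
  under \<open>PSL2R\<close> becomes a computation with \<open>PSL2R_hdet\<close>.\<close>

lemma pos_cyclic_hdet: "pos_cyclic u v w \<longleftrightarrow> hdet u v * hdet v w * hdet w u > 0"
proof -
  have "(a < b \<and> b < c \<or> b < c \<and> c < a \<or> c < a \<and> a < b) \<longleftrightarrow> (a - b) * (b - c) * (c - a) > 0"
    for a b c :: real
    by (auto simp: zero_less_mult_iff mult_less_0_iff)
  then show ?thesis
    by (cases u; cases v; cases w) auto
qed

text \<open>The point with homogeneous coordinates \<open>(x : y)\<close>; meaningless for \<open>(0, 0)\<close>.\<close>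

definition hpt :: "real \<Rightarrow> real \<Rightarrow> rhat" where
  "hpt x y = (if y = 0 then None else Some (x / y))"

lemma hpt_cases:
  obtains x y where "z = hpt x y" "(x, y) \<noteq> (0, 0)"
proof (cases z)
  case None
  then show ?thesis using that[of 1 0] by (simp add: hpt_def)
next
  case (Some r)
  then show ?thesis using that[of r 1] by (simp add: hpt_def)
qed

lemma hpt_scale: "k \<noteq> 0 \<Longrightarrow> hpt (k * x) (k * y) = hpt x y"
  by (simp add: hpt_def)

lemma hpt_eq_iff:
  assumes "(x, y) \<noteq> (0, 0)" "(x', y') \<noteq> (0, 0)"
  shows "hpt x y = hpt x' y' \<longleftrightarrow> x * y' = x' * y"
  using assms by (auto simp: hpt_def field_simps)

definition mob :: "real \<Rightarrow> real \<Rightarrow> real \<Rightarrow> real \<Rightarrow> rhat \<Rightarrow> rhat" where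
  "mob a b c d = rat_map [:b, a:] [:d, c:]"

lemma linear_nonzero:
  fixes a b c d x y :: real
  assumes "a * d - b * c \<noteq> 0" "(x, y) \<noteq> (0, 0)"
  shows "(a * x + b * y, c * x + d * y) \<noteq> (0, 0)"
proof
  assume "(a * x + b * y, c * x + d * y) = (0, 0)"
  then have "a * x + b * y = 0" "c * x + d * y = 0" by auto
  then have "(a * d - b * c) * x = 0" "(a * d - b * c) * y = 0" by algebra+
  then show False using assms by auto
qed

lemma mob_hpt:
  assumes "a * d - b * c \<noteq> 0" "(x, y) \<noteq> (0, 0)"
  shows "mob a b c d (hpt x y) = hpt (a * x + b * y) (c * x + d * y)"
proof (cases "y = 0")
  case True
  have "max (degree [:b, a:]) (degree [:d, c:]) = 1" using assms by auto
  then show ?thesis using True assms by (simp add: mob_def rat_map_def hpt_def)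
next
  case False
  have "poly [:b, a:] (x / y) = (a * x + b * y) / y" "poly [:d, c:] (x / y) = (c * x + d * y) / y"
    using False by (simp_all add: field_simps)
  then show ?thesis using False by (simp add: mob_def rat_map_def hpt_def)
qed

lemma mob_mob:
  assumes "a * d - b * c \<noteq> 0" "a' * d' - b' * c' \<noteq> 0"
  shows "mob a b c d \<circ> mob a' b' c' d'
       = mob (a * a' + b * c') (a * b' + b * d') (c * a' + d * c') (c * b' + d * d')"
proof
  fix z
  obtain x y where z: "z = hpt x y" "(x, y) \<noteq> (0, 0)" by (rule hpt_cases)
  have "(a * a' + b * c') * (c * b' + d * d') - (a * b' + b * d') * (c * a' + d * c')
      = (a * d - b * c) * (a' * d' - b' * c')" by algebra
  then have ne: "(a * a' + b * c') * (c * b' + d * d') - (a * b' + b * d') * (c * a' + d * c') \<noteq> 0"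
    using assms by simp
  show "(mob a b c d \<circ> mob a' b' c' d') z
       = mob (a * a' + b * c') (a * b' + b * d') (c * a' + d * c') (c * b' + d * d') z"
    unfolding z(1) o_def mob_hpt[OF assms(2) z(2)] mob_hpt[OF ne z(2)]
      mob_hpt[OF assms(1) linear_nonzero[OF assms(2) z(2)]]
    by (simp add: algebra_simps)
qed

lemma mob_id: "k \<noteq> 0 \<Longrightarrow> mob k 0 0 k = id"
proof
  fix z
  assume k: "k \<noteq> 0"
  obtain x y where z: "z = hpt x y" "(x, y) \<noteq> (0, 0)" by (rule hpt_cases)
  show "mob k 0 0 k z = id z"
    using mob_hpt[of k k 0 0 x y] k z by (simp add: hpt_scale)
qed

lemma PSL2R_mob: "PSL2R = {mob a b c d | a b c d. a * d - b * c = 1}"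
  by (simp add: PSL2R_def mob_def)

lemma PSL2R_E:
  assumes "g \<in> PSL2R"
  obtains a b c d where "g = mob a b c d" "a * d - b * c = 1"
  using assms unfolding PSL2R_mob by blast

text \<open>Multiplying all entries by the inverse square root \<open>k\<close> of the determinant
  leaves the map unchanged and makes the determinant 1.\<close>

lemma mob_in_PSL2R:
  assumes "a * d - b * c > 0"
  shows "mob a b c d \<in> PSL2R"
proof -
  define k where "k = 1 / sqrt (a * d - b * c)"
  have k: "k \<noteq> 0" "k * k * (a * d - b * c) = 1"
    using assms by (auto simp: k_def)
  have "mob k 0 0 k \<circ> mob a b c d = mob (k * a) (k * b) (k * c) (k * d)"
    using mob_mob[of k k 0 0 a d b c] k assms by simp
  then have "mob a b c d = mob (k * a) (k * b) (k * c) (k * d)"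
    using mob_id[OF k(1)] by simp
  moreover have "(k * a) * (k * d) - (k * b) * (k * c) = 1"
    using k(2) by (simp add: algebra_simps)
  ultimately show ?thesis unfolding PSL2R_mob by blast
qed

lemma id_in_PSL2R: "id \<in> PSL2R"
  using mob_in_PSL2R[of 1 1 0 0] mob_id[of 1] by simp

lemma PSL2R_comp:
  assumes "g \<in> PSL2R" "h \<in> PSL2R"
  shows "g \<circ> h \<in> PSL2R"
proof -
  obtain a b c d where g: "g = mob a b c d" "a * d - b * c = 1" using assms(1) by (rule PSL2R_E)
  obtain a' b' c' d' where h: "h = mob a' b' c' d'" "a' * d' - b' * c' = 1"
    using assms(2) by (rule PSL2R_E)
  have "(a * a' + b * c') * (c * b' + d * d') - (a * b' + b * d') * (c * a' + d * c')
      = (a * d - b * c) * (a' * d' - b' * c')" by algebra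
  then show ?thesis unfolding g(1) h(1) using g(2) h(2)
    by (subst mob_mob) (auto intro: mob_in_PSL2R)
qed

lemma mob_inverse:
  assumes "a * d - b * c = 1"
  shows "mob a b c d \<circ> mob d (- b) (- c) a = id" "mob d (- b) (- c) a \<circ> mob a b c d = id"
  using mob_mob[of a d b c d a "- b" "- c"] mob_mob[of d a "- b" "- c" a d b c] assms mob_id[of 1]
  by (simp_all add: algebra_simps)

lemma PSL2R_inverse:
  assumes "g \<in> PSL2R"
  obtains h where "h \<in> PSL2R" "g \<circ> h = id" "h \<circ> g = id"
proof -
  obtain a b c d where g: "g = mob a b c d" "a * d - b * c = 1" using assms by (rule PSL2R_E)
  show ?thesis
    using that[of "mob d (- b) (- c) a"] mob_inverse[OF g(2)] g mob_in_PSL2R[of d a "- b" "- c"]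
    by (simp add: algebra_simps)
qed

lemma PSL2R_bij: "g \<in> PSL2R \<Longrightarrow> bij g"
  by (metis PSL2R_inverse o_bij)

text \<open>
  The factor \<open>m z\<close> is the ratio between the representative of \<open>g z\<close> and the image of that of \<open>z\<close>.
\<close>

lemma PSL2R_hdet:
  assumes "g \<in> PSL2R"
  obtains m where "\<forall>z. m z \<noteq> 0" "\<forall>u v. hdet (g u) (g v) = m u * m v * hdet u v"
proof -
  obtain a b c d where g: "g = mob a b c d" "a * d - b * c = 1" using assms by (rule PSL2R_E)
  \<comment> \<open>The matrix sends the representative \<open>(x, 1)\<close> to
    \<open>(a * x + b, c * x + d)\<close>. Dividing by \<open>c * x + d\<close> gives the
    representative of a finite image, dividing by \<open>a * x + b\<close> that of infinity.\<close>
  define m where "m z = (case z of Some x \<Rightarrow> if c * x + d = 0 then 1 / (a * x + b) else 1 / (c * x + d)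
     | None \<Rightarrow> if c = 0 then 1 / a else 1 / c)" for z
  have deg: "max (degree [:b, a:]) (degree [:d, c:]) = 1" using g by auto
  have gS: "g (Some x) = (if c * x + d = 0 then None else Some ((a * x + b) / (c * x + d)))" for x
    by (simp add: g mob_def rat_map_def algebra_simps)
  have gN: "g None = (if c = 0 then None else Some (a / c))"
    using deg by (simp add: g mob_def rat_map_def)
  have nz: "a * x + b \<noteq> 0" if "c * x + d = 0" for x
    using linear_nonzero[of a d b c x 1] that g by auto
  have nz2: "a \<noteq> 0" if "c = 0" using that g by auto
  have 1: "m z \<noteq> 0" for z
    using nz nz2 by (auto simp: m_def split: option.split)
  have e1: "(a * x + b) / (c * x + d) - (a * y + b) / (c * y + d) = (x - y) / ((c * x + d) * (c * y + d))"
    if "c * x + d \<noteq> 0" "c * y + d \<noteq> 0" for x y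
  proof -
    have "(a * x + b) * (c * y + d) - (a * y + b) * (c * x + d) = (a * d - b * c) * (x - y)" by algebra
    then show ?thesis using that g(2) by (simp add: divide_simps)
  qed
  have e2: "(a * x + b) * (c * y + d) = x - y"
    if "c * x + d = 0" for x y using that g(2) by algebra
  have e3: "(a * x + b) * c = - 1" if "c * x + d = 0" for x using that g(2) by algebra
  have e5: "c * (a * x + b) = - 1 + a * (c * x + d)" for x using g(2) by algebra
  have 2: "hdet (g u) (g v) = m u * m v * hdet u v" for u v
  proof (cases u; cases v)
    fix x y assume uv: "u = Some x" "v = Some y"
    show ?thesis
    proof (cases "c * x + d = 0"; cases "c * y + d = 0")
      assume "c * x + d = 0" "c * y + d = 0"
      then have "c * (x - y) = 0" by algebra
      moreover have "c \<noteq> 0" using \<open>c * x + d = 0\<close> g(2) by auto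
      ultimately show ?thesis by (simp add: uv)
    next
      assume h: "c * x + d = 0" "c * y + d \<noteq> 0"
      then show ?thesis using e2[OF h(1), of y] nz[OF h(1)]
        by (auto simp: uv gS m_def divide_simps)
    next
      assume h: "c * x + d \<noteq> 0" "c * y + d = 0"
      then show ?thesis using e2[OF h(2), of x] nz[OF h(2)]
        by (auto simp: uv gS m_def divide_simps mult.commute)
    next
      assume h: "c * x + d \<noteq> 0" "c * y + d \<noteq> 0"
      then show ?thesis using e1[OF h] by (simp add: uv gS m_def)
    qed
  next
    fix x assume uv: "u = Some x" "v = None"
    show ?thesis
      using nz[of x] nz2 e3[of x] e5[of x] g(2)
      by (auto simp: uv gS gN m_def divide_simps split: if_splits) (auto simp: algebra_simps)
  next
    fix x assume uv: "u = None" "v = Some x"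
    show ?thesis
      using nz[of x] nz2 e3[of x] e5[of x] g(2)
      by (auto simp: uv gS gN m_def divide_simps split: if_splits) (auto simp: algebra_simps)
  next
    assume uv: "u = None" "v = None"
    then show ?thesis by simp
  qed
  show ?thesis by (rule that[of m]) (use 1 2 in auto)
qed

section \<open>Orientation, arcs and pairs of points under the action of
  \<open>PSL2R\<close>\<close>

lemma pos_cyclic_PSL2R:
  assumes "g \<in> PSL2R"
  shows "pos_cyclic (g u) (g v) (g w) \<longleftrightarrow> pos_cyclic u v w"
proof -
  obtain m where m: "\<forall>z. m z \<noteq> 0" "\<forall>u v. hdet (g u) (g v) = m u * m v * hdet u v"
    using assms by (rule PSL2R_hdet)
  have "hdet (g u) (g v) * hdet (g v) (g w) * hdet (g w) (g u)
      = (m u * m v * m w)\<^sup>2 * (hdet u v * hdet v w * hdet w u)"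
    by (simp add: m(2) power2_eq_square algebra_simps)
  moreover have "(m u * m v * m w)\<^sup>2 > 0" using m(1) by simp
  ultimately show ?thesis unfolding pos_cyclic_hdet by (simp add: zero_less_mult_iff)
qed

lemma pos_arc_PSL2R:
  assumes "g \<in> PSL2R"
  shows "g ` pos_arc u v = pos_arc (g u) (g v)"
proof -
  have "bij g" using assms by (rule PSL2R_bij)
  then have "g ` {z. pos_cyclic u z v} = {z. pos_cyclic (g u) z (g v)}"
    using pos_cyclic_PSL2R[OF assms] by (force simp: bij_def surj_def image_iff)
  then show ?thesis by (simp add: pos_arc_def)
qed

lemma PSL2R_0_infinity:
  assumes "u \<noteq> v"
  obtains g where "g \<in> PSL2R" "g u = Some 0" "g v = None"
proof -
  obtain x y where u: "u = hpt x y" "(x, y) \<noteq> (0, 0)" by (rule hpt_cases)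
  obtain x' y' where v: "v = hpt x' y'" "(x', y') \<noteq> (0, 0)" by (rule hpt_cases)
  define k where "k = x * y' - x' * y"
  have k: "k \<noteq> 0" using assms u v hpt_eq_iff[OF u(2) v(2)] by (auto simp: k_def)
  have k': "x * y' \<noteq> y * x'" using k by (simp add: k_def mult.commute)
  have det: "(k * y) * (- x') - (- (k * x)) * y' = k * k"
    by (simp add: k_def algebra_simps)
  then have det0: "(k * y) * (- x') - (- (k * x)) * y' > 0" using k
    by (metis not_square_less_zero linorder_neqE_linordered_idom mult_eq_0_iff)
  \<comment> \<open>The first row vanishes on the representative of \<open>u\<close>, the second on
    that of \<open>v\<close>. Without the factor \<open>k\<close> in the first row the determinant
    would be \<open>k\<close>, of unknown sign; with it the determinant is
    \<open>k * k\<close>.\<close>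
  define g where "g = mob (k * y) (- (k * x)) y' (- x')"
  have "g \<in> PSL2R" unfolding g_def using det0 by (rule mob_in_PSL2R)
  moreover have "g u = Some 0"
  proof -
    have "k * y * x + - (k * x) * y = 0" "y' * x + - x' * y = k" by (simp_all add: k_def)
    then show ?thesis unfolding g_def u(1) using det0 k k'
      by (subst mob_hpt[OF _ u(2)]) (auto simp: hpt_def mult.commute)
  qed
  moreover have "g v = None"
    unfolding g_def v(1) using det0 k'
    by (subst mob_hpt[OF _ v(2)]) (auto simp: hpt_def)
  ultimately show ?thesis by (rule that)
qed

section \<open>Quadratic maps and their critical points\<close>

definition quad_map :: "'a::field \<Rightarrow> 'a \<Rightarrow> 'a \<Rightarrow> 'a \<Rightarrow> 'a \<Rightarrow> 'a \<Rightarrow> 'a option \<Rightarrow> 'a option" where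
  "quad_map p0 p1 p2 q0 q1 q2 = rat_map [:p0, p1, p2:] [:q0, q1, q2:]"

text \<open>
  The resultant of numerator and denominator. It is also a quarter of the discriminant of the
  Wronskian, whose roots are the critical points; so it is positive iff these are real and distinct.
\<close>

definition qres :: "'a::field \<Rightarrow> 'a \<Rightarrow> 'a \<Rightarrow> 'a \<Rightarrow> 'a \<Rightarrow> 'a \<Rightarrow> 'a" where
  "qres p0 p1 p2 q0 q1 q2 =
     (p2 * q0 - p0 * q2)\<^sup>2 - (p1 * q0 - p0 * q1) * (p2 * q1 - p1 * q2)"

lemma no_common_zero:
  assumes "qres p0 p1 p2 q0 q1 q2 \<noteq> 0"
  shows "poly [:p0, p1, p2:] z \<noteq> 0 \<or> poly [:q0, q1, q2:] z \<noteq> 0"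
proof (rule ccontr)
  assume "\<not> ?thesis"
  then have "p0 + z * (p1 + z * p2) = 0" "q0 + z * (q1 + z * q2) = 0" by auto
  then have "qres p0 p1 p2 q0 q1 q2 = 0" unfolding qres_def by algebra
  then show False using assms by simp
qed

lemma critical_point_rat_map_Some:
  fixes p q :: "'a::real_normed_field poly"
  assumes "poly p z \<noteq> 0 \<or> poly q z \<noteq> 0"
  shows "critical_point (rat_map p q) (Some z) \<longleftrightarrow>
    poly (pderiv p) z * poly q z - poly p z * poly (pderiv q) z = 0"
proof (cases "poly q z = 0")
  case False
  define F where "F w = local_coord (rat_map p q (Some z)) (rat_map p q (local_param (Some z) w))" for w
  define D where "D = (poly (pderiv p) z * poly q z - poly p z * poly (pderiv q) z) / (poly q z)\<^sup>2"
  have "((\<lambda>w. poly p (z + w) / poly q (z + w) - poly p z / poly q z) has_field_derivative D) (at 0)"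
    unfolding D_def using False
    by (auto intro!: derivative_eq_intros poly_DERIV[THEN DERIV_chain2] simp: power2_eq_square)
  \<comment> \<open>The formula is only local: at a pole \<open>local_coord\<close> returns a
    default value, so poles have to be kept away.\<close>
  moreover have "open ((\<lambda>w. poly q (z + w)) -` (- {0}))"
    by (intro open_vimage) (auto intro!: continuous_intros)
  moreover have "0 \<in> (\<lambda>w. poly q (z + w)) -` (- {0})" using False by simp
  moreover have "poly p (z + w) / poly q (z + w) - poly p z / poly q z = F w"
    if "w \<in> (\<lambda>w. poly q (z + w)) -` (- {0})" for w
    using that False by (simp add: F_def rat_map_def local_coord_def local_param_def)
  ultimately have F: "(F has_field_derivative D) (at 0)"
    by (rule has_field_derivative_transform_within_open)
  have "critical_point (rat_map p q) (Some z) \<longleftrightarrow> (F has_field_derivative 0) (at 0)"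
    unfolding critical_point_def F_def ..
  also have "\<dots> \<longleftrightarrow> D = 0" using F DERIV_unique by blast
  also have "\<dots> \<longleftrightarrow> poly (pderiv p) z * poly q z - poly p z * poly (pderiv q) z = 0"
    using False by (simp add: D_def)
  finally show ?thesis .
next
  case True
  then have p: "poly p z \<noteq> 0" using assms by simp
  define F where "F w = local_coord (rat_map p q (Some z)) (rat_map p q (local_param (Some z) w))" for w
  define D where "D = (poly (pderiv q) z * poly p z - poly q z * poly (pderiv p) z) / (poly p z)\<^sup>2"
  have "((\<lambda>w. poly q (z + w) / poly p (z + w)) has_field_derivative D) (at 0)"
    unfolding D_def using p
    by (auto intro!: derivative_eq_intros poly_DERIV[THEN DERIV_chain2] simp: power2_eq_square)
  \<comment> \<open>At a pole the target coordinate is the reciprocal, so numerator and denominator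
    change places and the Wronskian changes sign. The equality holds for every \<open>w\<close>: at
    a pole both sides are 0 by the default of \<open>local_coord\<close>, at a zero of
    \<open>p\<close> because division by zero gives 0.\<close>
  moreover have "F = (\<lambda>w. poly q (z + w) / poly p (z + w))"
    using True by (auto simp: F_def rat_map_def local_coord_def local_param_def)
  ultimately have F: "(F has_field_derivative D) (at 0)" by simp
  have "critical_point (rat_map p q) (Some z) \<longleftrightarrow> (F has_field_derivative 0) (at 0)"
    unfolding critical_point_def F_def ..
  also have "\<dots> \<longleftrightarrow> D = 0" using F DERIV_unique by blast
  also have "\<dots> \<longleftrightarrow> poly (pderiv p) z * poly q z - poly p z * poly (pderiv q) z = 0"
    using True p by (simp add: D_def)
  finally show ?thesis .
qed

lemma critical_point_quad_map_Some:
  fixes p0 :: "'a::real_normed_field"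
  assumes "qres p0 p1 p2 q0 q1 q2 \<noteq> 0"
  shows "critical_point (quad_map p0 p1 p2 q0 q1 q2) (Some z) \<longleftrightarrow>
    (p1 * q0 - p0 * q1) + 2 * (p2 * q0 - p0 * q2) * z + (p2 * q1 - p1 * q2) * z\<^sup>2 = 0"
proof -
  have "poly (pderiv [:p0, p1, p2:]) z * poly [:q0, q1, q2:] z
      - poly [:p0, p1, p2:] z * poly (pderiv [:q0, q1, q2:]) z
      = (p1 * q0 - p0 * q1) + 2 * (p2 * q0 - p0 * q2) * z + (p2 * q1 - p1 * q2) * z\<^sup>2"
    by (simp add: pderiv_pCons algebra_simps power2_eq_square)
  then show ?thesis
    unfolding quad_map_def critical_point_rat_map_Some[OF no_common_zero[OF assms]] by simp
qed

lemma max_degree_quadratic: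
  "max (degree [:p0, p1, p2:]) (degree [:q0, q1, q2:]) = 2 \<longleftrightarrow> p2 \<noteq> 0 \<or> q2 \<noteq> 0"
  by auto

lemma qres_nonzero_degree:
  assumes "qres p0 p1 p2 q0 q1 q2 \<noteq> 0"
  shows "p2 \<noteq> 0 \<or> q2 \<noteq> 0"
  using assms by (auto simp: qres_def)

lemma quad_map_None:
  assumes "qres p0 p1 p2 q0 q1 q2 \<noteq> 0"
  shows "quad_map p0 p1 p2 q0 q1 q2 None = (if q2 = 0 then None else Some (p2 / q2))"
  using qres_nonzero_degree[OF assms]
  unfolding quad_map_def rat_map_def option.case Let_def
    max_degree_quadratic[THEN iffD2, OF qres_nonzero_degree[OF assms]]
  by (simp add: numeral_2_eq_2)

text \<open>In the coordinate \<open>1 / z\<close> the coefficients of numerator and denominator are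
  reversed, which reduces the claim to the point 0 of the reversed map.\<close>

lemma critical_point_quad_map_None:
  fixes p0 :: "'a::real_normed_field"
  assumes "qres p0 p1 p2 q0 q1 q2 \<noteq> 0"
  shows "critical_point (quad_map p0 p1 p2 q0 q1 q2) None \<longleftrightarrow> p2 * q1 - p1 * q2 = 0"
proof -
  have rs': "qres p2 p1 p0 q2 q1 q0 \<noteq> 0"
    using assms by (simp add: qres_def power2_eq_square algebra_simps)
  have eq: "quad_map p0 p1 p2 q0 q1 q2 (local_param None w) = quad_map p2 p1 p0 q2 q1 q0 (local_param (Some 0) w)" for w
  proof (cases "w = 0")
    case True
    then show ?thesis
      using quad_map_None[OF assms] by (simp add: local_param_def quad_map_def rat_map_def)
  next
    case False
    have "poly [:p0, p1, p2:] (1 / w) = poly [:p2, p1, p0:] w / w\<^sup>2"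
         "poly [:q0, q1, q2:] (1 / w) = poly [:q2, q1, q0:] w / w\<^sup>2"
      using False by (simp_all add: field_simps power2_eq_square)
    then show ?thesis using False unfolding local_param_def quad_map_def rat_map_def by simp
  qed
  have e0: "quad_map p0 p1 p2 q0 q1 q2 None = quad_map p2 p1 p0 q2 q1 q0 (Some 0)"
    using eq[of 0] by (simp add: local_param_def)
  have "critical_point (quad_map p0 p1 p2 q0 q1 q2) None \<longleftrightarrow> critical_point (quad_map p2 p1 p0 q2 q1 q0) (Some 0)"
    using e0 unfolding critical_point_def eq by simp
  then show ?thesis unfolding critical_point_quad_map_Some[OF rs'] by (auto simp: algebra_simps)
qed

text \<open>Write p, q for the two polynomials and A for \<open>p1 * q0 - p0 * q1\<close>. Then q1 p
  - p1 q = E x^2 - A and q2 p - p2 q = -(E x + B). Weighting the first with E and the second with E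
  x - B cancels x and leaves B^2 - A E, which is the resultant.\<close>

lemma quadratic_bezout:
  fixes p0 :: real
  assumes "qres p0 p1 p2 q0 q1 q2 \<noteq> 0"
  shows "\<exists>u v. [:p0, p1, p2:] * u + [:q0, q1, q2:] * v = 1"
proof -
  define B E R where "B = p2 * q0 - p0 * q2" and "E = p2 * q1 - p1 * q2"
    and "R = qres p0 p1 p2 q0 q1 q2"
  define k where "k = 1 / R"
  have "[:p0, p1, p2:] * smult k ([:E * q1:] + [:- B, E:] * [:q2:])
      + [:q0, q1, q2:] * smult k (- ([:E * p1:] + [:- B, E:] * [:p2:])) = 1"
  proof (rule poly_eq_poly_eq_iff[THEN iffD1], rule ext)
    fix x
    let ?e = "(p0 + x * (p1 + x * p2)) * (E * q1 + (x * E - B) * q2)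
      - (q0 + x * (q1 + x * q2)) * (E * p1 + (x * E - B) * p2)"
    have "poly ([:p0, p1, p2:] * smult k ([:E * q1:] + [:- B, E:] * [:q2:])
      + [:q0, q1, q2:] * smult k (- ([:E * p1:] + [:- B, E:] * [:p2:]))) x = k * ?e"
      by (simp add: algebra_simps)
    also have "?e = R" unfolding B_def E_def R_def qres_def by algebra
    also have "k * R = poly 1 x" using assms by (simp add: R_def k_def)
    finally show "poly ([:p0, p1, p2:] * smult k ([:E * q1:] + [:- B, E:] * [:q2:])
      + [:q0, q1, q2:] * smult k (- ([:E * p1:] + [:- B, E:] * [:p2:]))) x = poly 1 x" .
  qed
  then show ?thesis by blast
qed

lemma coprime_quadratics:
  fixes p0 :: real
  assumes "qres p0 p1 p2 q0 q1 q2 \<noteq> 0"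
  shows "coprime [:p0, p1, p2:] [:q0, q1, q2:]"
proof (rule coprimeI)
  fix d assume "d dvd [:p0, p1, p2:]" "d dvd [:q0, q1, q2:]"
  then show "is_unit d" using quadratic_bezout[OF assms] by (metis dvd_add dvd_mult2)
qed

text \<open>With the Wronskian written as A + 2 B z + E z^2, \<open>qres\<close> is B^2 - A E. A
  negative value produces a non-real critical point; the value zero produces a common factor or too
  small a degree. Coprimality, degree and reality of the critical points thus condense into one
  inequality.\<close>

lemma real_quadratic_pair_iff:
  "real_quadratic_pair [:p0, p1, p2:] [:q0, q1, q2:] \<longleftrightarrow> qres p0 p1 p2 q0 q1 q2 > 0"
proof
  assume qres: "qres p0 p1 p2 q0 q1 q2 > 0"
  let ?c = "complex_of_real"
  define A B E where "A = p1 * q0 - p0 * q1" and "B = p2 * q0 - p0 * q2" and "E = p2 * q1 - p1 * q2"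
  have rsc: "qres (?c p0) (?c p1) (?c p2) (?c q0) (?c q1) (?c q2) = ?c (qres p0 p1 p2 q0 q1 q2)"
    by (simp add: qres_def)
  then have rsc0: "qres (?c p0) (?c p1) (?c p2) (?c q0) (?c q1) (?c q2) \<noteq> 0" using qres by simp
  have mp: "rat_map (map_poly ?c [:p0, p1, p2:]) (map_poly ?c [:q0, q1, q2:])
     = quad_map (?c p0) (?c p1) (?c p2) (?c q0) (?c q1) (?c q2)"
    by (simp add: quad_map_def map_poly_pCons)
  have crit: "c \<in> range (map_option ?c)"
    if cp: "critical_point (quad_map (?c p0) (?c p1) (?c p2) (?c q0) (?c q1) (?c q2)) c" for c
  proof (cases c)
    case None
    then show ?thesis by (metis option.simps(8) rangeI)
  next
    case (Some w)
    have "?c A + 2 * ?c B * w + ?c E * w\<^sup>2 = 0"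
      using cp unfolding Some critical_point_quad_map_Some[OF rsc0] by (simp add: A_def B_def E_def)
    then have eq: "(?c E * w + ?c B)\<^sup>2 = ?c (B\<^sup>2 - A * E)"
      unfolding of_real_diff of_real_mult of_real_power by algebra
    define R where "R = sqrt (B\<^sup>2 - A * E)"
    have R: "R > 0" "R\<^sup>2 = B\<^sup>2 - A * E"
      using qres by (auto simp: R_def qres_def A_def B_def E_def)
    have "(?c E * w + ?c B)\<^sup>2 = (?c R)\<^sup>2" using eq R(2) by (metis of_real_power)
    then have w: "?c E * w + ?c B = ?c R \<or> ?c E * w + ?c B = - ?c R"
      by (simp add: power2_eq_iff)
    have "w \<in> range ?c"
    proof (cases "E = 0")
      case True
      have "B \<noteq> 0" using R True by auto
      then have "w = ?c (- A / (2 * B))"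
        using \<open>?c A + 2 * ?c B * w + ?c E * w\<^sup>2 = 0\<close> True
        by (simp add: field_simps add_eq_0_iff)
      then show ?thesis by blast
    next
      case False
      then have "w = ?c ((R - B) / E) \<or> w = ?c ((- R - B) / E)"
        using w by (auto simp: field_simps)
      then show ?thesis by blast
    qed
    then show ?thesis using Some by (metis (no_types) imageE option.simps(9) rangeI)
  qed
  show "real_quadratic_pair [:p0, p1, p2:] [:q0, q1, q2:]"
    unfolding real_quadratic_pair_def mp max_degree_quadratic
    using crit coprime_quadratics[of p0 p1 p2 q0 q1 q2] qres qres_nonzero_degree[of p0 p1 p2 q0 q1 q2] by auto
next
  let ?c = "complex_of_real"
  assume rqp: "real_quadratic_pair [:p0, p1, p2:] [:q0, q1, q2:]"
  define A B E where "A = p1 * q0 - p0 * q1" and "B = p2 * q0 - p0 * q2" and "E = p2 * q1 - p1 * q2"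
  have R: "qres p0 p1 p2 q0 q1 q2 = B\<^sup>2 - A * E" by (simp add: qres_def A_def B_def E_def)
  have cop: "coprime [:p0, p1, p2:] [:q0, q1, q2:]" and deg: "p2 \<noteq> 0 \<or> q2 \<noteq> 0"
    using rqp unfolding real_quadratic_pair_def max_degree_quadratic by auto
  have mp: "rat_map (map_poly ?c [:p0, p1, p2:]) (map_poly ?c [:q0, q1, q2:])
     = quad_map (?c p0) (?c p1) (?c p2) (?c q0) (?c q1) (?c q2)"
    by (simp add: quad_map_def map_poly_pCons)
  show "qres p0 p1 p2 q0 q1 q2 > 0"
  proof (rule ccontr)
    assume "\<not> ?thesis"
    then consider "qres p0 p1 p2 q0 q1 q2 < 0" | "qres p0 p1 p2 q0 q1 q2 = 0" by linarith
    then show False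
    proof cases
      case 1
      have rsc: "qres (?c p0) (?c p1) (?c p2) (?c q0) (?c q1) (?c q2) = ?c (qres p0 p1 p2 q0 q1 q2)"
        by (simp add: qres_def)
      then have rsc0: "qres (?c p0) (?c p1) (?c p2) (?c q0) (?c q1) (?c q2) \<noteq> 0" using 1 by simp
      have E: "E \<noteq> 0" using 1 R by auto
      define k where "k = sqrt (A * E - B\<^sup>2)"
      have k: "k \<noteq> 0" "k\<^sup>2 = A * E - B\<^sup>2" using 1 R by (auto simp: k_def)
      \<comment> \<open>A root of the Wronskian from the quadratic formula, with nonzero imaginary
        part \<open>k / E\<close>.\<close>
      define w where "w = Complex (- B / E) (k / E)"
      have "?c E * w = Complex (- B) k" using E by (simp add: w_def complex_eq_iff)
      then have "(?c E * w + ?c B)\<^sup>2 = ?c (B\<^sup>2 - A * E)"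
        using k(2) by (simp add: complex_eq_iff power2_eq_square)
      then have "?c E * (?c A + 2 * ?c B * w + ?c E * w\<^sup>2) = 0"
        unfolding of_real_diff of_real_mult of_real_power by algebra
      then have "?c A + 2 * ?c B * w + ?c E * w\<^sup>2 = 0" using E by simp
      then have "critical_point (quad_map (?c p0) (?c p1) (?c p2) (?c q0) (?c q1) (?c q2)) (Some w)"
        unfolding critical_point_quad_map_Some[OF rsc0] by (simp add: A_def B_def E_def)
      then have "Some w \<in> range (map_option ?c)"
        using rqp unfolding real_quadratic_pair_def mp by blast
      then obtain r where "w = ?c r" by (auto simp: map_option_case split: option.splits)
      then show False using k E by (simp add: w_def complex_eq_iff)
    next
      case 2
      have noroot: False if "p0 + z * (p1 + z * p2) = 0" "q0 + z * (q1 + z * q2) = 0" for z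
      proof -
        have "[:- z, 1:] dvd [:p0, p1, p2:]" "[:- z, 1:] dvd [:q0, q1, q2:]"
          using that by (simp_all add: poly_eq_0_iff_dvd[symmetric])
        then have "is_unit [:- z, 1:]" using cop coprime_common_divisor by blast
        then show False by (simp add: is_unit_iff_degree)
      qed
      consider "E \<noteq> 0" | "E = 0" "B = 0" "A \<noteq> 0" | "E = 0" "B = 0" "A = 0" using 2 R by force
      then show False
      proof cases
        case 1
        \<comment> \<open>The double root of the Wronskian turns out to be a common zero of
          numerator and denominator.\<close>
        define z where "z = - B / E"
        have Ez: "E * z = - B" using 1 by (simp add: z_def)
        have AE: "B\<^sup>2 = A * E" using 2 R by simp
        have Az: "E * (A + B * z) = 0" using Ez AE by algebra
        then have Az: "A + B * z = 0" using 1 by simp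
        have "E * (p0 + z * (p1 + z * p2)) = 0" "E * (q0 + z * (q1 + z * q2)) = 0"
          using Ez Az unfolding A_def B_def E_def by algebra+
        then show False using noroot 1 by simp
      next
        case 2
        \<comment> \<open>Both identities expand a 3-by-3 determinant with a repeated row. Here they
          say that the common zero lies at infinity, against the degree condition.\<close>
        have "A * p2 = p1 * B - p0 * E" "A * q2 = q1 * B - q0 * E"
          unfolding A_def B_def E_def by algebra+
        then show False using 2 deg by simp
      next
        case 3
        \<comment> \<open>All three minors vanish, so the polynomials are proportional; being
          coprime, one of them must be a nonzero constant.\<close>
        have e: "smult q2 [:p0, p1, p2:] = smult p2 [:q0, q1, q2:]"
          using 3 by (simp add: A_def B_def E_def algebra_simps)
        have "is_unit [:p0, p1, p2:] \<or> is_unit [:q0, q1, q2:]"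
        proof (cases "p2 = 0")
          case True
          then have "[:p0, p1, p2:] = 0" using e deg by simp
          then show ?thesis using cop by (metis coprime_0_left_iff)
        next
          case False
          have "[:p0, p1, p2:] dvd smult p2 [:q0, q1, q2:]"
            unfolding e[symmetric] by (intro dvd_smult dvd_refl)
          then have "[:p0, p1, p2:] dvd [:q0, q1, q2:]"
            using False dvd_smult_cancel by blast
          then show ?thesis using cop coprime_common_divisor[OF cop dvd_refl] by blast
        qed
        moreover have False if "is_unit [:p0, p1, p2:]"
        proof -
          have "p2 = 0" "p1 = 0" "p0 \<noteq> 0" using that by (auto simp: is_unit_pCons_iff)
          then show False using 3 deg by (simp add: B_def)
        qed
        moreover have False if "is_unit [:q0, q1, q2:]"
        proof -
          have "q2 = 0" "q1 = 0" "q0 \<noteq> 0" using that by (auto simp: is_unit_pCons_iff)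
          then show False using 3 deg by (simp add: B_def)
        qed
        ultimately show False by blast
      qed
    qed
  qed
qed

lemma real_quadratic_map_iff:
  "real_quadratic_map f \<longleftrightarrow> (\<exists>p0 p1 p2 q0 q1 q2. qres p0 p1 p2 q0 q1 q2 > 0 \<and> f = quad_map p0 p1 p2 q0 q1 q2)"
proof
  assume "real_quadratic_map f"
  then obtain p q where pq: "real_quadratic_pair p q" "f = rat_map p q"
    unfolding real_quadratic_map_def by blast
  have deg: "degree p \<le> 2" "degree q \<le> 2" using pq(1) by (auto simp: real_quadratic_pair_def)
  have ex: "r = [:coeff r 0, coeff r 1, coeff r 2:]" if "degree r \<le> 2" for r :: "real poly"
    using that
    by (auto simp: poly_eq_iff coeff_pCons numeral_2_eq_2 coeff_eq_0 split: nat.split)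
  show "\<exists>p0 p1 p2 q0 q1 q2. qres p0 p1 p2 q0 q1 q2 > 0 \<and> f = quad_map p0 p1 p2 q0 q1 q2"
    using pq ex[OF deg(1)] ex[OF deg(2)] unfolding quad_map_def by (metis real_quadratic_pair_iff)
next
  assume "\<exists>p0 p1 p2 q0 q1 q2. qres p0 p1 p2 q0 q1 q2 > 0 \<and> f = quad_map p0 p1 p2 q0 q1 q2"
  then show "real_quadratic_map f"
    unfolding real_quadratic_map_def quad_map_def using real_quadratic_pair_iff by blast
qed

section \<open>Normal form and a conjugation invariant\<close>

lemma quadratic_form_nonzero:
  fixes x y :: real
  assumes "qres p0 p1 p2 q0 q1 q2 \<noteq> 0" "(x, y) \<noteq> (0, 0)"
  shows "(p0 * y\<^sup>2 + p1 * x * y + p2 * x\<^sup>2, q0 * y\<^sup>2 + q1 * x * y + q2 * x\<^sup>2) \<noteq> (0, 0)"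
proof (cases "y = 0")
  case True
  then show ?thesis using assms qres_nonzero_degree[OF assms(1)] by auto
next
  case False
  have "p0 * y\<^sup>2 + p1 * x * y + p2 * x\<^sup>2 = y\<^sup>2 * poly [:p0, p1, p2:] (x / y)"
    "q0 * y\<^sup>2 + q1 * x * y + q2 * x\<^sup>2 = y\<^sup>2 * poly [:q0, q1, q2:] (x / y)"
    using False by (simp_all add: field_simps power2_eq_square)
  then show ?thesis using no_common_zero[OF assms(1), of "x / y"] False by auto
qed

lemma quad_map_hpt:
  fixes x y :: real
  assumes "qres p0 p1 p2 q0 q1 q2 \<noteq> 0" "(x, y) \<noteq> (0, 0)"
  shows "quad_map p0 p1 p2 q0 q1 q2 (hpt x y)
    = hpt (p0 * y\<^sup>2 + p1 * x * y + p2 * x\<^sup>2) (q0 * y\<^sup>2 + q1 * x * y + q2 * x\<^sup>2)"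
proof (cases "y = 0")
  case True
  then show ?thesis using assms quad_map_None[OF assms(1)] by (simp add: hpt_def)
next
  case False
  have "p0 * y\<^sup>2 + p1 * x * y + p2 * x\<^sup>2 = y\<^sup>2 * poly [:p0, p1, p2:] (x / y)"
    "q0 * y\<^sup>2 + q1 * x * y + q2 * x\<^sup>2 = y\<^sup>2 * poly [:q0, q1, q2:] (x / y)"
    using False by (simp_all add: field_simps power2_eq_square)
  then show ?thesis using False by (simp add: quad_map_def rat_map_def hpt_def)
qed

lemma critical_point_quad_map_hpt:
  fixes x y :: real
  assumes "qres p0 p1 p2 q0 q1 q2 \<noteq> 0" "(x, y) \<noteq> (0, 0)"
  shows "critical_point (quad_map p0 p1 p2 q0 q1 q2) (hpt x y) \<longleftrightarrow>
    (p1 * q0 - p0 * q1) * y\<^sup>2 + 2 * (p2 * q0 - p0 * q2) * x * y + (p2 * q1 - p1 * q2) * x\<^sup>2 = 0"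
proof (cases "y = 0")
  case True
  then show ?thesis using assms critical_point_quad_map_None[OF assms(1)] by (simp add: hpt_def)
next
  case False
  have "(p1 * q0 - p0 * q1) * y\<^sup>2 + 2 * (p2 * q0 - p0 * q2) * x * y + (p2 * q1 - p1 * q2) * x\<^sup>2
    = y\<^sup>2 * ((p1 * q0 - p0 * q1) + 2 * (p2 * q0 - p0 * q2) * (x / y) + (p2 * q1 - p1 * q2) * (x / y)\<^sup>2)"
    using False by (simp add: field_simps power2_eq_square)
  then show ?thesis using False by (simp add: hpt_def critical_point_quad_map_Some[OF assms(1)])
qed

text \<open>Each 2-by-2 minor of the coefficients is multiplied by the determinant, and
  \<open>qres\<close> is quadratic in these minors.\<close>

lemma qres_post:
  "qres (a * p0 + b * q0) (a * p1 + b * q1) (a * p2 + b * q2)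
      (c * p0 + d * q0) (c * p1 + d * q1) (c * p2 + d * q2)
   = (a * d - b * c)\<^sup>2 * qres p0 p1 p2 q0 q1 (q2 :: real)"
  unfolding qres_def by algebra

lemma mob_quad_map:
  assumes "a * d - b * c \<noteq> 0" "qres p0 p1 p2 q0 q1 q2 \<noteq> 0"
  shows "mob a b c d \<circ> quad_map p0 p1 p2 q0 q1 q2 =
    quad_map (a * p0 + b * q0) (a * p1 + b * q1) (a * p2 + b * q2)
      (c * p0 + d * q0) (c * p1 + d * q1) (c * p2 + d * q2)"
proof
  fix z
  obtain x y where z: "z = hpt x y" "(x, y) \<noteq> (0, 0)" by (rule hpt_cases)
  have r: "qres (a * p0 + b * q0) (a * p1 + b * q1) (a * p2 + b * q2)
      (c * p0 + d * q0) (c * p1 + d * q1) (c * p2 + d * q2) \<noteq> 0"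
    unfolding qres_post using assms by simp
  show "(mob a b c d \<circ> quad_map p0 p1 p2 q0 q1 q2) z =
    quad_map (a * p0 + b * q0) (a * p1 + b * q1) (a * p2 + b * q2)
      (c * p0 + d * q0) (c * p1 + d * q1) (c * p2 + d * q2) z"
    unfolding z(1) o_def quad_map_hpt[OF assms(2) z(2)] quad_map_hpt[OF r z(2)]
      mob_hpt[OF assms(1) quadratic_form_nonzero[OF assms(2) z(2)]]
    by (simp add: algebra_simps)
qed

text \<open>The Wronskian, as a binary quadratic form, undergoes the linear substitution and is
  multiplied by the determinant D. Its discriminant gains D^2 from the substitution and D^2 from the
  factor.\<close>

lemma qres_pre:
  fixes a b c d p0 p1 p2 q0 q1 q2 :: real
  shows "qres (p0 * d\<^sup>2 + p1 * b * d + p2 * b\<^sup>2) (2 * p0 * c * d + p1 * (a * d + b * c) + 2 * p2 * a * b)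
      (p0 * c\<^sup>2 + p1 * a * c + p2 * a\<^sup>2)
      (q0 * d\<^sup>2 + q1 * b * d + q2 * b\<^sup>2) (2 * q0 * c * d + q1 * (a * d + b * c) + 2 * q2 * a * b)
      (q0 * c\<^sup>2 + q1 * a * c + q2 * a\<^sup>2)
   = (a * d - b * c) ^ 4 * qres p0 p1 p2 q0 q1 q2" (is "qres ?p0 ?p1 ?p2 ?q0 ?q1 ?q2 = _")
proof -
  define A B E where "A = p1 * q0 - p0 * q1" and "B = p2 * q0 - p0 * q2" and "E = p2 * q1 - p1 * q2"
  define D where "D = a * d - b * c"
  have "?p2 * ?q0 - ?p0 * ?q2 = D * (A * c * d + B * (a * d + b * c) + E * a * b)"
    "?p1 * ?q0 - ?p0 * ?q1 = D * (A * d\<^sup>2 + 2 * B * b * d + E * b\<^sup>2)"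
    "?p2 * ?q1 - ?p1 * ?q2 = D * (A * c\<^sup>2 + 2 * B * a * c + E * a\<^sup>2)"
    unfolding A_def B_def E_def D_def by algebra+
  then have "qres ?p0 ?p1 ?p2 ?q0 ?q1 ?q2 = D\<^sup>2 * ((A * c * d + B * (a * d + b * c) + E * a * b)\<^sup>2
      - (A * d\<^sup>2 + 2 * B * b * d + E * b\<^sup>2) * (A * c\<^sup>2 + 2 * B * a * c + E * a\<^sup>2))"
    unfolding qres_def by (simp add: power2_eq_square algebra_simps)
  also have "\<dots> = D ^ 4 * (B\<^sup>2 - A * E)" unfolding D_def by algebra
  finally show ?thesis by (simp add: qres_def A_def B_def E_def D_def)
qed

lemma quad_map_mob:
  assumes "a * d - b * c \<noteq> 0" "qres p0 p1 p2 q0 q1 q2 \<noteq> 0"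
  shows "quad_map p0 p1 p2 q0 q1 q2 \<circ> mob a b c d =
    quad_map (p0 * d\<^sup>2 + p1 * b * d + p2 * b\<^sup>2) (2 * p0 * c * d + p1 * (a * d + b * c) + 2 * p2 * a * b)
      (p0 * c\<^sup>2 + p1 * a * c + p2 * a\<^sup>2)
      (q0 * d\<^sup>2 + q1 * b * d + q2 * b\<^sup>2) (2 * q0 * c * d + q1 * (a * d + b * c) + 2 * q2 * a * b)
      (q0 * c\<^sup>2 + q1 * a * c + q2 * a\<^sup>2)" (is "_ = quad_map ?p0 ?p1 ?p2 ?q0 ?q1 ?q2")
proof
  fix z
  obtain x y where z: "z = hpt x y" "(x, y) \<noteq> (0, 0)" by (rule hpt_cases)
  have r: "qres ?p0 ?p1 ?p2 ?q0 ?q1 ?q2 \<noteq> 0" unfolding qres_pre using assms by simp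
  have "r0 * (c * x + d * y)\<^sup>2 + r1 * (a * x + b * y) * (c * x + d * y) + r2 * (a * x + b * y)\<^sup>2
    = (r0 * d\<^sup>2 + r1 * b * d + r2 * b\<^sup>2) * y\<^sup>2 + (2 * r0 * c * d + r1 * (a * d + b * c) + 2 * r2 * a * b) * x * y
      + (r0 * c\<^sup>2 + r1 * a * c + r2 * a\<^sup>2) * x\<^sup>2" for r0 r1 r2 by algebra
  then show "(quad_map p0 p1 p2 q0 q1 q2 \<circ> mob a b c d) z = quad_map ?p0 ?p1 ?p2 ?q0 ?q1 ?q2 z"
    unfolding z(1) o_def mob_hpt[OF assms(1) z(2)] quad_map_hpt[OF r z(2)]
      quad_map_hpt[OF assms(2) linear_nonzero[OF assms(1) z(2)]] by simp
qed

lemma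
  assumes "real_quadratic_map f" "g \<in> PSL2R"
  shows real_quadratic_map_post: "real_quadratic_map (g \<circ> f)"
    and critical_point_post: "critical_point (g \<circ> f) z \<longleftrightarrow> critical_point f z"
proof -
  obtain p0 p1 p2 q0 q1 q2 where f: "qres p0 p1 p2 q0 q1 q2 > 0" "f = quad_map p0 p1 p2 q0 q1 q2"
    using assms(1) unfolding real_quadratic_map_iff by blast
  obtain a b c d where g: "g = mob a b c d" "a * d - b * c = 1" using assms(2) by (rule PSL2R_E)
  have r: "qres (a * p0 + b * q0) (a * p1 + b * q1) (a * p2 + b * q2)
      (c * p0 + d * q0) (c * p1 + d * q1) (c * p2 + d * q2) > 0"
    unfolding qres_post using f g by simp
  have gf: "g \<circ> f = quad_map (a * p0 + b * q0) (a * p1 + b * q1) (a * p2 + b * q2)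
      (c * p0 + d * q0) (c * p1 + d * q1) (c * p2 + d * q2)"
    unfolding f g(1) using f g by (intro mob_quad_map) auto
  show "real_quadratic_map (g \<circ> f)" unfolding gf real_quadratic_map_iff using r by blast
  obtain x y where z: "z = hpt x y" "(x, y) \<noteq> (0, 0)" by (rule hpt_cases)
  have e: "(a * r1 + b * s1) * (c * r0 + d * s0) - (a * r0 + b * s0) * (c * r1 + d * s1)
    = r1 * s0 - r0 * s1" for r0 r1 s0 s1 using g(2) by algebra
  show "critical_point (g \<circ> f) z \<longleftrightarrow> critical_point f z"
    unfolding gf unfolding f(2) z(1) using r f(1) z(2)
    by (subst (1 2) critical_point_quad_map_hpt) (auto simp: e)
qed

lemma
  assumes "real_quadratic_map f" "g \<in> PSL2R"
  shows real_quadratic_map_pre: "real_quadratic_map (f \<circ> g)"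
    and critical_point_pre: "critical_point (f \<circ> g) z \<longleftrightarrow> critical_point f (g z)"
proof -
  obtain p0 p1 p2 q0 q1 q2 where f: "qres p0 p1 p2 q0 q1 q2 > 0" "f = quad_map p0 p1 p2 q0 q1 q2"
    using assms(1) unfolding real_quadratic_map_iff by blast
  obtain a b c d where g: "g = mob a b c d" "a * d - b * c = 1" using assms(2) by (rule PSL2R_E)
  let ?p0 = "p0 * d\<^sup>2 + p1 * b * d + p2 * b\<^sup>2"
  let ?p1 = "2 * p0 * c * d + p1 * (a * d + b * c) + 2 * p2 * a * b"
  let ?p2 = "p0 * c\<^sup>2 + p1 * a * c + p2 * a\<^sup>2"
  let ?q0 = "q0 * d\<^sup>2 + q1 * b * d + q2 * b\<^sup>2"
  let ?q1 = "2 * q0 * c * d + q1 * (a * d + b * c) + 2 * q2 * a * b"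
  let ?q2 = "q0 * c\<^sup>2 + q1 * a * c + q2 * a\<^sup>2"
  have r: "qres ?p0 ?p1 ?p2 ?q0 ?q1 ?q2 > 0" unfolding qres_pre using f g by simp
  have fg: "f \<circ> g = quad_map ?p0 ?p1 ?p2 ?q0 ?q1 ?q2" unfolding f g(1) using f g by (intro quad_map_mob) auto
  show "real_quadratic_map (f \<circ> g)" unfolding fg real_quadratic_map_iff using r by blast
  obtain x y where z: "z = hpt x y" "(x, y) \<noteq> (0, 0)" by (rule hpt_cases)
  define A B E where "A = p1 * q0 - p0 * q1" and "B = p2 * q0 - p0 * q2" and "E = p2 * q1 - p1 * q2"
  define D where "D = a * d - b * c"
  have "?p2 * ?q0 - ?p0 * ?q2 = D * (A * c * d + B * (a * d + b * c) + E * a * b)"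
    "?p1 * ?q0 - ?p0 * ?q1 = D * (A * d\<^sup>2 + 2 * B * b * d + E * b\<^sup>2)"
    "?p2 * ?q1 - ?p1 * ?q2 = D * (A * c\<^sup>2 + 2 * B * a * c + E * a\<^sup>2)"
    unfolding A_def B_def E_def D_def by algebra+
  then have "?p2 * ?q0 - ?p0 * ?q2 = A * c * d + B * (a * d + b * c) + E * a * b"
    "?p1 * ?q0 - ?p0 * ?q1 = A * d\<^sup>2 + 2 * B * b * d + E * b\<^sup>2"
    "?p2 * ?q1 - ?p1 * ?q2 = A * c\<^sup>2 + 2 * B * a * c + E * a\<^sup>2"
    using g(2) by (simp_all add: D_def)
  \<comment> \<open>The Wronskian of the composition is the Wronskian form of \<open>f\<close>
    evaluated at the image vector, so its zeros are the preimages of the critical points.\<close>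
  moreover have "(A * d\<^sup>2 + 2 * B * b * d + E * b\<^sup>2) * y\<^sup>2
      + 2 * (A * c * d + B * (a * d + b * c) + E * a * b) * x * y
      + (A * c\<^sup>2 + 2 * B * a * c + E * a\<^sup>2) * x\<^sup>2
    = A * (c * x + d * y)\<^sup>2 + 2 * B * (a * x + b * y) * (c * x + d * y) + E * (a * x + b * y)\<^sup>2"
    by algebra
  moreover have "g z = hpt (a * x + b * y) (c * x + d * y)"
    unfolding g(1) z(1) using g(2) z(2) by (intro mob_hpt) auto
  moreover have "(a * x + b * y, c * x + d * y) \<noteq> (0, 0)"
    by (rule linear_nonzero) (use g(2) z(2) in auto)
  ultimately show "critical_point (f \<circ> g) z \<longleftrightarrow> critical_point f (g z)"
    unfolding fg unfolding f(2) using critical_point_quad_map_hpt[of ?p0 ?p1 ?p2 ?q0 ?q1 ?q2 x y] r z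
      critical_point_quad_map_hpt[of p0 p1 p2 q0 q1 q2 "a * x + b * y" "c * x + d * y"] f(1)
    by (simp add: A_def[symmetric] B_def[symmetric] E_def[symmetric])
qed

section \<open>The squaring map as normal form\<close>

definition sq :: "rhat \<Rightarrow> rhat" where
  "sq = quad_map 0 0 1 1 0 0"

lemma qres_sq: "qres 0 0 1 1 0 (0 :: real) = 1"
  by (simp add: qres_def)

lemma real_quadratic_map_sq: "real_quadratic_map sq"
  unfolding real_quadratic_map_iff sq_def using qres_sq by (metis zero_less_one)

lemma sq_simps [simp]: "sq (Some x) = Some (x\<^sup>2)" "sq None = None"
  using quad_map_None[of 0 0 1 1 0 0] by (simp_all add: sq_def qres_sq quad_map_def rat_map_def power2_eq_square)

lemma sq_hpt: "(x, y) \<noteq> (0, 0) \<Longrightarrow> sq (hpt x y) = hpt (x\<^sup>2) (y\<^sup>2)"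
  by (auto simp: hpt_def power_divide)

lemma critical_point_sq: "critical_point sq z \<longleftrightarrow> z = Some 0 \<or> z = None"
  using critical_point_quad_map_Some[of 0 0 1 1 0 "0 :: real"] critical_point_quad_map_None[of 0 0 1 1 0 "0 :: real"]
  by (cases z) (auto simp: sq_def qres_sq)

lemma quad_map_even:
  assumes "p2 * q0 - p0 * q2 \<noteq> 0"
  shows "quad_map p0 0 p2 q0 0 q2 = mob p2 p0 q2 q0 \<circ> sq"
  unfolding sq_def using assms by (subst mob_quad_map) (auto simp: qres_sq)

text \<open>Composing with \<open>z \<mapsto> -1/z\<close> turns a negative determinant into a positive one.\<close>

lemma even_orientation:
  assumes "p2 * q0 - p0 * q2 < 0"
  shows "mob p2 p0 q2 q0 \<circ> sq = mob p0 p2 q0 q2 \<circ> sq \<circ> mob 0 (- 1) 1 0"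
proof
  fix z
  obtain x y where z: "z = hpt x y" "(x, y) \<noteq> (0, 0)" by (rule hpt_cases)
  have xy: "(x\<^sup>2, y\<^sup>2) \<noteq> (0, 0)" "(y\<^sup>2, x\<^sup>2) \<noteq> (0, 0)" "(- y, x) \<noteq> (0, 0)" using z(2) by auto
  have J: "mob 0 (- 1) 1 0 (hpt x y) = hpt (- y) x"
    using mob_hpt[of 0 0 "- 1" 1 x y] z(2) by simp
  show "(mob p2 p0 q2 q0 \<circ> sq) z = (mob p0 p2 q0 q2 \<circ> sq \<circ> mob 0 (- 1) 1 0) z"
    using mob_hpt[of p2 q0 p0 q2, OF _ xy(1)] mob_hpt[of p0 q2 p2 q0, OF _ xy(2)] assms
    by (simp add: z(1) J sq_hpt[OF z(2)] sq_hpt[OF xy(3)] algebra_simps)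
qed

lemma ex_two_critical_points:
  assumes "real_quadratic_map f"
  obtains u v where "u \<noteq> v" "critical_point f u" "critical_point f v"
proof -
  obtain p0 p1 p2 q0 q1 q2 where f: "qres p0 p1 p2 q0 q1 q2 > 0" "f = quad_map p0 p1 p2 q0 q1 q2"
    using assms(1) unfolding real_quadratic_map_iff by blast
  then have qres: "qres p0 p1 p2 q0 q1 q2 \<noteq> 0" by simp
  define A B E where "A = p1 * q0 - p0 * q1" and "B = p2 * q0 - p0 * q2" and "E = p2 * q1 - p1 * q2"
  have S: "critical_point f (Some z) \<longleftrightarrow> A + 2 * B * z + E * z\<^sup>2 = 0" for z
    unfolding f(2) critical_point_quad_map_Some[OF qres] A_def B_def E_def ..
  have N: "critical_point f None \<longleftrightarrow> E = 0"
    unfolding f(2) critical_point_quad_map_None[OF qres] E_def ..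
  have pos: "B\<^sup>2 - A * E > 0" using f(1) by (simp add: qres_def A_def B_def E_def)
  show ?thesis
  proof (cases "E = 0")
    case True
    then have "B \<noteq> 0" using pos by auto
    then have "critical_point f (Some (- A / (2 * B)))" unfolding S using True by simp
    then show ?thesis using N True that[of None "Some (- A / (2 * B))"] by simp
  next
    case False
    define R where "R = sqrt (B\<^sup>2 - A * E)"
    have R: "R > 0" "R\<^sup>2 = B\<^sup>2 - A * E" using pos by (auto simp: R_def)
    have "critical_point f (Some ((T - B) / E))" if "T\<^sup>2 = B\<^sup>2 - A * E" for T
    proof -
      define w where "w = (T - B) / E"
      have "E * w = T - B" using False by (simp add: w_def)
      then have "E * (A + 2 * B * w + E * w\<^sup>2) = 0" using that by algebra
      then show ?thesis unfolding S w_def[symmetric] using False by simp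
    qed
    from this[of R] this[of "- R"] show ?thesis
      using that[of "Some ((R - B) / E)" "Some ((- R - B) / E)"] R False by simp
  qed
qed

text \<open>With the critical points moved to 0 and infinity only the middle coefficient of the
  Wronskian survives, which forces the linear coefficients of the map to vanish: it is a fractional
  linear map of \<open>z\<^sup>2\<close>. If that outer map has negative determinant, precomposition
  with \<open>- 1 / z\<close>, which exchanges 0 and infinity, repairs it.\<close>

lemma real_quadratic_normal_form:
  assumes "real_quadratic_map f"
  obtains \<psi> \<phi> where "\<psi> \<in> PSL2R" "\<phi> \<in> PSL2R" "f = \<psi> \<circ> sq \<circ> \<phi>"
proof -
  obtain u v where uv: "u \<noteq> v" "critical_point f u" "critical_point f v"
    using assms by (rule ex_two_critical_points)
  obtain g where g: "g \<in> PSL2R" "g u = Some 0" "g v = None"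
    using uv(1) by (rule PSL2R_0_infinity)
  obtain h where h: "h \<in> PSL2R" "g \<circ> h = id" "h \<circ> g = id" using g(1) by (rule PSL2R_inverse)
  have huv: "h (Some 0) = u" "h None = v" using g h(3) by (metis comp_apply id_apply)+
  obtain p0 p1 p2 q0 q1 q2 where fh: "qres p0 p1 p2 q0 q1 q2 > 0" "f \<circ> h = quad_map p0 p1 p2 q0 q1 q2"
    using real_quadratic_map_pre[OF assms h(1)] unfolding real_quadratic_map_iff by blast
  then have qres: "qres p0 p1 p2 q0 q1 q2 \<noteq> 0" by simp
  define B where "B = p2 * q0 - p0 * q2"
  have "critical_point (f \<circ> h) (Some 0)" "critical_point (f \<circ> h) None"
    using critical_point_pre[OF assms h(1)] uv huv by auto
  then have e: "p1 * q0 - p0 * q1 = 0" "p2 * q1 - p1 * q2 = 0"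
    unfolding fh(2) critical_point_quad_map_Some[OF qres] critical_point_quad_map_None[OF qres] by auto
  then have B: "B \<noteq> 0" using qres by (auto simp: qres_def B_def)
  have "B * p1 = 0" "B * q1 = 0" using e unfolding B_def by algebra+
  then have "p1 = 0" "q1 = 0" using B by auto
  then have fh': "f \<circ> h = mob p2 p0 q2 q0 \<circ> sq" using B quad_map_even fh(2) by (simp add: B_def)
  have f: "f = f \<circ> h \<circ> g" using h(3) by (simp add: comp_assoc)
  show ?thesis
  proof (cases "B > 0")
    case True
    then show ?thesis
      using that[of "mob p2 p0 q2 q0" g] f fh' g(1) mob_in_PSL2R[of p2 q0 p0 q2] by (simp add: B_def)
  next
    case False
    then have neg: "p2 * q0 - p0 * q2 < 0" using B by (simp add: B_def)
    have "mob 0 (- 1) 1 0 \<circ> g \<in> PSL2R" by (intro PSL2R_comp mob_in_PSL2R g) simp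
    moreover have "mob p0 p2 q0 q2 \<in> PSL2R" by (intro mob_in_PSL2R) (use neg in simp)
    moreover have "f = mob p0 p2 q0 q2 \<circ> sq \<circ> (mob 0 (- 1) 1 0 \<circ> g)"
      using f fh' even_orientation[OF neg] by (simp add: comp_assoc)
    ultimately show ?thesis using that by blast
  qed
qed

lemma critical_point_sq_comp:
  assumes "\<psi> \<in> PSL2R" "\<phi> \<in> PSL2R"
  shows "critical_point (\<psi> \<circ> sq \<circ> \<phi>) z \<longleftrightarrow> \<phi> z = Some 0 \<or> \<phi> z = None"
  using assms
  by (simp add: real_quadratic_map_post real_quadratic_map_sq critical_point_pre
      critical_point_post critical_point_sq)

text \<open>Two fractions in lowest terms with the same value differ by a unit. The Bezout cofactors
  exhibit that unit as \<open>p' * u + q' * v\<close> and its inverse as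
  \<open>p * u' + q * v'\<close>.\<close>

lemma bezout_cross_proportional:
  fixes p q p' q' :: "'a::idom"
  assumes "p * u + q * v = 1" "p' * u' + q' * v' = 1" "p * q' = p' * q"
  obtains r where "r dvd 1" "p' = p * r" "q' = q * r"
proof
  show p: "p' = p * (p' * u + q' * v)" and q: "q' = q * (p' * u + q' * v)" using assms by algebra+
  have "1 = (p' * u + q' * v) * (p * u' + q * v')" using assms(2) p q by algebra
  then show "p' * u + q' * v dvd 1" by (rule dvdI)
qed

lemma quad_map_eq_imp_proportional:
  fixes p0 :: real
  assumes "qres p0 p1 p2 q0 q1 q2 \<noteq> 0" "qres p0' p1' p2' q0' q1' q2' \<noteq> 0"
    and eq: "quad_map p0 p1 p2 q0 q1 q2 = quad_map p0' p1' p2' q0' q1' q2'"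
  obtains k where "k \<noteq> 0" "p0' = k * p0" "p1' = k * p1" "p2' = k * p2"
    "q0' = k * q0" "q1' = k * q1" "q2' = k * q2"
proof -
  let ?p = "[:p0, p1, p2:]" and ?q = "[:q0, q1, q2:]"
  let ?p' = "[:p0', p1', p2':]" and ?q' = "[:q0', q1', q2':]"
  have pq: "?p * ?q' = ?p' * ?q"
  proof (rule poly_eq_poly_eq_iff[THEN iffD1], rule ext)
    fix x
    \<comment> \<open>Homogeneous coordinates turn equality of values into the vanishing of a
      determinant, poles included.\<close>
    have "hpt (p0 * 1\<^sup>2 + p1 * x * 1 + p2 * x\<^sup>2) (q0 * 1\<^sup>2 + q1 * x * 1 + q2 * x\<^sup>2)
      = hpt (p0' * 1\<^sup>2 + p1' * x * 1 + p2' * x\<^sup>2) (q0' * 1\<^sup>2 + q1' * x * 1 + q2' * x\<^sup>2)"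
      using eq quad_map_hpt[OF assms(1), of x 1] quad_map_hpt[OF assms(2), of x 1] by simp
    then have "(p0 * 1\<^sup>2 + p1 * x * 1 + p2 * x\<^sup>2) * (q0' * 1\<^sup>2 + q1' * x * 1 + q2' * x\<^sup>2)
      = (p0' * 1\<^sup>2 + p1' * x * 1 + p2' * x\<^sup>2) * (q0 * 1\<^sup>2 + q1 * x * 1 + q2 * x\<^sup>2)"
      by (subst (asm) hpt_eq_iff) (use quadratic_form_nonzero[OF assms(1), of x 1]
          quadratic_form_nonzero[OF assms(2), of x 1] in auto)
    moreover have "poly [:a, b, c:] x = a * 1\<^sup>2 + b * x * 1 + c * x\<^sup>2" for a b c
      by (simp add: algebra_simps power2_eq_square)
    ultimately show "poly (?p * ?q') x = poly (?p' * ?q) x" unfolding poly_mult by (simp only:)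
  qed
  obtain u v where uv: "?p * u + ?q * v = 1" using quadratic_bezout[OF assms(1)] by blast
  obtain u' v' where uv': "?p' * u' + ?q' * v' = 1" using quadratic_bezout[OF assms(2)] by blast
  obtain r where r: "r dvd 1" "?p' = ?p * r" "?q' = ?q * r"
    using bezout_cross_proportional[OF uv uv' pq] by blast
  obtain k where "r = [:k:]" "k \<noteq> 0" using r(1) by (auto simp: is_unit_poly_iff dvd_field_iff)
  then show ?thesis using that[of k] r(2,3) by (simp add: mult.commute)
qed

text \<open>
  The quadratic map of the plane lifting \<open>p / q\<close> is \<open>F = (P, Q)\<close> with the binary forms \<open>P\<close>, \<open>Q\<close>. Its
  fixed points are the zeros of the cubic form \<open>x Q - y P\<close>, and its divergence is a linear form.
  Both are covariant under conjugation, and so is the value of the former at the zero of the latter.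
\<close>

definition conj_inv_num :: "real \<Rightarrow> real \<Rightarrow> real \<Rightarrow> real \<Rightarrow> real \<Rightarrow> real \<Rightarrow> real" where
  "conj_inv_num p0 p1 p2 q0 q1 q2 = (let x = - (p1 + 2 * q0); y = 2 * p2 + q1 in
     x * (q0 * y\<^sup>2 + q1 * x * y + q2 * x\<^sup>2) - y * (p0 * y\<^sup>2 + p1 * x * y + p2 * x\<^sup>2))"

text \<open>The matrix carries the zero vector of the divergence of the conjugated lift to that of
  the original lift. The cubic form is the determinant of a vector and its image under the lift, so
  a change of coordinates of determinant 1 preserves its value.\<close>

lemma conj_inv_num_conj:
  fixes a b c d p0 p1 p2 q0 q1 q2 :: real
  defines "r0 \<equiv> p0 * d\<^sup>2 + p1 * b * d + p2 * b\<^sup>2"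
    and "r1 \<equiv> 2 * p0 * c * d + p1 * (a * d + b * c) + 2 * p2 * a * b"
    and "r2 \<equiv> p0 * c\<^sup>2 + p1 * a * c + p2 * a\<^sup>2"
    and "s0 \<equiv> q0 * d\<^sup>2 + q1 * b * d + q2 * b\<^sup>2"
    and "s1 \<equiv> 2 * q0 * c * d + q1 * (a * d + b * c) + 2 * q2 * a * b"
    and "s2 \<equiv> q0 * c\<^sup>2 + q1 * a * c + q2 * a\<^sup>2"
  assumes det: "a * d - b * c = 1"
  shows "conj_inv_num (d * r0 + - b * s0) (d * r1 + - b * s1) (d * r2 + - b * s2)
    (- c * r0 + a * s0) (- c * r1 + a * s1) (- c * r2 + a * s2) = conj_inv_num p0 p1 p2 q0 q1 q2"
proof -
  define x where "x = - ((d * r1 + - b * s1) + 2 * (- c * r0 + a * s0))"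
  define y where "y = 2 * (d * r2 + - b * s2) + (- c * r1 + a * s1)"
  have X0: "a * x + b * y = - (a * d - b * c)\<^sup>2 * (p1 + 2 * q0)"
    and Y0: "c * x + d * y = (a * d - b * c)\<^sup>2 * (2 * p2 + q1)"
    unfolding x_def y_def r0_def r1_def r2_def s0_def s1_def s2_def by algebra+
  have X: "a * x + b * y = - (p1 + 2 * q0)" and Y: "c * x + d * y = 2 * p2 + q1"
    using X0 Y0 det by simp_all
  define P where "P = p0 * (c * x + d * y)\<^sup>2 + p1 * (a * x + b * y) * (c * x + d * y) + p2 * (a * x + b * y)\<^sup>2"
  define Q where "Q = q0 * (c * x + d * y)\<^sup>2 + q1 * (a * x + b * y) * (c * x + d * y) + q2 * (a * x + b * y)\<^sup>2"
  have P: "r0 * y\<^sup>2 + r1 * x * y + r2 * x\<^sup>2 = P" unfolding P_def r0_def r1_def r2_def by algebra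
  have Q: "s0 * y\<^sup>2 + s1 * x * y + s2 * x\<^sup>2 = Q" unfolding Q_def s0_def s1_def s2_def by algebra
  have "conj_inv_num (d * r0 + - b * s0) (d * r1 + - b * s1) (d * r2 + - b * s2)
      (- c * r0 + a * s0) (- c * r1 + a * s1) (- c * r2 + a * s2)
    = x * (- c * (r0 * y\<^sup>2 + r1 * x * y + r2 * x\<^sup>2) + a * (s0 * y\<^sup>2 + s1 * x * y + s2 * x\<^sup>2))
      - y * (d * (r0 * y\<^sup>2 + r1 * x * y + r2 * x\<^sup>2) - b * (s0 * y\<^sup>2 + s1 * x * y + s2 * x\<^sup>2))"
    unfolding conj_inv_num_def x_def[symmetric] y_def[symmetric] Let_def by algebra
  also have "\<dots> = (a * x + b * y) * Q - (c * x + d * y) * P"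
    unfolding P Q by algebra
  also have "\<dots> = conj_inv_num p0 p1 p2 q0 q1 q2"
    unfolding P_def Q_def X Y conj_inv_num_def Let_def by (simp add: algebra_simps)
  finally show ?thesis .
qed

text \<open>Numerator and \<open>qres\<close> are both homogeneous of degree four in the
  coefficients, so the quotient depends only on the map and not on the chosen pair of
  polynomials.\<close>

definition conj_inv :: "real \<Rightarrow> real \<Rightarrow> real \<Rightarrow> real \<Rightarrow> real \<Rightarrow> real \<Rightarrow> real" where
  "conj_inv p0 p1 p2 q0 q1 q2 = conj_inv_num p0 p1 p2 q0 q1 q2 / qres p0 p1 p2 q0 q1 q2"

lemma conj_inv_scale:
  "k \<noteq> 0 \<Longrightarrow> conj_inv (k * p0) (k * p1) (k * p2) (k * q0) (k * q1) (k * q2) = conj_inv p0 p1 p2 q0 q1 q2"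
proof -
  assume k: "k \<noteq> 0"
  have "conj_inv_num (k * p0) (k * p1) (k * p2) (k * q0) (k * q1) (k * q2) = k ^ 4 * conj_inv_num p0 p1 p2 q0 q1 q2"
    unfolding conj_inv_num_def Let_def by algebra
  moreover have "qres (k * p0) (k * p1) (k * p2) (k * q0) (k * q1) (k * q2) = k ^ 4 * qres p0 p1 p2 q0 q1 q2"
    unfolding qres_def by algebra
  ultimately show ?thesis using k by (simp add: conj_inv_def)
qed

lemma conj_inv_conj_invariant:
  assumes "qres p0 p1 p2 q0 q1 q2 > 0" "qres p0' p1' p2' q0' q1' q2' > 0" "\<phi> \<in> PSL2R"
    and eq: "quad_map p0 p1 p2 q0 q1 q2 \<circ> \<phi> = \<phi> \<circ> quad_map p0' p1' p2' q0' q1' q2'"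
  shows "conj_inv p0 p1 p2 q0 q1 q2 = conj_inv p0' p1' p2' q0' q1' q2'"
proof -
  obtain a b c d where g: "\<phi> = mob a b c d" and det: "a * d - b * c = 1" using assms(3) by (rule PSL2R_E)
  define r0 where "r0 = p0 * d\<^sup>2 + p1 * b * d + p2 * b\<^sup>2"
  define r1 where "r1 = 2 * p0 * c * d + p1 * (a * d + b * c) + 2 * p2 * a * b"
  define r2 where "r2 = p0 * c\<^sup>2 + p1 * a * c + p2 * a\<^sup>2"
  define s0 where "s0 = q0 * d\<^sup>2 + q1 * b * d + q2 * b\<^sup>2"
  define s1 where "s1 = 2 * q0 * c * d + q1 * (a * d + b * c) + 2 * q2 * a * b"
  define s2 where "s2 = q0 * c\<^sup>2 + q1 * a * c + q2 * a\<^sup>2"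
  note defs = r0_def r1_def r2_def s0_def s1_def s2_def
  have rsr: "qres r0 r1 r2 s0 s1 s2 = qres p0 p1 p2 q0 q1 q2" unfolding defs qres_pre using det by simp
  have det': "d * a - - b * - c = 1" using det by (simp add: algebra_simps)
  let ?H = "\<lambda>F. F (d * r0 + - b * s0) (d * r1 + - b * s1) (d * r2 + - b * s2)
    (- c * r0 + a * s0) (- c * r1 + a * s1) (- c * r2 + a * s2)"
  have rsH: "?H qres = qres p0 p1 p2 q0 q1 q2" unfolding qres_post det' rsr by simp
  have "quad_map p0 p1 p2 q0 q1 q2 \<circ> mob a b c d = quad_map r0 r1 r2 s0 s1 s2"
    unfolding defs using assms(1) det by (intro quad_map_mob) auto
  then have "mob d (- b) (- c) a \<circ> quad_map r0 r1 r2 s0 s1 s2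
      = mob d (- b) (- c) a \<circ> mob a b c d \<circ> quad_map p0' p1' p2' q0' q1' q2'"
    using eq g by (simp add: comp_assoc)
  then have "quad_map p0' p1' p2' q0' q1' q2' = mob d (- b) (- c) a \<circ> quad_map r0 r1 r2 s0 s1 s2"
    unfolding mob_inverse(2)[OF det] by simp
  also have "\<dots> = ?H quad_map" using assms(1) rsr det' by (intro mob_quad_map) auto
  finally have "quad_map p0' p1' p2' q0' q1' q2' = ?H quad_map" .
  moreover have "qres p0' p1' p2' q0' q1' q2' \<noteq> 0" "?H qres \<noteq> 0" unfolding rsH using assms by auto
  \<comment> \<open>Equality of maps determines the coefficients only up to a factor, which is why
    \<open>conj_inv\<close> and not its numerator is compared.\<close>
  ultimately obtain k where k: "k \<noteq> 0" and kk:
    "d * r0 + - b * s0 = k * p0'" "d * r1 + - b * s1 = k * p1'" "d * r2 + - b * s2 = k * p2'"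
    "- c * r0 + a * s0 = k * q0'" "- c * r1 + a * s1 = k * q1'" "- c * r2 + a * s2 = k * q2'"
    by (elim quad_map_eq_imp_proportional[rotated 2])
  have "?H conj_inv = conj_inv p0' p1' p2' q0' q1' q2'" unfolding kk by (rule conj_inv_scale[OF k])
  moreover have "?H conj_inv_num = conj_inv_num p0 p1 p2 q0 q1 q2" unfolding defs by (rule conj_inv_num_conj[OF det])
  ultimately show ?thesis using rsH by (simp add: conj_inv_def)
qed

section \<open>Configurations of six points\<close>

lemma config_class_PSL2R:
  assumes "g \<in> PSL2R"
  shows "config_class n (\<lambda>i\<in>{..n}. g (x i)) = config_class n x"
proof -
  obtain h where h: "h \<in> PSL2R" "g \<circ> h = id" "h \<circ> g = id" using assms by (rule PSL2R_inverse)
  have hg: "h (g z) = z" for z using h(3) by (metis comp_apply id_apply)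
  have "(\<lambda>i\<in>{..n}. k ((\<lambda>i\<in>{..n}. g (x i)) i)) = (\<lambda>i\<in>{..n}. (k \<circ> g) (x i))" for k :: "rhat \<Rightarrow> rhat"
    by auto
  moreover have "(\<lambda>i\<in>{..n}. k (x i)) = (\<lambda>i\<in>{..n}. (k \<circ> h) ((\<lambda>i\<in>{..n}. g (x i)) i))" for k :: "rhat \<Rightarrow> rhat"
    by (auto simp: hg)
  ultimately show ?thesis unfolding config_class_def using PSL2R_comp assms h(1) by blast
qed

lemma config_class_self: "x \<in> extensional {..n} \<Longrightarrow> x \<in> config_class n x"
  unfolding config_class_def using id_in_PSL2R
  by (auto intro!: exI[of _ id] simp: extensional_restrict)

lemma config_class_E:
  assumes "y \<in> config_class n x"
  obtains g where "g \<in> PSL2R" "y = (\<lambda>i\<in>{..n}. g (x i))"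
  using assms unfolding config_class_def by auto

lemma configs_PSL2R:
  assumes "x \<in> configs n" "g \<in> PSL2R"
  shows "(\<lambda>i\<in>{..n}. g (x i)) \<in> configs n"
proof -
  have "inj g" using PSL2R_bij[OF assms(2)] by (simp add: bij_def)
  then show ?thesis
    using assms by (auto simp: configs_def inj_on_def pos_cyclic_PSL2R)
qed

lemma pos_cyclic_distinct:
  assumes "pos_cyclic u v w"
  shows "u \<noteq> v" "v \<noteq> w" "u \<noteq> w"
  using assms by (auto simp: pos_cyclic_hdet hdet_eq_0_iff[THEN iffD2])

lemma ordered_triples_le_5:
  fixes P :: "nat \<Rightarrow> nat \<Rightarrow> nat \<Rightarrow> bool"
  shows "(\<forall>i j k. i < j \<and> j < k \<and> k \<le> 5 \<longrightarrow> P i j k) \<longleftrightarrow>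
    P 0 1 2 \<and> P 0 1 3 \<and> P 0 1 4 \<and> P 0 1 5 \<and> P 0 2 3 \<and> P 0 2 4 \<and> P 0 2 5 \<and>
    P 0 3 4 \<and> P 0 3 5 \<and> P 0 4 5 \<and> P 1 2 3 \<and> P 1 2 4 \<and> P 1 2 5 \<and> P 1 3 4 \<and>
    P 1 3 5 \<and> P 1 4 5 \<and> P 2 3 4 \<and> P 2 3 5 \<and> P 2 4 5 \<and> P 3 4 5" (is "?L \<longleftrightarrow> ?R")
proof
  assume ?L
  then show ?R by (intro conjI) simp_all
next
  assume R: ?R
  show ?L
  proof (intro allI impI)
    fix i j k :: nat
    assume h: "i < j \<and> j < k \<and> k \<le> 5"
    then have "i \<in> {0, 1, 2, 3}" "j \<in> {1, 2, 3, 4}" "k \<in> {2, 3, 4, 5}" by auto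
    then show "P i j k" using R h by auto
  qed
qed

text \<open>Any two indices lie in a common increasing triple, and cyclically ordered points are
  distinct, so the order condition already contains injectivity.\<close>

lemma configs_5_iff:
  "x \<in> configs 5 \<longleftrightarrow> x \<in> extensional {..5} \<and>
     (\<forall>i j k. i < j \<and> j < k \<and> k \<le> 5 \<longrightarrow> pos_cyclic (x i) (x j) (x k))"
proof -
  have "inj_on x {..5}" if H: "\<forall>i j k. i < j \<and> j < k \<and> k \<le> 5 \<longrightarrow> pos_cyclic (x i) (x j) (x k)"
  proof (rule linorder_inj_onI)
    have c: "pos_cyclic (x i) (x j) (x k)" if "i < j" "j < k" "k \<le> 5" for i j k
      by (rule H[rule_format]) (intro conjI that)
    fix i j :: nat
    assume h: "i < j" "i \<in> {..5}" "j \<in> {..5}"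
    then consider "j < 5" | "i = 0" "j = 5" | "0 < i" "j = 5" by fastforce
    then show "x i \<noteq> x j"
    proof cases
      case 1
      show ?thesis by (rule pos_cyclic_distinct(1)[OF c[of i j 5]]) (use 1 h in auto)
    next
      case 2
      show ?thesis unfolding 2 by (rule pos_cyclic_distinct(3)[OF c[of 0 1 5]]) auto
    next
      case 3
      show ?thesis by (rule pos_cyclic_distinct(2)[OF c[of 0 i j]]) (use 3 h in auto)
    qed
  qed (rule linear)
  then show ?thesis unfolding configs_def by blast
qed

lemma configs_distinct:
  assumes "x \<in> configs n" "i \<le> n" "j \<le> n" "i \<noteq> j"
  shows "x i \<noteq> x j"
  using assms by (auto simp: configs_def inj_on_def)

text \<open>Each of the four points occurs once above and once below the line, so factors of
  homogeneous representatives cancel and the value is invariant under \<open>PSL2R\<close>. The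
  point 0 at index 0 and infinity at index 4 turn it into the quotient of the points at indices 1
  and 3.\<close>

definition cross :: "(nat \<Rightarrow> rhat) \<Rightarrow> real" where
  "cross x = (hdet (x 1) (x 0) * hdet (x 3) (x 4)) / (hdet (x 3) (x 0) * hdet (x 1) (x 4))"

lemma cross_PSL2R:
  assumes "g \<in> PSL2R"
  shows "cross (\<lambda>i\<in>{..5}. g (x i)) = cross x"
proof -
  obtain m where m: "\<forall>z. m z \<noteq> 0" "\<forall>u v. hdet (g u) (g v) = m u * m v * hdet u v"
    using assms by (rule PSL2R_hdet)
  have "cross (\<lambda>i\<in>{..5}. g (x i)) = ((m (x 0) * m (x 1) * m (x 3) * m (x 4)) * (hdet (x 1) (x 0) * hdet (x 3) (x 4)))
     / ((m (x 0) * m (x 1) * m (x 3) * m (x 4)) * (hdet (x 3) (x 0) * hdet (x 1) (x 4)))"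
    using m(2) by (simp add: cross_def mult_ac)
  also have "\<dots> = cross x" using m(1) by (simp add: cross_def)
  finally show ?thesis .
qed

definition norm_config :: "real \<Rightarrow> real \<Rightarrow> real \<Rightarrow> real \<Rightarrow> nat \<Rightarrow> rhat" where
  "norm_config p1 p2 p3 p5 = (\<lambda>i\<in>{..5}. [Some 0, Some p1, Some p2, Some p3, None, Some p5] ! i)"

lemma norm_config_in_configs:
  assumes "0 < p1" "p1 < p2" "p2 < p3" "p5 < 0"
  shows "norm_config p1 p2 p3 p5 \<in> configs 5"
  unfolding configs_5_iff ordered_triples_le_5 using assms by (simp add: norm_config_def)

lemma cross_norm_config: "cross (norm_config p1 p2 p3 p5) = p1 / p3"
  by (simp add: cross_def norm_config_def)

lemma configs_normalize:
  assumes "x \<in> configs 5" "g \<in> PSL2R" "g (x 0) = Some 0" "g (x 4) = None"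
  obtains p1 p2 p3 p5 where "0 < p1" "p1 < p2" "p2 < p3" "p5 < 0"
    "(\<lambda>i\<in>{..5}. g (x i)) = norm_config p1 p2 p3 p5"
proof -
  define w where "w = (\<lambda>i\<in>{..5}. g (x i))"
  have "w \<in> configs 5" unfolding w_def using assms(1,2) by (rule configs_PSL2R)
  then have c: "\<forall>i j k. i < j \<and> j < k \<and> k \<le> 5 \<longrightarrow> pos_cyclic (w i) (w j) (w k)"
    unfolding configs_5_iff by blast
  have w0: "w 0 = Some 0" and w4: "w 4 = None" using assms by (simp_all add: w_def)
  have c': "pos_cyclic (Some 0) (w 1) None" "pos_cyclic (w 1) (w 2) None" "pos_cyclic (w 2) (w 3) None"
    "pos_cyclic (Some 0) None (w 5)"
    using c[rule_format, of 0 1 4] c[rule_format, of 1 2 4] c[rule_format, of 2 3 4] c[rule_format, of 0 4 5]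
    by (simp_all add: w0 w4)
  then obtain p1 where p1: "w 1 = Some p1" "0 < p1" by (cases "w 1") auto
  then obtain p2 where p2: "w 2 = Some p2" "p1 < p2" using c' by (cases "w 2") auto
  then obtain p3 where p3: "w 3 = Some p3" "p2 < p3" using c' by (cases "w 3") auto
  obtain p5 where p5: "w 5 = Some p5" "p5 < 0" using c' by (cases "w 5") auto
  have "w i = norm_config p1 p2 p3 p5 i" for i
  proof (cases "i \<le> 5")
    case True
    then have "i \<in> {0, 1, 2, 3, 4, 5}" by auto
    then show ?thesis using w0 w4 p1 p2 p3 p5 by (auto simp: norm_config_def)
  next
    case False
    then show ?thesis by (simp add: w_def norm_config_def)
  qed
  then have "w = norm_config p1 p2 p3 p5" by auto
  then show ?thesis using that p1 p2 p3 p5 unfolding w_def by blast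
qed

lemma cross_bounds:
  assumes "x \<in> configs 5"
  shows "0 < cross x" "cross x < 1"
proof -
  obtain g where g: "g \<in> PSL2R" "g (x 0) = Some 0" "g (x 4) = None"
    using PSL2R_0_infinity[of "x 0" "x 4"] configs_distinct[OF assms, of 0 4] by auto
  obtain p1 p2 p3 p5 where "0 < p1" "p1 < p2" "p2 < p3" "p5 < 0"
    "(\<lambda>i\<in>{..5}. g (x i)) = norm_config p1 p2 p3 p5" using assms g by (rule configs_normalize)
  moreover from this have "cross x = p1 / p3" using cross_PSL2R[OF g(1), of x] by (simp add: cross_norm_config)
  ultimately show "0 < cross x" "cross x < 1" by simp_all
qed

definition sym_config :: "real \<Rightarrow> nat \<Rightarrow> rhat" where
  "sym_config s = (\<lambda>i\<in>{..5}. [Some s, Some 1, None, Some (- 1), Some (- s), Some 0] ! i)"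

lemma sym_config_in_configs:
  assumes "0 < s" "s < 1"
  shows "sym_config s \<in> configs 5"
  unfolding configs_5_iff ordered_triples_le_5 using assms by (simp add: sym_config_def)

text \<open>The value is a perfect square. The square root taken by the pull-back is therefore
  rational in \<open>s\<close>, and the iteration on the symmetric family is explicit.\<close>

lemma cross_sym_config: "cross (sym_config s) = ((1 - s) / (1 + s))\<^sup>2"
proof -
  have num: "hdet (sym_config s 1) (sym_config s 0) * hdet (sym_config s 3) (sym_config s 4) = - (1 - s)\<^sup>2"
    and den: "hdet (sym_config s 3) (sym_config s 0) * hdet (sym_config s 1) (sym_config s 4) = - (1 + s)\<^sup>2"
    by (simp_all add: sym_config_def power2_eq_square algebra_simps)
  show ?thesis unfolding cross_def num den by (simp add: power_divide)
qed

text \<open>A positive dilation acts as an element of \<open>PSL2R\<close>, so the scale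
  \<open>k\<close> is absorbed by passing to classes and only the ratio \<open>s\<close>
  survives.\<close>

lemma eq_scaled_sym_config:
  assumes "k > 0" "\<phi> \<in> PSL2R"
    and "y \<in> extensional {..5}"
    and "y 0 = \<phi> (Some (k * s))" "y 1 = \<phi> (Some k)" "y 2 = \<phi> None"
      "y 3 = \<phi> (Some (- k))" "y 4 = \<phi> (Some (- (k * s)))" "y 5 = \<phi> (Some 0)"
  shows "config_class 5 y = config_class 5 (sym_config s)"
proof -
  define g where "g = \<phi> \<circ> mob k 0 0 1"
  have g: "g \<in> PSL2R" unfolding g_def using assms(1,2) by (intro PSL2R_comp mob_in_PSL2R) auto
  have S: "mob k 0 0 1 (Some z) = Some (k * z)" for z
    by (simp add: mob_def rat_map_def algebra_simps)
  have N: "mob k 0 0 1 None = None" using assms(1) by (simp add: mob_def rat_map_def)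
  have "y i = (\<lambda>i\<in>{..5}. g (sym_config s i)) i" for i
  proof (cases "i \<le> 5")
    case True
    then have "i \<in> {0, 1, 2, 3, 4, 5}" by auto
    then show ?thesis using assms(4-) by (auto simp: g_def sym_config_def S N)
  next
    case False
    then show ?thesis using assms(3) by (auto simp: extensional_def)
  qed
  then have "y = (\<lambda>i\<in>{..5}. g (sym_config s i))" by (rule ext)
  then show ?thesis using config_class_PSL2R[OF g] by metis
qed

section \<open>Arcs from 0 to infinity and the orientation behaviour of squaring\<close>

lemma pos_arc_0_infinity: "pos_arc (Some 0) None = insert None (Some ` {0..})"
  unfolding pos_arc_def
proof (intro set_eqI)
  fix z show "z \<in> {Some 0, None} \<union> {z. pos_cyclic (Some 0) z None} \<longleftrightarrow> z \<in> insert None (Some ` {0..})"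
    by (cases z) auto
qed

lemma pos_arc_infinity_0: "pos_arc None (Some 0) = insert None (Some ` {..0})"
  unfolding pos_arc_def
proof (intro set_eqI)
  fix z show "z \<in> {None, Some 0} \<union> {z. pos_cyclic None z (Some 0)} \<longleftrightarrow> z \<in> insert None (Some ` {..0})"
    by (cases z) auto
qed

text \<open>An oriented arc determines its endpoints. In the pull-back this turns the condition on
  the range of \<open>f\<close> into the location of both critical values, including their
  order.\<close>

lemma pos_arc_0_infinity_endpoints:
  assumes "pos_arc u v = pos_arc (Some 0) None" "u \<noteq> v"
  shows "u = Some 0 \<and> v = None"
proof -
  have mem: "z \<in> pos_arc u v \<longleftrightarrow> z = None \<or> (\<exists>r\<ge>0. z = Some r)" for z
    unfolding assms(1) pos_arc_0_infinity by auto
  have S: "Some r \<in> pos_arc u v \<longleftrightarrow> r \<ge> 0" for r using mem by auto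
  have N: "None \<in> pos_arc u v" using mem by auto
  show ?thesis
  proof (cases u; cases v)
    assume "u = None" "v = None" then show ?thesis using assms(2) by simp
  next
    fix b assume uv: "u = None" "v = Some b"
    \<comment> \<open>A negative number below \<open>b\<close>: it lies on the arc that comes up
      from infinity to \<open>b\<close>.\<close>
    then show ?thesis using S[of "min (-1) (b - 1)"] by (auto simp: pos_arc_def)
  next
    fix a assume uv: "u = Some a" "v = None"
    then have "a = 0" using S[of 0] S[of a] by (auto simp: pos_arc_def)
    then show ?thesis using uv by simp
  next
    fix a b assume uv: "u = Some a" "v = Some b"
    show ?thesis
    proof (cases "a < b")
      case True
      then show ?thesis using N uv by (auto simp: pos_arc_def)
    next
      case False
      then show ?thesis using S[of "min (-1) (b - 1)"] uv assms(2) by (auto simp: pos_arc_def)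
    qed
  qed
qed

lemma sq_preserves:
  assumes "u \<in> pos_arc (Some 0) None" "v \<in> pos_arc (Some 0) None" "w \<in> pos_arc (Some 0) None"
    "pos_cyclic u v w"
  shows "pos_cyclic (sq u) (sq v) (sq w)"
proof -
  have mono: "a\<^sup>2 < b\<^sup>2 \<longleftrightarrow> a < b" if "a \<ge> 0" "b \<ge> 0" for a b :: real
    using that by (simp add: power_mono_iff flip: linorder_not_le)
  show ?thesis using assms unfolding pos_arc_0_infinity by (auto simp: mono)
qed

lemma sq_reverses:
  assumes "u \<in> pos_arc None (Some 0)" "v \<in> pos_arc None (Some 0)" "w \<in> pos_arc None (Some 0)"
    "pos_cyclic u v w"
  shows "pos_cyclic (sq w) (sq v) (sq u)"
proof -
  have mono: "a\<^sup>2 < b\<^sup>2 \<longleftrightarrow> b < a" if "a \<le> 0" "b \<le> 0" for a b :: real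
    using power_mono_iff[of "- b" "- a" 2] that by (simp flip: linorder_not_le)
  show ?thesis using assms unfolding pos_arc_infinity_0 by (auto simp: mono)
qed

lemma range_sq: "range sq = pos_arc (Some 0) None"
proof -
  have "sq z \<in> pos_arc (Some 0) None" for z by (cases z) (auto simp: pos_arc_0_infinity)
  moreover have "z \<in> range sq" if "z \<in> pos_arc (Some 0) None" for z
  proof -
    have "z = None \<or> (\<exists>r\<ge>0. z = Some r)" using that by (auto simp: pos_arc_0_infinity)
    then show ?thesis by (metis rangeI real_sqrt_pow2 sq_simps)
  qed
  ultimately show ?thesis by blast
qed

section \<open>The pull-back and the associated maps\<close>

lemma inj_on_sq: "inj_on sq (pos_arc (Some 0) None)" "inj_on sq (pos_arc None (Some 0))"
  unfolding pos_arc_0_infinity pos_arc_infinity_0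
  by (auto simp: inj_on_def power2_eq_iff)

text \<open>Decides between the two labellings of the critical points in \<open>is_pullback\<close>:
  the half-circle on which orientation is preserved must correspond to the nonnegative
  half-line.\<close>

lemma sq_not_preserves: "\<not> preserves_orientation_on sq (pos_arc None (Some 0))"
proof
  assume h: "preserves_orientation_on sq (pos_arc None (Some 0))"
  have "Some (- 3) \<in> pos_arc None (Some 0)" "Some (- 2) \<in> pos_arc None (Some 0)"
    "Some (- 1) \<in> pos_arc None (Some 0)" by (auto simp: pos_arc_infinity_0)
  moreover have "pos_cyclic (Some (- 3)) (Some (- 2)) (Some (- 1))" by simp
  ultimately have "pos_cyclic (sq (Some (- 3))) (sq (Some (- 2))) (sq (Some (- 1)))"
    using h unfolding preserves_orientation_on_def by blast
  then show False by simp
qed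

text \<open>For any admissible map, the orientation condition makes \<open>c\<close> and
  \<open>d\<close> the preimages of 0 and infinity under \<phi>, and the range condition makes
  \<open>x 0\<close> and \<open>x 4\<close> the images of 0 and infinity under \<psi>. The branches
  are then the two square roots, and the remaining freedom is a Moebius map, which disappears in the
  class.\<close>

lemma pullback_class:
  assumes x: "x \<in> configs 5" and "is_pullback x y"
  shows "config_class 5 y = config_class 5 (sym_config (sqrt (cross x)))"
proof -
  obtain f c d Hp Hm where f: "real_quadratic_map f" "range f = pos_arc (x 0) (x 4)"
    "c \<noteq> d" "{z. critical_point f z} = {c, d}" and H: "Hp = pos_arc c d" "Hm = pos_arc d c"
    and pres: "preserves_orientation_on f Hp"
    and y: "y = (\<lambda>j\<in>{..5}. inv_into (if j \<in> {3, 4} then Hm else Hp) f (x (m_vec j)))"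
    using assms(2) unfolding is_pullback_def by blast
  obtain \<psi> \<phi> where nf: "\<psi> \<in> PSL2R" "\<phi> \<in> PSL2R" "f = \<psi> \<circ> sq \<circ> \<phi>"
    using f(1) by (rule real_quadratic_normal_form)
  obtain \<psi>' where \<psi>': "\<psi>' \<in> PSL2R" "\<psi> \<circ> \<psi>' = id" "\<psi>' \<circ> \<psi> = id" using nf(1) by (rule PSL2R_inverse)
  obtain \<phi>' where \<phi>': "\<phi>' \<in> PSL2R" "\<phi> \<circ> \<phi>' = id" "\<phi>' \<circ> \<phi> = id" using nf(2) by (rule PSL2R_inverse)
  have r: "\<psi> (\<psi>' z) = z" "\<psi>' (\<psi> z) = z" "\<phi> (\<phi>' z) = z" "\<phi>' (\<phi> z) = z" for z
    using \<psi>' \<phi>' by (metis comp_apply id_apply)+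
  have inj: "inj \<psi>" using PSL2R_bij[OF nf(1)] by (simp add: bij_def)
  have f\<phi>': "f (\<phi>' z) = \<psi> (sq z)" for z by (simp add: nf(3) r)
  have \<phi>_eq: "\<phi> z = w \<longleftrightarrow> z = \<phi>' w" for z w using r(3,4) by metis
  have "{z. critical_point f z} = {\<phi>' (Some 0), \<phi>' None}"
    unfolding nf(3) by (auto simp: critical_point_sq_comp[OF nf(1,2)] \<phi>_eq)
  then have "c = \<phi>' (Some 0) \<and> d = \<phi>' None \<or> c = \<phi>' None \<and> d = \<phi>' (Some 0)"
    using f(3,4) by (auto simp: doubleton_eq_iff)
  \<comment> \<open>The critical points are given as an unordered pair; the swapped labelling would
    make squaring preserve orientation on the nonpositive half-line.\<close>
  moreover have False if "c = \<phi>' None" "d = \<phi>' (Some 0)"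
  proof -
    have "Hp = \<phi>' ` pos_arc None (Some 0)" using H that pos_arc_PSL2R[OF \<phi>'(1)] by simp
    then have "preserves_orientation_on sq (pos_arc None (Some 0))"
      using pres pos_cyclic_PSL2R[OF nf(1)] pos_cyclic_PSL2R[OF \<phi>'(1)]
      by (auto simp: preserves_orientation_on_def f\<phi>')
    then show False using sq_not_preserves by blast
  qed
  ultimately have cd: "c = \<phi>' (Some 0)" "d = \<phi>' None" by auto
  have Hp: "Hp = \<phi>' ` pos_arc (Some 0) None" and Hm: "Hm = \<phi>' ` pos_arc None (Some 0)"
    using H cd pos_arc_PSL2R[OF \<phi>'(1)] by auto
  have f\<phi>_comp: "f \<circ> \<phi>' = \<psi> \<circ> sq" by (auto simp: f\<phi>')
  have inj_f: "inj_on f Hp" "inj_on f Hm"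
    unfolding Hp Hm
    by (intro inj_on_imageI; simp add: f\<phi>_comp comp_inj_on inj_on_sq inj_on_subset[OF inj])+
  have inv_Hp: "inv_into Hp f (\<psi> (sq z)) = \<phi>' z" if "z \<in> pos_arc (Some 0) None" for z
    using inj_f(1) that by (intro inv_into_f_eq) (auto simp: Hp f\<phi>')
  have inv_Hm: "inv_into Hm f (\<psi> (sq z)) = \<phi>' z" if "z \<in> pos_arc None (Some 0)" for z
    using inj_f(2) that by (intro inv_into_f_eq) (auto simp: Hm f\<phi>')
  have "range f = \<psi> ` range sq"
    using PSL2R_bij[OF nf(2)] unfolding nf(3) by (metis bij_betw_def image_comp)
  moreover have "pos_arc (\<psi>' (x 0)) (\<psi>' (x 4)) = \<psi>' ` range f"
    unfolding f(2) pos_arc_PSL2R[OF \<psi>'(1)] ..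
  ultimately have "pos_arc (\<psi>' (x 0)) (\<psi>' (x 4)) = pos_arc (Some 0) None"
    by (simp add: image_image r range_sq)
  moreover have "\<psi>' (x 0) \<noteq> \<psi>' (x 4)" 
  proof
    assume "\<psi>' (x 0) = \<psi>' (x 4)"
    then have "x 0 = x 4" using r(1) by metis
    then show False using configs_distinct[OF x, of 0 4] by simp
  qed
  ultimately have x04: "\<psi>' (x 0) = Some 0" "\<psi>' (x 4) = None"
    using pos_arc_0_infinity_endpoints by blast+
  obtain p1 p2 p3 p5 where p: "0 < p1" "p1 < p2" "p2 < p3" "p5 < 0"
    and n: "(\<lambda>i\<in>{..5}. \<psi>' (x i)) = norm_config p1 p2 p3 p5" using x \<psi>'(1) x04 by (rule configs_normalize)
  have cross: "cross x = p1 / p3" using cross_PSL2R[OF \<psi>'(1), of x] by (simp add: n cross_norm_config)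
  have "\<psi>' (x 1) = Some p1" "\<psi>' (x 3) = Some p3"
    using fun_cong[OF n, of 1] fun_cong[OF n, of 3] by (simp_all add: norm_config_def)
  then have xs: "x 0 = \<psi> (Some 0)" "x 4 = \<psi> None" "x 1 = \<psi> (Some p1)" "x 3 = \<psi> (Some p3)"
    using x04 r(1) by metis+
  define k where "k = sqrt p3"
  define s where "s = sqrt (cross x)"
  have k: "k > 0" using p by (simp add: k_def)
  have ks: "k * s = sqrt p1" using p by (simp add: k_def s_def cross real_sqrt_divide)
  have ks2: "(k * s)\<^sup>2 = p1" "k\<^sup>2 = p3" "k * s \<ge> 0" using p unfolding ks by (auto simp: k_def)
  \<comment> \<open>\<open>x 1\<close> and \<open>x 3\<close> are written with both signs of the
    root, because \<open>m_vec\<close> refers to each of them twice, once for each branch.\<close>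
  have xsq: "x 0 = \<psi> (sq (Some 0))" "x 4 = \<psi> (sq None)"
    "x 1 = \<psi> (sq (Some (k * s)))" "x 3 = \<psi> (sq (Some k))"
    "x 1 = \<psi> (sq (Some (- (k * s))))" "x 3 = \<psi> (sq (Some (- k)))"
    unfolding xs sq_simps using ks2 by simp_all
  have "config_class 5 y = config_class 5 (sym_config s)"
  proof (rule eq_scaled_sym_config[OF k \<phi>'(1)])
    show "y \<in> extensional {..5}" by (simp add: y)
    show "y 0 = \<phi>' (Some (k * s))"
      using inv_Hp[of "Some (k * s)"] ks2(3) by (simp add: y m_vec_def xsq(3) pos_arc_0_infinity del: sq_simps One_nat_def)
    show "y 1 = \<phi>' (Some k)"
      using inv_Hp[of "Some k"] k by (simp add: y m_vec_def xsq(4) pos_arc_0_infinity del: sq_simps One_nat_def)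
    show "y 2 = \<phi>' None"
      using inv_Hp[of None] by (simp add: y m_vec_def xsq(2) pos_arc_0_infinity del: sq_simps One_nat_def)
    show "y 3 = \<phi>' (Some (- k))"
      using inv_Hm[of "Some (- k)"] k by (simp add: y m_vec_def xsq(6) pos_arc_infinity_0 del: sq_simps One_nat_def)
    show "y 4 = \<phi>' (Some (- (k * s)))"
      using inv_Hm[of "Some (- (k * s))"] ks2(3) by (simp add: y m_vec_def xsq(5) pos_arc_infinity_0 del: sq_simps One_nat_def)
    show "y 5 = \<phi>' (Some 0)"
      using inv_Hp[of "Some 0"] by (simp add: y m_vec_def xsq(1) pos_arc_0_infinity del: sq_simps One_nat_def)
  qed
  then show ?thesis by (simp add: s_def)
qed

lemma pullback_exists:
  assumes "x \<in> configs 5"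
  shows "\<exists>y. is_pullback x y"
proof -
  obtain g where g: "g \<in> PSL2R" "g (x 0) = Some 0" "g (x 4) = None"
    using PSL2R_0_infinity[of "x 0" "x 4"] configs_distinct[OF assms, of 0 4] by auto
  obtain h where h: "h \<in> PSL2R" "g \<circ> h = id" "h \<circ> g = id" using g(1) by (rule PSL2R_inverse)
  have hx: "h (Some 0) = x 0" "h None = x 4" using g h(3) by (metis comp_apply id_apply)+
  have "real_quadratic_map (h \<circ> sq)" using h(1) real_quadratic_map_sq by (rule real_quadratic_map_post[rotated])
  moreover have "range (h \<circ> sq) = pos_arc (x 0) (x 4)"
    unfolding image_comp[symmetric] range_sq pos_arc_PSL2R[OF h(1)] hx ..
  moreover have "{z. critical_point (h \<circ> sq) z} = {Some 0, None}"
    using critical_point_post[OF real_quadratic_map_sq h(1)] by (auto simp: critical_point_sq)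
  moreover have "preserves_orientation_on (h \<circ> sq) (pos_arc (Some 0) None)"
    unfolding preserves_orientation_on_def using sq_preserves pos_cyclic_PSL2R[OF h(1)] by simp
  moreover have "reverses_orientation_on (h \<circ> sq) (pos_arc None (Some 0))"
    unfolding reverses_orientation_on_def using sq_reverses pos_cyclic_PSL2R[OF h(1)] by simp
  ultimately show ?thesis unfolding is_pullback_def by (metis option.distinct(1))
qed

definition sym_class :: "real \<Rightarrow> (nat \<Rightarrow> rhat) set" where
  "sym_class s = config_class 5 (sym_config s)"

lemma topspace_moduli: "topspace (moduli_top n) = config_class n ` configs n"
proof -
  have "configs n \<subseteq> extensional {..n}" by (auto simp: configs_def)
  then have "(\<Pi>\<^sub>E i\<in>{..n}. UNIV) \<inter> configs n = configs n" by (auto simp: PiE_def)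
  then show ?thesis by (simp add: moduli_top_def configs_top_def)
qed

text \<open>This justifies the definite description: \<open>pullback_exists\<close> supplies a
  value, and it is unique because \<open>pullback_class\<close> leaves only the cross ratio, which
  is the same for all representatives.\<close>

lemma pullback_T_class:
  assumes "x \<in> configs 5"
  shows "pullback_T (config_class 5 x) = sym_class (sqrt (cross x))"
  unfolding pullback_T_def
proof (rule the_equality)
  obtain y where y: "is_pullback x y" using pullback_exists[OF assms] by blast
  have "x \<in> config_class 5 x" using assms by (intro config_class_self) (simp add: configs_def)
  then show "\<exists>x'\<in>config_class 5 x. \<exists>y. is_pullback x' y \<and> sym_class (sqrt (cross x)) = config_class 5 y"
    using y pullback_class[OF assms y] unfolding sym_class_def by metis
next
  fix D assume "\<exists>x'\<in>config_class 5 x. \<exists>y. is_pullback x' y \<and> D = config_class 5 y"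
  then obtain x' y where xy: "x' \<in> config_class 5 x" "is_pullback x' y" "D = config_class 5 y" by blast
  obtain g where g: "g \<in> PSL2R" "x' = (\<lambda>i\<in>{..5}. g (x i))" using xy(1) by (rule config_class_E)
  have "x' \<in> configs 5" unfolding g(2) using assms g(1) by (rule configs_PSL2R)
  moreover have "cross x' = cross x" unfolding g(2) by (rule cross_PSL2R[OF g(1)])
  ultimately show "D = sym_class (sqrt (cross x))"
    using pullback_class[OF _ xy(2)] by (simp add: sym_class_def xy(3))
qed

lemma pullback_T_sym_class:
  assumes "0 < s" "s < 1"
  shows "pullback_T (sym_class s) = sym_class ((1 - s) / (1 + s))"
  unfolding sym_class_def[of s] pullback_T_class[OF sym_config_in_configs[OF assms]] cross_sym_config real_sqrt_abs
  using assms by simp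

section \<open>The involution on the parameter of the symmetric family\<close>

definition tau :: "real \<Rightarrow> real" where
  "tau s = (1 - s) / (1 + s)"

lemma tau_bounds: "0 < s \<Longrightarrow> s < 1 \<Longrightarrow> 0 < tau s" "0 < s \<Longrightarrow> s < 1 \<Longrightarrow> tau s < 1"
  by (simp_all add: tau_def field_simps)

lemma tau_tau: "0 < s \<Longrightarrow> s < 1 \<Longrightarrow> tau (tau s) = s"
  by (simp add: tau_def field_simps)

lemma tau_fixed: "0 < s \<Longrightarrow> s < 1 \<Longrightarrow> tau s = s \<longleftrightarrow> s = sqrt 2 - 1"
proof -
  assume s: "0 < s" "s < 1"
  have "tau s = s \<longleftrightarrow> (s + 1)\<^sup>2 = 2"
    using s by (auto simp: tau_def field_simps power2_eq_square)
  also have "\<dots> \<longleftrightarrow> s + 1 = sqrt 2"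
    using s real_sqrt_unique[of "s + 1" 2] by auto
  finally show ?thesis by auto
qed

text \<open>The cross ratio recovers \<open>tau s\<close> up to sign, positivity fixes the sign, and
  \<open>tau\<close> is its own inverse.\<close>

lemma sym_class_inj:
  assumes "0 < s" "s < 1" "0 < s'" "s' < 1" "sym_class s = sym_class s'"
  shows "s = s'"
proof -
  have "sym_config s \<in> config_class 5 (sym_config s')"
    using assms(5) config_class_self[of "sym_config s" 5] sym_config_in_configs[OF assms(1,2)]
    by (simp add: sym_class_def configs_def)
  then obtain g where "g \<in> PSL2R" "sym_config s = (\<lambda>i\<in>{..5}. g (sym_config s' i))" by (rule config_class_E)
  then have "cross (sym_config s) = cross (sym_config s')" using cross_PSL2R by metis
  then have "(tau s)\<^sup>2 = (tau s')\<^sup>2" unfolding cross_sym_config tau_def .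
  then have "tau s = tau s'"
    using tau_bounds(1)[OF assms(1,2)] tau_bounds(1)[OF assms(3,4)] by (simp add: power2_eq_iff)
  then show ?thesis using tau_tau assms by metis
qed

text \<open>Critical points 0 and infinity leave a fractional linear map of
  \<open>z\<^sup>2\<close>, and the critical values leave one parameter t. The fixed point -1 then
  requires s (1 + t) = 1 - t, so the involution of the pull-back reappears as a coefficient.\<close>

definition sym_map :: "real \<Rightarrow> rhat \<Rightarrow> rhat" where
  "sym_map s = quad_map (- s * tau s) 0 (- s) (- tau s) 0 1"

lemma qres_sym_map: "qres (- s * tau s) 0 (- s) (- tau s) 0 1 = (2 * s * tau s)\<^sup>2"
  by (simp add: qres_def power2_eq_square)

lemma qres_sym_map_pos: "0 < s \<Longrightarrow> s < 1 \<Longrightarrow> qres (- s * tau s) 0 (- s) (- tau s) 0 1 > 0"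
  unfolding qres_sym_map using tau_bounds[of s] by simp

lemma real_quadratic_sym_map: "0 < s \<Longrightarrow> s < 1 \<Longrightarrow> real_quadratic_map (sym_map s)"
  unfolding real_quadratic_map_iff sym_map_def using qres_sym_map_pos by blast

lemma determines_map_sym_map:
  assumes "0 < s" "s < 1"
  shows "determines_map (sym_config s) (sym_map s)"
proof -
  have qres: "qres (- s * tau s) 0 (- s) (- tau s) 0 1 \<noteq> 0" using qres_sym_map_pos[OF assms] by simp
  note t = tau_bounds[OF assms]
  have "critical_point (sym_map s) None" "critical_point (sym_map s) (Some 0)"
    unfolding sym_map_def critical_point_quad_map_None[OF qres] critical_point_quad_map_Some[OF qres] by simp_all
  moreover have "sym_map s None = Some (- s)" unfolding sym_map_def quad_map_None[OF qres] by simp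
  moreover have "sym_map s (Some 0) = Some s" using t by (simp add: sym_map_def quad_map_def rat_map_def)
  moreover have "(- s - s * tau s) / (1 - tau s) = - 1"
  proof -
    have "tau s * (1 + s) = 1 - s" using assms by (simp add: tau_def)
    then show ?thesis using t by (simp add: field_simps)
  qed
  then have "sym_map s (Some (- 1)) = Some (- 1)" using t by (simp add: sym_map_def quad_map_def rat_map_def algebra_simps)
  ultimately show ?thesis
    using real_quadratic_sym_map[OF assms] by (simp add: determines_map_def sym_config_def)
qed

lemma determines_map_unique:
  assumes "0 < s" "s < 1" "determines_map (sym_config s) f"
  shows "f = sym_map s"
proof -
  obtain p0 p1 p2 q0 q1 q2 where f: "qres p0 p1 p2 q0 q1 q2 > 0" "f = quad_map p0 p1 p2 q0 q1 q2"
    using assms(3) unfolding determines_map_def real_quadratic_map_iff by blast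
  then have qres: "qres p0 p1 p2 q0 q1 q2 \<noteq> 0" by simp
  have c: "critical_point f None" "critical_point f (Some 0)"
    and v: "f None = Some (- s)" "f (Some 0) = Some s" "f (Some (- 1)) = Some (- 1)"
    using assms(3) by (simp_all add: determines_map_def sym_config_def)
  have e: "p1 * q0 - p0 * q1 = 0" "p2 * q1 - p1 * q2 = 0"
    using c unfolding f(2) critical_point_quad_map_Some[OF qres] critical_point_quad_map_None[OF qres] by auto
  define B where "B = p2 * q0 - p0 * q2"
  have B: "B \<noteq> 0" using e qres by (auto simp: qres_def B_def)
  have "B * p1 = 0" "B * q1 = 0" using e unfolding B_def by algebra+
  then have z: "p1 = 0" "q1 = 0" using B by auto
  have p2: "q2 \<noteq> 0" "p2 = - s * q2"
    using v(1) unfolding f(2) quad_map_None[OF qres] by (auto simp: field_simps split: if_splits)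
  have p0: "q0 \<noteq> 0" "p0 = s * q0"
    using v(2) unfolding f(2) quad_map_def rat_map_def by (auto simp: field_simps split: if_splits)
  have "p0 + p2 = - (q0 + q2)"
    using v(3) z unfolding f(2) quad_map_def rat_map_def by (auto simp: field_simps split: if_splits)
  then have "q0 * (1 + s) = - (1 - s) * q2" unfolding p0 p2 by (simp add: algebra_simps)
  then have q0: "q0 = q2 * (- tau s)" using assms(1) by (simp add: tau_def field_simps)
  have "f = quad_map (q2 * (- s * tau s)) (q2 * 0) (q2 * (- s)) (q2 * (- tau s)) (q2 * 0) (q2 * 1)"
    unfolding f(2) using p0(2) p2(2) q0 z by (simp add: algebra_simps)
  also have "\<dots> = sym_map s"
    unfolding sym_map_def using p2(1) qres_sym_map_pos[OF assms(1,2)]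
  proof -
    have qres: "qres (- s * tau s) 0 (- s) (- tau s) 0 1 \<noteq> 0" using qres_sym_map_pos[OF assms(1,2)] by simp
    \<comment> \<open>A common factor of the coefficients amounts to post-composition with a scalar
      matrix, which acts as the identity.\<close>
    have "mob q2 0 0 q2 \<circ> quad_map (- s * tau s) 0 (- s) (- tau s) 0 1
      = quad_map (q2 * (- s * tau s)) (q2 * 0) (q2 * (- s)) (q2 * (- tau s)) (q2 * 0) (q2 * 1)"
      using p2(1) qres by (subst mob_quad_map) auto
    then show "quad_map (q2 * (- s * tau s)) (q2 * 0) (q2 * (- s)) (q2 * (- tau s)) (q2 * 0) (q2 * 1)
      = quad_map (- s * tau s) 0 (- s) (- tau s) 0 1"
      unfolding mob_id[OF p2(1)] by simp
  qed
  finally show ?thesis .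
qed

lemma conj_class_conj:
  assumes "g \<in> PSL2R" "h \<in> PSL2R" "g \<circ> h = id" "h \<circ> g = id"
  shows "conj_class (h \<circ> f \<circ> g) = conj_class f"
proof -
  have "(\<exists>\<phi>\<in>PSL2R. k \<circ> \<phi> = \<phi> \<circ> (h \<circ> f \<circ> g)) \<longleftrightarrow> (\<exists>\<phi>\<in>PSL2R. k \<circ> \<phi> = \<phi> \<circ> f)" for k
  proof
    assume "\<exists>\<phi>\<in>PSL2R. k \<circ> \<phi> = \<phi> \<circ> (h \<circ> f \<circ> g)"
    then obtain \<phi> where \<phi>: "\<phi> \<in> PSL2R" "k \<circ> \<phi> = \<phi> \<circ> (h \<circ> f \<circ> g)" by blast
    have "k \<circ> (\<phi> \<circ> h) = \<phi> \<circ> (h \<circ> f \<circ> g) \<circ> h" using \<phi>(2) by (simp add: comp_assoc[symmetric])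
    also have "\<dots> = (\<phi> \<circ> h) \<circ> f \<circ> (g \<circ> h)" by (simp only: comp_assoc)
    finally have "k \<circ> (\<phi> \<circ> h) = (\<phi> \<circ> h) \<circ> f" by (simp add: assms(3))
    then show "\<exists>\<phi>\<in>PSL2R. k \<circ> \<phi> = \<phi> \<circ> f" using PSL2R_comp[OF \<phi>(1) assms(2)] by blast
  next
    assume "\<exists>\<phi>\<in>PSL2R. k \<circ> \<phi> = \<phi> \<circ> f"
    then obtain \<phi> where \<phi>: "\<phi> \<in> PSL2R" "k \<circ> \<phi> = \<phi> \<circ> f" by blast
    have "k \<circ> (\<phi> \<circ> g) = \<phi> \<circ> (g \<circ> h) \<circ> f \<circ> g" using \<phi>(2) by (simp add: comp_assoc[symmetric] assms(3))
    also have "\<dots> = (\<phi> \<circ> g) \<circ> (h \<circ> f \<circ> g)" by (simp only: comp_assoc)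
    finally show "\<exists>\<phi>\<in>PSL2R. k \<circ> \<phi> = \<phi> \<circ> (h \<circ> f \<circ> g)" using PSL2R_comp[OF \<phi>(1) assms(1)] by blast
  qed
  then show ?thesis unfolding conj_class_def by simp
qed

text \<open>Another representative of the class is the image of \<open>sym_config s\<close> under
  some \<open>g\<close>. Conjugating back by \<open>g\<close> gives a map determined by
  \<open>sym_config s\<close>, hence \<open>sym_map s\<close>, so the definite description has one
  value.\<close>

lemma map_class_sym_class:
  assumes "0 < s" "s < 1"
  shows "map_class (sym_class s) = conj_class (sym_map s)"
  unfolding map_class_def
proof (rule the_equality)
  have "sym_config s \<in> sym_class s"
    unfolding sym_class_def using sym_config_in_configs[OF assms] by (intro config_class_self) (simp add: configs_def)
  then show "\<exists>x\<in>sym_class s. \<exists>f. determines_map x f \<and> conj_class (sym_map s) = conj_class f"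
    using determines_map_sym_map[OF assms] by blast
next
  fix F assume "\<exists>x\<in>sym_class s. \<exists>f. determines_map x f \<and> F = conj_class f"
  then obtain x f where xf: "x \<in> sym_class s" "determines_map x f" "F = conj_class f" by blast
  obtain g where g: "g \<in> PSL2R" "x = (\<lambda>i\<in>{..5}. g (sym_config s i))"
    using xf(1) unfolding sym_class_def by (rule config_class_E)
  obtain h where h: "h \<in> PSL2R" "g \<circ> h = id" "h \<circ> g = id" using g(1) by (rule PSL2R_inverse)
  have hg: "h (g z) = z" for z using h(3) by (metis comp_apply id_apply)
  have f: "real_quadratic_map f" "critical_point f (x 2)" "critical_point f (x 5)"
    "f (x 2) = x 4" "f (x 5) = x 0" "f (x 3) = x 3" using xf(2) by (auto simp: determines_map_def)
  have xi: "x i = g (sym_config s i)" if "i \<le> 5" for i using that by (simp add: g(2))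
  have hf: "real_quadratic_map (h \<circ> f)" using f(1) h(1) by (rule real_quadratic_map_post)
  have "determines_map (sym_config s) (h \<circ> f \<circ> g)"
    using f real_quadratic_map_pre[OF hf g(1)] critical_point_pre[OF hf g(1)]
      critical_point_post[OF f(1) h(1)]
    unfolding determines_map_def by (simp add: xi hg)
  then have "h \<circ> f \<circ> g = sym_map s" by (rule determines_map_unique[OF assms])
  then show "F = conj_class (sym_map s)" using conj_class_conj[OF g(1) h, of f] xf(3) by simp
qed

section \<open>Topology of the moduli space\<close>

lemma continuous_map_Some: "continuous_map euclideanreal rhat_top Some"
  by (simp add: continuous_map_def openin_rhat_top)

text \<open>The neighbourhoods of infinity are complements of compact sets: the limit bounds the
  exceptional set, and continuity makes it closed.\<close>

lemma continuous_map_rhat_real: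
  assumes "continuous_on UNIV k" "(k \<longlongrightarrow> l) at_infinity"
  shows "continuous_map rhat_top euclideanreal (case_option l k)"
  unfolding continuous_map_def
proof (intro conjI allI impI)
  fix V :: "real set" assume "openin euclideanreal V"
  then have V: "open V" by simp
  then have op: "open {r. k r \<in> V}"
    using assms(1) open_vimage[of V k] by (simp add: vimage_def)
  have "compact {r. k r \<notin> V}" if l: "l \<in> V"
  proof -
    have "\<forall>\<^sub>F x in at_infinity. k x \<in> V" using assms(2) V l by (simp add: tendsto_def)
    then obtain b where b: "\<And>x. b \<le> norm x \<Longrightarrow> k x \<in> V" unfolding eventually_at_infinity by blast
    have "norm r \<le> b" if "r \<in> {r. k r \<notin> V}" for r using b[of r] that by force
    then have "bounded {r. k r \<notin> V}" unfolding bounded_iff by blast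
    moreover have "closed {r. k r \<notin> V}" using op by (simp add: closed_def Compl_eq)
    ultimately show ?thesis by (simp add: compact_eq_bounded_closed)
  qed
  then show "openin rhat_top {x \<in> topspace rhat_top. case_option l k x \<in> V}"
    using op by (simp add: openin_rhat_top)
qed simp

text \<open>
  The extended line is embedded into the plane as the circle \<open>X\<^sup>2 + Y\<^sup>2 = X\<close>. Ratios of chord lengths
  give the absolute values of cross ratios in a form that is visibly continuous also at infinity.
\<close>

definition circ_x :: "rhat \<Rightarrow> real" where "circ_x = case_option 0 (\<lambda>x. 1 / (1 + x\<^sup>2))"
definition circ_y :: "rhat \<Rightarrow> real" where "circ_y = case_option 0 (\<lambda>x. x / (1 + x\<^sup>2))"
text \<open>The squared Euclidean norm of the homogeneous representative that underlies
  \<open>hdet\<close>.\<close>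

definition hnorm :: "rhat \<Rightarrow> real" where "hnorm = case_option 1 (\<lambda>x. 1 + x\<^sup>2)"

text \<open>The square of the chord length.\<close>

definition chord :: "rhat \<Rightarrow> rhat \<Rightarrow> real" where
  "chord u v = (circ_x u - circ_x v)\<^sup>2 + (circ_y u - circ_y v)\<^sup>2"

lemma one_plus_square_pos: "1 + x\<^sup>2 > (0 :: real)" "1 + x\<^sup>2 \<noteq> (0 :: real)"
proof -
  show "1 + x\<^sup>2 > (0 :: real)" using zero_le_power2[of x] by linarith
  then show "1 + x\<^sup>2 \<noteq> (0 :: real)" by simp
qed

lemma hnorm_pos: "hnorm u > 0"
  using one_plus_square_pos by (cases u) (auto simp: hnorm_def)

lemma continuous_map_circ: "continuous_map rhat_top euclideanreal circ_x" "continuous_map rhat_top euclideanreal circ_y"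
proof -
  have ev: "\<forall>\<^sub>F x in at_infinity. 1 \<le> \<bar>x :: real\<bar>"
    by (rule eventually_at_infinityI[of 1]) simp
  have lim: "((\<lambda>x :: real. norm (inverse x)) \<longlongrightarrow> 0) at_infinity"
    using tendsto_inverse_0 by (intro tendsto_norm_zero)
  have "norm (1 / (1 + x\<^sup>2)) \<le> norm (inverse x) \<and> norm (x / (1 + x\<^sup>2)) \<le> norm (inverse x)"
    if "1 \<le> \<bar>x\<bar>" for x :: real
  proof -
    have "\<bar>x\<bar> * 1 \<le> \<bar>x\<bar> * \<bar>x\<bar>" using that by (intro mult_left_mono) auto
    then have "\<bar>x\<bar> \<le> 1 + x\<^sup>2" by (simp add: power2_eq_square abs_mult_self_eq)
    moreover have "\<bar>x\<bar> * \<bar>x\<bar> \<le> 1 + x\<^sup>2" by (simp add: power2_eq_square abs_mult_self_eq)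
    ultimately show ?thesis
      using that one_plus_square_pos[of x] by (simp add: abs_divide divide_simps abs_of_pos)
  qed
  then have bound: "\<forall>\<^sub>F x in at_infinity. norm (1 / (1 + x\<^sup>2)) \<le> norm (inverse x :: real)"
    "\<forall>\<^sub>F x in at_infinity. norm (x / (1 + x\<^sup>2)) \<le> norm (inverse x :: real)"
    using ev by (auto elim!: eventually_mono)
  have "((\<lambda>x :: real. 1 / (1 + x\<^sup>2)) \<longlongrightarrow> 0) at_infinity" "((\<lambda>x :: real. x / (1 + x\<^sup>2)) \<longlongrightarrow> 0) at_infinity"
    by (rule Lim_null_comparison[OF bound(1) lim], rule Lim_null_comparison[OF bound(2) lim])
  then show "continuous_map rhat_top euclideanreal circ_x" "continuous_map rhat_top euclideanreal circ_y"
    unfolding circ_x_def circ_y_def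
    by (auto intro!: continuous_map_rhat_real continuous_intros simp: one_plus_square_pos)
qed

text \<open>The circle has diameter 1, so a chord is the sine of the angle between the two lines
  spanned by the homogeneous representatives.\<close>

lemma chord_hdet: "chord u v = (hdet u v)\<^sup>2 / (hnorm u * hnorm v)"
proof -
  have 1: "(1 / (1 + x\<^sup>2) - 0)\<^sup>2 + (x / (1 + x\<^sup>2) - 0)\<^sup>2 = 1 / (1 + x\<^sup>2)" for x :: real
  proof -
    have "(1 / (1 + x\<^sup>2) - 0)\<^sup>2 + (x / (1 + x\<^sup>2) - 0)\<^sup>2 = (1 + x\<^sup>2) / (1 + x\<^sup>2)\<^sup>2"
      by (simp add: power_divide add_divide_distrib)
    then show ?thesis by (simp add: power2_eq_square[of "1 + x\<^sup>2"] one_plus_square_pos)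
  qed
  have 2: "(1 / (1 + x\<^sup>2) - 1 / (1 + y\<^sup>2))\<^sup>2 + (x / (1 + x\<^sup>2) - y / (1 + y\<^sup>2))\<^sup>2
      = (x - y)\<^sup>2 / ((1 + x\<^sup>2) * (1 + y\<^sup>2))" for x y :: real
  proof -
    define X Y where "X = 1 + x\<^sup>2" and "Y = 1 + y\<^sup>2"
    have XY: "X \<noteq> 0" "Y \<noteq> 0" using one_plus_square_pos by (auto simp: X_def Y_def)
    have "(Y - X)\<^sup>2 + (x * Y - y * X)\<^sup>2 = (x - y)\<^sup>2 * (X * Y)"
      unfolding X_def Y_def by algebra
    moreover have "1 / X - 1 / Y = (Y - X) / (X * Y)" "x / X - y / Y = (x * Y - y * X) / (X * Y)"
      using XY by (simp_all add: field_simps)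
    ultimately show ?thesis
      unfolding X_def[symmetric] Y_def[symmetric] using XY
      by (simp add: power_divide power2_eq_square[of "X * Y"] flip: add_divide_distrib)
  qed
  show ?thesis
  proof (cases u; cases v)
    fix x y assume "u = Some x" "v = Some y"
    then show ?thesis using 2[of x y] by (simp add: chord_def circ_x_def circ_y_def hnorm_def)
  next
    fix x assume "u = Some x" "v = None"
    then show ?thesis using 1[of x] by (simp add: chord_def circ_x_def circ_y_def hnorm_def)
  next
    fix x assume "u = None" "v = Some x"
    then show ?thesis using 1[of x] by (simp add: chord_def circ_x_def circ_y_def hnorm_def)
  qed (simp add: chord_def)
qed

lemma chord_eq_0_iff: "chord u v = 0 \<longleftrightarrow> u = v"
  using hnorm_pos[of u] hnorm_pos[of v] by (simp add: chord_hdet)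

section \<open>Continuity of the cross ratio\<close>

lemma topspace_configs_top: "topspace (configs_top n) = configs n"
proof -
  have "configs n \<subseteq> extensional {..n}" by (auto simp: configs_def)
  then show ?thesis by (auto simp: configs_top_def PiE_def)
qed

lemma continuous_map_point: "i \<le> n \<Longrightarrow> continuous_map (configs_top n) rhat_top (\<lambda>x. x i)"
  unfolding configs_top_def by (intro continuous_map_from_subtopology continuous_map_product_projection) simp

lemma continuous_map_chord:
  assumes "i \<le> n" "j \<le> n"
  shows "continuous_map (configs_top n) euclideanreal (\<lambda>x. chord (x i) (x j))"
proof -
  have "continuous_map (configs_top n) euclideanreal (\<lambda>x. e (x i))"
    if "continuous_map rhat_top euclideanreal e" "i \<le> n" for e i
    using continuous_map_compose[OF continuous_map_point[OF that(2)] that(1)] by (simp add: o_def)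
  then show ?thesis unfolding chord_def
    using continuous_map_circ assms by (intro continuous_intros) auto
qed

text \<open>The factors \<open>hnorm\<close> cancel and leave the square of the cross ratio; its
  positivity on configurations then selects the root. Continuity follows without treating infinity
  separately.\<close>

lemma cross_chord:
  assumes "x \<in> configs 5"
  shows "cross x = sqrt ((chord (x 1) (x 0) * chord (x 3) (x 4)) / (chord (x 3) (x 0) * chord (x 1) (x 4)))"
proof -
  have "(chord (x 1) (x 0) * chord (x 3) (x 4)) / (chord (x 3) (x 0) * chord (x 1) (x 4)) = (cross x)\<^sup>2"
    using hnorm_pos[of "x 0"] hnorm_pos[of "x 1"] hnorm_pos[of "x 3"] hnorm_pos[of "x 4"]
    by (simp add: chord_hdet cross_def power_divide power_mult_distrib)
  then show ?thesis using cross_bounds(1)[OF assms] by simp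
qed

lemma continuous_map_cross: "continuous_map (configs_top 5) euclideanreal cross"
proof (rule continuous_map_eq)
  show "continuous_map (configs_top 5) euclideanreal (\<lambda>x. sqrt ((chord (x 1) (x 0) * chord (x 3) (x 4)) / (chord (x 3) (x 0) * chord (x 1) (x 4))))"
  proof (intro continuous_intros continuous_map_chord)
    show "chord (x 3) (x 0) * chord (x 1) (x 4) \<noteq> 0" if "x \<in> topspace (configs_top 5)" for x
      using that configs_distinct[of x 5 3 0] configs_distinct[of x 5 1 4]
      by (simp add: topspace_configs_top chord_eq_0_iff)
  qed simp_all
qed (simp add: topspace_configs_top cross_chord)

lemma quotient_map_config_class: "quotient_map (configs_top n) (moduli_top n) (config_class n)"
  unfolding moduli_top_def by (rule quotient_map_quotient_topology)

text \<open>The parameter of the pulled-back class, hence one step ahead: on the symmetric class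
  with parameter \<open>s\<close> it takes the value \<open>tau s\<close>, which is why
  \<open>tau\<close> enters the inverse of \<open>sym_class\<close>.\<close>

definition cross_param :: "(nat \<Rightarrow> rhat) set \<Rightarrow> real" where
  "cross_param C = sqrt (cross (SOME x. x \<in> C))"

lemma cross_param_config_class:
  assumes "x \<in> configs 5"
  shows "cross_param (config_class 5 x) = sqrt (cross x)"
proof -
  have "x \<in> config_class 5 x" using assms by (intro config_class_self) (simp add: configs_def)
  then have "(SOME y. y \<in> config_class 5 x) \<in> config_class 5 x" by (rule someI[of "\<lambda>y. y \<in> config_class 5 x"])
  then obtain g where "g \<in> PSL2R" "(SOME y. y \<in> config_class 5 x) = (\<lambda>i\<in>{..5}. g (x i))"
    by (rule config_class_E)
  then show ?thesis unfolding cross_param_def using cross_PSL2R by simp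
qed

lemma continuous_map_cross_param: "continuous_map (moduli_top 5) euclideanreal cross_param"
proof (rule continuous_compose_quotient_map[OF quotient_map_config_class])
  show "continuous_map (configs_top 5) euclideanreal (cross_param \<circ> config_class 5)"
    by (rule continuous_map_eq[OF continuous_map_sqrt[OF continuous_map_cross]])
      (simp add: topspace_configs_top cross_param_config_class)
qed

section \<open>The symmetric family as a closed line in the moduli space\<close>

lemma continuous_map_configs_path:
  assumes "\<And>s. s \<in> S \<Longrightarrow> c s \<in> configs n"
    and "\<And>i. i \<le> n \<Longrightarrow> continuous_map (top_of_set S) rhat_top (\<lambda>s. c s i)"
  shows "continuous_map (top_of_set S) (moduli_top n) (\<lambda>s. config_class n (c s))"
proof -
  have "continuous_map (top_of_set S) (configs_top n) c"
    unfolding configs_top_def continuous_map_in_subtopology continuous_map_componentwise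
    using assms by (auto simp: configs_def)
  then show ?thesis
    using continuous_map_compose quotient_imp_continuous_map[OF quotient_map_config_class]
    by (fastforce simp: o_def)
qed

lemma continuous_map_Some_comp:
  "continuous_on S k \<Longrightarrow> continuous_map (top_of_set S) rhat_top (\<lambda>s. Some (k s))"
  using continuous_map_compose[OF _ continuous_map_Some, of "top_of_set S" k] by (simp add: o_def)

lemma continuous_map_sym_class: "continuous_map (top_of_set {0<..<1}) (moduli_top 5) sym_class"
  unfolding sym_class_def
proof (rule continuous_map_configs_path)
  fix i :: nat assume "i \<le> 5"
  then have "i \<in> {0, 1, 2, 3, 4, 5}" by auto
  then show "continuous_map (top_of_set {0<..<1}) rhat_top (\<lambda>s. sym_config s i)"
    by (elim insertE emptyE)
      (simp_all add: sym_config_def continuous_map_Some_comp continuous_on_minus)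
qed (simp add: sym_config_in_configs)

lemma cross_param_sym_class: "0 < s \<Longrightarrow> s < 1 \<Longrightarrow> cross_param (sym_class s) = tau s"
  using cross_param_config_class[OF sym_config_in_configs] tau_bounds[of s]
  by (simp add: sym_class_def cross_sym_config tau_def real_sqrt_abs del: real_sqrt_divide)

definition sym_classes :: "(nat \<Rightarrow> rhat) set set" where
  "sym_classes = sym_class ` {0<..<1}"

lemma sym_classes_subset: "sym_classes \<subseteq> topspace (moduli_top 5)"
  unfolding sym_classes_def topspace_moduli sym_class_def using sym_config_in_configs by auto

lemma sym_classes_homeomorphic_maps:
  "homeomorphic_maps (top_of_set {0<..<1}) (subtopology (moduli_top 5) sym_classes) sym_class (tau \<circ> cross_param)"
  unfolding homeomorphic_maps_def
proof (intro conjI)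
  show "continuous_map (top_of_set {0<..<1}) (subtopology (moduli_top 5) sym_classes) sym_class"
    using continuous_map_sym_class by (auto simp: continuous_map_in_subtopology sym_classes_def)
  have cross_param: "continuous_map (subtopology (moduli_top 5) sym_classes) (top_of_set {0<..<1}) cross_param"
    using continuous_map_cross_param
    by (auto simp: continuous_map_in_subtopology continuous_map_from_subtopology sym_classes_def cross_param_sym_class tau_bounds)
  have "continuous_map (top_of_set {0<..<1}) (top_of_set {0<..<1}) tau"
    by (auto simp: tau_bounds) (auto simp: tau_def intro!: continuous_intros)
  then show "continuous_map (subtopology (moduli_top 5) sym_classes) (top_of_set {0<..<1}) (tau \<circ> cross_param)"
    using cross_param by (rule continuous_map_compose[rotated])
  show "\<forall>s\<in>topspace (top_of_set {0<..<1}). (tau \<circ> cross_param) (sym_class s) = s"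
    by (simp add: cross_param_sym_class tau_tau)
  show "\<forall>C\<in>topspace (subtopology (moduli_top 5) sym_classes). sym_class ((tau \<circ> cross_param) C) = C"
    by (auto simp: sym_classes_def cross_param_sym_class tau_tau)
qed

text \<open>With the point of index 5 at 0 and that of index 2 at infinity, the equations say that
  the points of indices 0 and 4, and those of indices 1 and 3, have equal absolute values. The
  cyclic order puts them on opposite sides of 0, so they are negatives of each other.\<close>

lemma config_class_in_sym_classes_iff:
  assumes x: "x \<in> configs 5"
  shows "config_class 5 x \<in> sym_classes \<longleftrightarrow>
    chord (x 0) (x 5) * chord (x 4) (x 2) = chord (x 4) (x 5) * chord (x 0) (x 2) \<and>
    chord (x 1) (x 5) * chord (x 3) (x 2) = chord (x 3) (x 5) * chord (x 1) (x 2)"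
proof -
  have ch: "chord u a * chord v b = chord v a * chord u b \<longleftrightarrow>
      (hdet u a * hdet v b)\<^sup>2 = (hdet v a * hdet u b)\<^sup>2" for u v a b
    using hnorm_pos[of u] hnorm_pos[of v] hnorm_pos[of a] hnorm_pos[of b]
    by (simp add: chord_hdet power_mult_distrib mult_ac)
  have inv: "(hdet (g u) (g a) * hdet (g v) (g b))\<^sup>2 = (hdet (g v) (g a) * hdet (g u) (g b))\<^sup>2 \<longleftrightarrow>
      (hdet u a * hdet v b)\<^sup>2 = (hdet v a * hdet u b)\<^sup>2" if g: "g \<in> PSL2R" for g u v a b
  proof -
    obtain m where m: "\<forall>z. m z \<noteq> 0" "\<forall>u v. hdet (g u) (g v) = m u * m v * hdet u v"
      using g by (rule PSL2R_hdet)
    have "(hdet (g u) (g a) * hdet (g v) (g b))\<^sup>2 = (m u * m v * m a * m b)\<^sup>2 * (hdet u a * hdet v b)\<^sup>2"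
      "(hdet (g v) (g a) * hdet (g u) (g b))\<^sup>2 = (m u * m v * m a * m b)\<^sup>2 * (hdet v a * hdet u b)\<^sup>2"
      by (simp_all add: m(2) power_mult_distrib mult_ac)
    then show ?thesis using m(1) by simp
  qed
  show ?thesis unfolding ch
  proof
    assume "config_class 5 x \<in> sym_classes"
    then obtain s where s: "0 < s" "s < 1" "config_class 5 x = config_class 5 (sym_config s)"
      by (auto simp: sym_classes_def sym_class_def)
    have "x \<in> config_class 5 (sym_config s)"
      using s(3) config_class_self[of x 5] x by (auto simp: configs_def)
    then obtain g where g: "g \<in> PSL2R" "x = (\<lambda>i\<in>{..5}. g (sym_config s i))" by (rule config_class_E)
    have xi: "x i = g (sym_config s i)" if "i \<le> 5" for i using that by (simp add: g(2))
    show "(hdet (x 0) (x 5) * hdet (x 4) (x 2))\<^sup>2 = (hdet (x 4) (x 5) * hdet (x 0) (x 2))\<^sup>2 \<and>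
      (hdet (x 1) (x 5) * hdet (x 3) (x 2))\<^sup>2 = (hdet (x 3) (x 5) * hdet (x 1) (x 2))\<^sup>2"
      by (simp add: xi inv[OF g(1)] del: One_nat_def) (simp add: sym_config_def)
  next
    assume eq: "(hdet (x 0) (x 5) * hdet (x 4) (x 2))\<^sup>2 = (hdet (x 4) (x 5) * hdet (x 0) (x 2))\<^sup>2 \<and>
      (hdet (x 1) (x 5) * hdet (x 3) (x 2))\<^sup>2 = (hdet (x 3) (x 5) * hdet (x 1) (x 2))\<^sup>2"
    obtain g where g: "g \<in> PSL2R" "g (x 5) = Some 0" "g (x 2) = None"
      using PSL2R_0_infinity[of "x 5" "x 2"] configs_distinct[OF x, of 5 2] by auto
    obtain h where h: "h \<in> PSL2R" "g \<circ> h = id" "h \<circ> g = id" using g(1) by (rule PSL2R_inverse)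
    have hg: "h (g z) = z" for z using h(3) by (metis comp_apply id_apply)
    have c: "pos_cyclic (g (x i)) (g (x j)) (g (x k))" if "i < j \<and> j < k \<and> k \<le> 5" for i j k
      using x that pos_cyclic_PSL2R[OF g(1)] unfolding configs_5_iff by blast
    have c': "pos_cyclic (g (x 0)) None (Some 0)" "pos_cyclic (g (x 0)) (g (x 1)) None"
      "pos_cyclic None (g (x 3)) (Some 0)" "pos_cyclic None (g (x 4)) (Some 0)"
      using c[of 0 2 5] c[of 0 1 2] c[of 2 3 5] c[of 2 4 5] by (simp_all add: g)
    obtain w0 where w0: "g (x 0) = Some w0" "0 < w0" using c'(1) by (cases "g (x 0)") auto
    then obtain w1 where w1: "g (x 1) = Some w1" "w0 < w1" using c'(2) by (cases "g (x 1)") auto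
    obtain w3 where w3: "g (x 3) = Some w3" "w3 < 0" using c'(3) by (cases "g (x 3)") auto
    obtain w4 where w4: "g (x 4) = Some w4" "w4 < 0" using c'(4) by (cases "g (x 4)") auto
    have "w0\<^sup>2 = w4\<^sup>2" "w1\<^sup>2 = w3\<^sup>2"
      using eq inv[OF g(1), of "x 0" "x 5" "x 4" "x 2"] inv[OF g(1), of "x 1" "x 5" "x 3" "x 2"]
      by (simp_all add: g w0 w1 w3 w4 del: One_nat_def)
    then have w: "w4 = - w0" "w3 = - w1" using w0 w1 w3 w4 by (auto simp: power2_eq_iff)
    have "w1 > 0" using w0 w1 by simp
    then have "config_class 5 x = config_class 5 (sym_config (w0 / w1))"
      using h(1)
    proof (rule eq_scaled_sym_config)
      show "x \<in> extensional {..5}" using x by (simp add: configs_def)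
      have e: "w1 * (w0 / w1) = w0" using \<open>w1 > 0\<close> by simp
      show "x 0 = h (Some (w1 * (w0 / w1)))" "x 4 = h (Some (- (w1 * (w0 / w1))))"
        "x 1 = h (Some w1)" "x 2 = h None" "x 3 = h (Some (- w1))" "x 5 = h (Some 0)"
        unfolding e using hg w0(1) w1(1) w3(1) w4(1) w g(2,3) by metis+
    qed
    moreover have "w0 / w1 \<in> {0<..<1}" using w0 w1 by simp
    ultimately show "config_class 5 x \<in> sym_classes" unfolding sym_classes_def sym_class_def by blast
  qed
qed

text \<open>In a quotient closedness is tested on the preimage, which is cut out by two equations
  between continuous functions.\<close>

lemma closedin_sym_classes: "closedin (moduli_top 5) sym_classes"
proof -
  have "closedin (configs_top 5) {x \<in> topspace (configs_top 5). config_class 5 x \<in> sym_classes}"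
  proof -
    have cl: "closedin (configs_top 5) {x \<in> topspace (configs_top 5). chord (x i) (x j) * chord (x k) (x l) - chord (x k) (x j) * chord (x i) (x l) \<in> {0}}"
      if "i \<le> 5" "j \<le> 5" "k \<le> 5" "l \<le> 5" for i j k l
      by (rule closedin_continuous_map_preimage[where Y = euclideanreal])
        (use that in \<open>auto intro!: continuous_intros continuous_map_chord\<close>)
    have "{x \<in> topspace (configs_top 5). config_class 5 x \<in> sym_classes} =
      {x \<in> topspace (configs_top 5). chord (x 0) (x 5) * chord (x 4) (x 2) - chord (x 4) (x 5) * chord (x 0) (x 2) \<in> {0}} \<inter>
      {x \<in> topspace (configs_top 5). chord (x 1) (x 5) * chord (x 3) (x 2) - chord (x 3) (x 5) * chord (x 1) (x 2) \<in> {0}}"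
      by (auto simp: topspace_configs_top config_class_in_sym_classes_iff)
    then show ?thesis using cl[of 0 5 4 2] cl[of 1 5 3 2] by (simp add: closedin_Int)
  qed
  then show ?thesis
    using quotient_map_config_class[of 5] sym_classes_subset unfolding quotient_map_closedin by blast
qed

section \<open>Topology of the space of conjugacy classes\<close>

definition qpairs :: "((real \<times> real \<times> real) \<times> (real \<times> real \<times> real)) set" where
  "qpairs = {(a, b). real_quadratic_pair (poly3 a) (poly3 b)}"

definition qpair_class :: "(real \<times> real \<times> real) \<times> (real \<times> real \<times> real) \<Rightarrow> (rhat \<Rightarrow> rhat) set" where
  "qpair_class = conj_class \<circ> (\<lambda>(a, b). rat_map (poly3 a) (poly3 b))"

lemma qpairs_iff: "((p0, p1, p2), (q0, q1, q2)) \<in> qpairs \<longleftrightarrow> qres p0 p1 p2 q0 q1 q2 > 0"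
  by (simp add: qpairs_def real_quadratic_pair_iff)

lemma qpair_class_eq: "qpair_class ((p0, p1, p2), (q0, q1, q2)) = conj_class (quad_map p0 p1 p2 q0 q1 q2)"
  by (simp add: qpair_class_def quad_map_def)

text \<open>Presents the space of conjugacy classes as a single quotient of the coefficient space,
  so that continuous functions on it are continuous functions of the coefficients that are constant
  on classes.\<close>

lemma quotient_map_qpair_class: "quotient_map (top_of_set qpairs) conj_class_top qpair_class"
  unfolding qpair_class_def
proof (rule quotient_map_compose)
  show "quotient_map (top_of_set qpairs) quad_map_top (\<lambda>(a, b). rat_map (poly3 a) (poly3 b))"
    unfolding quad_map_top_def qpairs_def by (rule quotient_map_quotient_topology)
  show "quotient_map quad_map_top conj_class_top conj_class"
    unfolding conj_class_top_def by (rule quotient_map_quotient_topology)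
qed

lemma conj_class_eq_imp_conj_inv_eq:
  assumes "qres p0 p1 p2 q0 q1 q2 > 0" "qres p0' p1' p2' q0' q1' q2' > 0"
    "conj_class (quad_map p0 p1 p2 q0 q1 q2) = conj_class (quad_map p0' p1' p2' q0' q1' q2')"
  shows "conj_inv p0 p1 p2 q0 q1 q2 = conj_inv p0' p1' p2' q0' q1' q2'"
proof -
  have "real_quadratic_map (quad_map p0 p1 p2 q0 q1 q2)"
    unfolding real_quadratic_map_iff using assms(1) by blast
  moreover have "quad_map p0 p1 p2 q0 q1 q2 \<circ> id = id \<circ> quad_map p0 p1 p2 q0 q1 q2" by simp
  ultimately have "quad_map p0 p1 p2 q0 q1 q2 \<in> conj_class (quad_map p0 p1 p2 q0 q1 q2)"
    unfolding conj_class_def using id_in_PSL2R by blast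
  then obtain \<phi> where "\<phi> \<in> PSL2R" "quad_map p0 p1 p2 q0 q1 q2 \<circ> \<phi> = \<phi> \<circ> quad_map p0' p1' p2' q0' q1' q2'"
    unfolding assms(3) unfolding conj_class_def by blast
  then show ?thesis by (rule conj_inv_conj_invariant[OF assms(1,2)])
qed

text \<open>\<open>conj_inv\<close> has the nonvanishing denominator \<open>qres\<close> and is
  constant on conjugacy classes, so it descends to a continuous function on the quotient.\<close>

lemma ex_conj_class_invariant:
  "\<exists>J. continuous_map conj_class_top euclideanreal J \<and>
    (\<forall>p0 p1 p2 q0 q1 q2. qres p0 p1 p2 q0 q1 q2 > 0 \<longrightarrow>
       J (conj_class (quad_map p0 p1 p2 q0 q1 q2)) = conj_inv p0 p1 p2 q0 q1 q2)"
proof -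
  define h where "h = (\<lambda>((p0, p1, p2), (q0, q1, q2)). conj_inv p0 p1 p2 q0 q1 q2)"
  have cont: "continuous_on qpairs h"
    unfolding h_def conj_inv_def conj_inv_num_def qres_def Let_def split_beta
    by (intro continuous_intros) (auto simp: qpairs_iff qres_def)
  have resp: "h z = h z'" if "z \<in> qpairs" "z' \<in> qpairs" "qpair_class z = qpair_class z'" for z z'
  proof -
    obtain p0 p1 p2 q0 q1 q2 where z: "z = ((p0, p1, p2), (q0, q1, q2))" by (metis surj_pair)
    obtain p0' p1' p2' q0' q1' q2' where z': "z' = ((p0', p1', p2'), (q0', q1', q2'))" by (metis surj_pair)
    show ?thesis
      using that conj_class_eq_imp_conj_inv_eq[of p0 p1 p2 q0 q1 q2 p0' p1' p2' q0' q1' q2']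
      by (simp add: z z' qpairs_iff qpair_class_eq h_def)
  qed
  have h: "continuous_map (top_of_set qpairs) euclideanreal h" using cont by simp
  show ?thesis
  proof (rule quotient_map_lift_exists[OF quotient_map_qpair_class h])
    show "h z = h z'" if "z \<in> topspace (top_of_set qpairs)" "z' \<in> topspace (top_of_set qpairs)"
      "qpair_class z = qpair_class z'" for z z'
      using that by (intro resp) simp_all
  next
    fix J
    assume J: "continuous_map conj_class_top euclideanreal J"
      "\<And>z. z \<in> topspace (top_of_set qpairs) \<Longrightarrow> J (qpair_class z) = h z"
    have "J (conj_class (quad_map p0 p1 p2 q0 q1 q2)) = conj_inv p0 p1 p2 q0 q1 q2"
      if "qres p0 p1 p2 q0 q1 q2 > 0" for p0 p1 p2 q0 q1 q2
      using J(2)[of "((p0, p1, p2), (q0, q1, q2))"] that by (simp add: qpairs_iff qpair_class_eq h_def)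
    then show ?thesis using J(1) by blast
  qed
qed

definition class_inv :: "(rhat \<Rightarrow> rhat) set \<Rightarrow> real" where
  "class_inv = (SOME J. continuous_map conj_class_top euclideanreal J \<and>
    (\<forall>p0 p1 p2 q0 q1 q2. qres p0 p1 p2 q0 q1 q2 > 0 \<longrightarrow>
       J (conj_class (quad_map p0 p1 p2 q0 q1 q2)) = conj_inv p0 p1 p2 q0 q1 q2))"

lemma continuous_map_class_inv: "continuous_map conj_class_top euclideanreal class_inv"
  and class_inv_quad_map: "qres p0 p1 p2 q0 q1 q2 > 0 \<Longrightarrow>
    class_inv (conj_class (quad_map p0 p1 p2 q0 q1 q2)) = conj_inv p0 p1 p2 q0 q1 q2"
  using someI_ex[OF ex_conj_class_invariant] unfolding class_inv_def[symmetric] by blast+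

lemma class_inv_sym_map:
  assumes "0 < s" "s < 1"
  shows "class_inv (conj_class (sym_map s)) = 2 * (tau s / s\<^sup>2 - s\<^sup>2 / tau s) - 4"
proof -
  note t = tau_bounds[OF assms]
  have "class_inv (conj_class (sym_map s)) = conj_inv (- s * tau s) 0 (- s) (- tau s) 0 1"
    unfolding sym_map_def by (rule class_inv_quad_map[OF qres_sym_map_pos[OF assms]])
  \<comment> \<open>The divergence of the lift vanishes at \<open>(2 * tau s, - 2 * s)\<close>; the
    numerator is the cubic form at this vector.\<close>
  also have "\<dots> = (8 * tau s ^ 3 - 16 * s\<^sup>2 * (tau s)\<^sup>2 - 8 * s ^ 4 * tau s) / (2 * s * tau s)\<^sup>2"
    unfolding conj_inv_def qres_sym_map conj_inv_num_def Let_def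
    by (rule arg_cong2[where f = "(/)"]) (algebra, simp)
  also have "\<dots> = 2 * (tau s / s\<^sup>2 - s\<^sup>2 / tau s) - 4"
    using t assms by (simp add: field_simps power2_eq_square power3_eq_cube power4_eq_xxxx)
  finally show ?thesis .
qed

text \<open>As \<open>s\<close> grows, \<open>tau s\<close> falls, so both terms of the difference
  in \<open>class_inv_sym_map\<close> push the invariant down.\<close>

lemma class_inv_sym_map_inj: "inj_on (\<lambda>s. class_inv (conj_class (sym_map s))) {0<..<1}"
proof (rule linorder_inj_onI)
  fix s r :: real
  assume h: "s < r" "s \<in> {0<..<1}" "r \<in> {0<..<1}"
  then have sr: "0 < s" "s < 1" "0 < r" "r < 1" by auto
  have t: "tau r < tau s" using h sr by (simp add: tau_def field_simps)
  have t0: "0 < tau r" "0 < tau s" using tau_bounds sr by auto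
  have sq: "s\<^sup>2 < r\<^sup>2" using h sr by (intro power_strict_mono) auto
  have "tau r / r\<^sup>2 < tau s / s\<^sup>2" using t sq t0 sr h(1) by (intro frac_less) auto
  moreover have "s\<^sup>2 / tau s < r\<^sup>2 / tau r" using t sq t0 sr h(1) by (intro frac_less) auto
  ultimately show "class_inv (conj_class (sym_map s)) \<noteq> class_inv (conj_class (sym_map r))"
    using sr by (simp add: class_inv_sym_map)
qed (rule linear)

section \<open>The symmetric family inside the space of conjugacy classes\<close>

lemma continuous_map_conj_class_sym_map:
  "continuous_map (top_of_set {0<..<1}) conj_class_top (\<lambda>s. conj_class (sym_map s))"
proof -
  define c where "c s = ((- s * tau s, 0 :: real, - s), (- tau s, 0 :: real, 1 :: real))" for s
  have "continuous_on {0<..<1} c"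
    unfolding c_def tau_def by (intro continuous_intros) auto
  then have "continuous_map (top_of_set {0<..<1}) (top_of_set qpairs) c"
    using qres_sym_map_pos by (auto simp: c_def qpairs_iff)
  then have "continuous_map (top_of_set {0<..<1}) conj_class_top (qpair_class \<circ> c)"
    using quotient_imp_continuous_map[OF quotient_map_qpair_class] by (rule continuous_map_compose)
  moreover have "qpair_class \<circ> c = (\<lambda>s. conj_class (sym_map s))"
    by (auto simp: c_def qpair_class_eq sym_map_def)
  ultimately show ?thesis by simp
qed

text \<open>The inverse of the composition, preceded by \<open>g\<close>, is a continuous inverse of
  \<open>f\<close> on its image. An embedding into the space of conjugacy classes can thus be
  detected by a real-valued function on that space.\<close>

lemma embedding_map_from_composition:
  assumes "continuous_map X Y f" "continuous_map Y Z g" "embedding_map X Z (g \<circ> f)"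
  shows "embedding_map X Y f"
proof -
  obtain k where k: "homeomorphic_maps X (subtopology Z ((g \<circ> f) ` topspace X)) (g \<circ> f) k"
    using assms(3) unfolding embedding_map_def homeomorphic_map_maps by blast
  have "continuous_map (subtopology Y (f ` topspace X)) (subtopology Z ((g \<circ> f) ` topspace X)) g"
    using assms(2) by (auto simp: continuous_map_in_subtopology continuous_map_from_subtopology)
  then have "continuous_map (subtopology Y (f ` topspace X)) X (k \<circ> g)"
    using k unfolding homeomorphic_maps_def by (blast intro: continuous_map_compose)
  moreover have "continuous_map X (subtopology Y (f ` topspace X)) f"
    using assms(1) by (simp add: continuous_map_in_subtopology)
  moreover have "k (g (f x)) = x" if "x \<in> topspace X" for x
    using k that by (simp add: homeomorphic_maps_def)
  ultimately have "homeomorphic_maps X (subtopology Y (f ` topspace X)) f (k \<circ> g)"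
    unfolding homeomorphic_maps_def by auto
  then show ?thesis unfolding embedding_map_def homeomorphic_map_maps by blast
qed

lemma class_inv_map_class_inj: "inj_on (class_inv \<circ> map_class) sym_classes"
  using class_inv_sym_map_inj unfolding sym_classes_def inj_on_def by (auto simp: map_class_sym_class)

lemma continuous_map_map_class:
  "continuous_map (subtopology (moduli_top 5) sym_classes) conj_class_top map_class"
proof (rule continuous_map_eq)
  have "continuous_map (subtopology (moduli_top 5) sym_classes) (top_of_set {0<..<1}) (tau \<circ> cross_param)"
    using sym_classes_homeomorphic_maps unfolding homeomorphic_maps_def by blast
  then show "continuous_map (subtopology (moduli_top 5) sym_classes) conj_class_top ((\<lambda>s. conj_class (sym_map s)) \<circ> (tau \<circ> cross_param))"
    using continuous_map_conj_class_sym_map by (rule continuous_map_compose)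
  show "((\<lambda>s. conj_class (sym_map s)) \<circ> (tau \<circ> cross_param)) C = map_class C"
    if "C \<in> topspace (subtopology (moduli_top 5) sym_classes)" for C
    using that unfolding sym_classes_def by (auto simp: cross_param_sym_class tau_tau map_class_sym_class)
qed

lemma sym_classes_homeomorphic_interval: "top_of_set {0<..<1 :: real} homeomorphic_space subtopology (moduli_top 5) sym_classes"
  by (rule homeomorphic_maps_imp_homeomorphic_space[OF sym_classes_homeomorphic_maps])

text \<open>An injective continuous real function on a path connected space is an embedding. The
  family is an interval, and the invariant of its maps is injective on it.\<close>

lemma embedding_map_class: "embedding_map (subtopology (moduli_top 5) sym_classes) conj_class_top map_class"
proof (rule embedding_map_from_composition[OF continuous_map_map_class continuous_map_class_inv])
  let ?X = "subtopology (moduli_top 5) sym_classes"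
  have "path_connected_space (top_of_set {0<..<1 :: real})"
    by (simp add: convex_imp_path_connected)
  then have pc: "path_connected_space ?X"
    using homeomorphic_path_connected_space[OF sym_classes_homeomorphic_interval] by simp
  have "topspace ?X = sym_classes" using sym_classes_subset by auto
  then show "embedding_map ?X euclideanreal (class_inv \<circ> map_class)"
    unfolding embedding_map_into_euclideanreal[OF pc]
    using continuous_map_compose[OF continuous_map_map_class continuous_map_class_inv] class_inv_map_class_inj by simp
qed

lemma sym_classes_homeomorphic_real: "subtopology (moduli_top 5) sym_classes homeomorphic_space euclideanreal"
proof -
  obtain f g where "homeomorphism {0<..<1 :: real} (UNIV :: real set) f g"
    using homeomorphic_open_interval_UNIV[of 0 "1 :: real"] unfolding homeomorphic_def by auto
  then have "homeomorphic_maps (top_of_set {0<..<1 :: real}) euclideanreal f g"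
    unfolding homeomorphism_def homeomorphic_maps_def continuous_map_in_subtopology by auto
  then have "top_of_set {0<..<1 :: real} homeomorphic_space euclideanreal"
    by (rule homeomorphic_maps_imp_homeomorphic_space)
  then show ?thesis
    using sym_classes_homeomorphic_interval homeomorphic_space_sym homeomorphic_space_trans by blast
qed

section \<open>Dynamics of the pull-back\<close>

lemma moduli_cross_param_bounds:
  assumes "c \<in> topspace (moduli_top 5)"
  shows "0 < cross_param c" "cross_param c < 1" "pullback_T c = sym_class (cross_param c)"
  using assms cross_bounds unfolding topspace_moduli
  by (auto simp: cross_param_config_class pullback_T_class real_sqrt_lt_1_iff)

lemma pullback_T_sym_classes: "s \<in> {0<..<1} \<Longrightarrow> pullback_T (sym_class s) = sym_class (tau s)"
  using pullback_T_sym_class by (simp add: tau_def)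

text \<open>Even iterates are described from the second on: the starting class itself need not be
  symmetric.\<close>

lemma pullback_T_iterate:
  assumes "c \<in> topspace (moduli_top 5)"
  shows "(pullback_T ^^ (2 * n + 1)) c = sym_class (cross_param c)"
    and "(pullback_T ^^ (2 * n + 2)) c = sym_class (tau (cross_param c))"
proof -
  note b = moduli_cross_param_bounds[OF assms]
  have t: "tau (cross_param c) \<in> {0<..<1}" using tau_bounds b by auto
  have "(pullback_T ^^ (2 * n + 1)) c = sym_class (cross_param c) \<and> (pullback_T ^^ (2 * n + 2)) c = sym_class (tau (cross_param c))"
  proof (induction n)
    case 0
    then show ?case using b pullback_T_sym_classes[of "cross_param c"] by (simp add: numeral_2_eq_2)
  next
    case (Suc n)
    have "(pullback_T ^^ (2 * Suc n + 1)) c = pullback_T ((pullback_T ^^ (2 * n + 2)) c)" by simp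
    also have "(pullback_T ^^ (2 * n + 2)) c = sym_class (tau (cross_param c))" using Suc by blast
    also have "pullback_T (sym_class (tau (cross_param c))) = sym_class (cross_param c)"
      using b by (simp only: pullback_T_sym_classes[OF t] tau_tau)
    finally have 1: "(pullback_T ^^ (2 * Suc n + 1)) c = sym_class (cross_param c)" .
    have "(pullback_T ^^ (2 * Suc n + 2)) c = pullback_T ((pullback_T ^^ (2 * Suc n + 1)) c)" by simp
    also have "\<dots> = sym_class (tau (cross_param c))" unfolding 1 using b by (intro pullback_T_sym_classes) simp
    finally show ?case using 1 by blast
  qed
  then show "(pullback_T ^^ (2 * n + 1)) c = sym_class (cross_param c)"
    "(pullback_T ^^ (2 * n + 2)) c = sym_class (tau (cross_param c))" by auto
qed

lemma pullback_T_T_sym_classes: "a \<in> sym_classes \<Longrightarrow> pullback_T (pullback_T a) = a"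
  unfolding sym_classes_def using tau_bounds by (auto simp: pullback_T_sym_classes tau_tau)

lemma global_attractor_sym_classes: "global_attractor (moduli_top 5) (pullback_T \<circ> pullback_T) sym_classes"
  unfolding global_attractor_def
proof (intro conjI allI impI closedin_sym_classes)
  show "(pullback_T \<circ> pullback_T) ` sym_classes = sym_classes" by (simp add: pullback_T_T_sym_classes)
next
  fix K U
  assume KU: "compactin (moduli_top 5) K \<and> openin (moduli_top 5) U \<and> sym_classes \<subseteq> U"
  have K: "K \<subseteq> topspace (moduli_top 5)" using KU compactin_subset_topspace by blast
  \<comment> \<open>One application already lands in \<open>sym_classes\<close>, so the bound 1
    serves every \<open>K\<close> and \<open>U\<close>.\<close>
  have "((pullback_T \<circ> pullback_T) ^^ n) ` K \<subseteq> U" if "n \<ge> 1" for n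
  proof
    fix z assume "z \<in> ((pullback_T \<circ> pullback_T) ^^ n) ` K"
    then obtain c where c: "c \<in> K" "z = ((pullback_T \<circ> pullback_T) ^^ n) c" by blast
    obtain m where m: "n = Suc m" using \<open>n \<ge> 1\<close> by (cases n) auto
    have "pullback_T \<circ> pullback_T = pullback_T ^^ 2" by (simp add: numeral_2_eq_2)
    then have "(pullback_T \<circ> pullback_T) ^^ n = pullback_T ^^ (2 * m + 2)"
      by (simp only: funpow_mult m) simp
    then have "z = sym_class (tau (cross_param c))" using c K pullback_T_iterate(2) by auto
    moreover have "tau (cross_param c) \<in> {0<..<1}" using moduli_cross_param_bounds[of c] c K tau_bounds by auto
    ultimately show "z \<in> U" using KU unfolding sym_classes_def by blast
  qed
  then show "\<forall>\<^sub>F n in sequentially. ((pullback_T \<circ> pullback_T) ^^ n) ` K \<subseteq> U"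
    unfolding eventually_sequentially by blast
qed

section \<open>The fixed point and generic starting classes\<close>

lemma sqrt2_bounds: "0 < sqrt 2 - 1" "sqrt 2 - 1 < (1 :: real)"
  by (auto simp: real_less_lsqrt)

text \<open>A fixed class lies in the image of the pull-back, hence in the symmetric family, where
  its parameter must be fixed by \<open>tau\<close>.\<close>

lemma pullback_T_fixed_points:
  "{c \<in> topspace (moduli_top 5). pullback_T c = c} = {sym_class (sqrt 2 - 1)}"
proof (intro set_eqI iffI)
  fix c assume "c \<in> {c \<in> topspace (moduli_top 5). pullback_T c = c}"
  then have c: "c \<in> topspace (moduli_top 5)" "pullback_T c = c" by auto
  note b = moduli_cross_param_bounds[OF c(1)]
  have "sym_class (tau (cross_param c)) = sym_class (cross_param c)" using pullback_T_sym_classes[of "cross_param c"] b c(2) by simp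
  then have "tau (cross_param c) = cross_param c" using sym_class_inj tau_bounds b by blast
  then have "cross_param c = sqrt 2 - 1" using tau_fixed b by blast
  then show "c \<in> {sym_class (sqrt 2 - 1)}" using b(3) c(2) by simp
next
  fix c assume "c \<in> {sym_class (sqrt 2 - 1)}"
  moreover have "sym_class (sqrt 2 - 1) \<in> sym_classes" unfolding sym_classes_def using sqrt2_bounds by simp
  moreover have "tau (sqrt 2 - 1) = sqrt 2 - 1" using tau_fixed[OF sqrt2_bounds] by blast
  ultimately show "c \<in> {c \<in> topspace (moduli_top 5). pullback_T c = c}"
    using sym_classes_subset pullback_T_sym_classes[of "sqrt 2 - 1"] sqrt2_bounds by auto
qed

text \<open>Removes the level set of the classes that the pull-back sends to its fixed
  point.\<close>

definition generic_classes :: "(nat \<Rightarrow> rhat) set set" where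
  "generic_classes = {c \<in> topspace (moduli_top 5). cross_param c \<in> - {sqrt 2 - 1}}"

lemma openin_generic_classes: "openin (moduli_top 5) generic_classes"
  unfolding generic_classes_def using continuous_map_cross_param 
  by (rule openin_continuous_map_preimage) (simp add: open_Compl)

lemma generic_classes_dense: "moduli_top 5 closure_of generic_classes = topspace (moduli_top 5)"
proof (rule antisym[OF closure_of_subset_topspace], rule subsetI)
  fix c assume c: "c \<in> topspace (moduli_top 5)"
  then obtain x where x: "x \<in> configs 5" "c = config_class 5 x" by (auto simp: topspace_moduli)
  obtain g where g: "g \<in> PSL2R" "g (x 0) = Some 0" "g (x 4) = None"
    using PSL2R_0_infinity[of "x 0" "x 4"] configs_distinct[OF x(1), of 0 4] by auto
  obtain p1 p2 p3 p5 where p: "0 < p1" "p1 < p2" "p2 < p3" "p5 < 0"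
    "(\<lambda>i\<in>{..5}. g (x i)) = norm_config p1 p2 p3 p5" using x(1) g by (rule configs_normalize)
  \<comment> \<open>Moving only the point of index 1 in normalized position changes the cross ratio
    \<open>r / p3\<close> strictly, and the order is kept as long as \<open>r\<close> stays between
    0 and \<open>p2\<close>.\<close>
  define path where "path r = config_class 5 (norm_config r p2 p3 p5)" for r
  have path1: "c = path p1" unfolding path_def x(2) using config_class_PSL2R[OF g(1), of 5 x] p(5) by simp
  have cont: "continuous_map (top_of_set {0<..<p2}) (moduli_top 5) path"
    unfolding path_def
  proof (rule continuous_map_configs_path)
    fix i :: nat assume "i \<le> 5"
    then have "i \<in> {0, 1, 2, 3, 4, 5}" by auto
    then show "continuous_map (top_of_set {0<..<p2}) rhat_top (\<lambda>r. norm_config r p2 p3 p5 i)"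
      by (elim insertE emptyE) (simp_all add: norm_config_def continuous_map_Some_comp)
  qed (use p in \<open>simp add: norm_config_in_configs\<close>)
  show "c \<in> moduli_top 5 closure_of generic_classes"
    unfolding in_closure_of
  proof (intro conjI allI impI c)
    fix V assume V: "c \<in> V \<and> openin (moduli_top 5) V"
    define W where "W = {r \<in> {0<..<p2}. path r \<in> V}"
    have "openin (top_of_set {0<..<p2}) W"
      using openin_continuous_map_preimage[OF cont, of V] V by (simp add: W_def)
    then have "open W" by (simp add: openin_open_eq)
    moreover have "p1 \<in> W" using V p path1 by (simp add: W_def)
    ultimately have "infinite W" using finite_imp_not_open by blast
    \<comment> \<open>The value avoided is the only one on the path with cross ratio
      \<open>(sqrt 2 - 1)\<^sup>2\<close>.\<close>
    then obtain r where r: "r \<in> W" "r \<noteq> (sqrt 2 - 1)\<^sup>2 * p3"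
      using finite_subset[of W "{(sqrt 2 - 1)\<^sup>2 * p3}"] by blast
    have rb: "0 < r" "r < p2" "path r \<in> V" using r(1) by (auto simp: W_def)
    have n: "norm_config r p2 p3 p5 \<in> configs 5" using rb p by (intro norm_config_in_configs) auto
    have "cross_param (path r) = sqrt (r / p3)" unfolding path_def cross_param_config_class[OF n] cross_norm_config ..
    moreover have "sqrt (r / p3) \<noteq> sqrt 2 - 1"
    proof
      assume "sqrt (r / p3) = sqrt 2 - 1"
      moreover have "(sqrt (r / p3))\<^sup>2 = r / p3" using rb p by simp
      ultimately have "r / p3 = (sqrt 2 - 1)\<^sup>2" by simp
      then show False using r(2) p by (simp add: field_simps)
    qed
    ultimately have "path r \<in> generic_classes" unfolding generic_classes_def topspace_moduli using n by (auto simp: path_def)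
    then show "\<exists>y. y \<in> generic_classes \<and> y \<in> V" using rb(3) by blast
  qed
qed

theorem proposition5p2:
  shows "\<exists>A c0.
    global_attractor (moduli_top 5) (pullback_T \<circ> pullback_T) A \<and>
    subtopology (moduli_top 5) A homeomorphic_space euclideanreal \<and>
    embedding_map (subtopology (moduli_top 5) A) conj_class_top map_class \<and>
    (\<forall>a\<in>A. pullback_T (pullback_T a) = a) \<and>
    c0 \<in> A \<and> {c \<in> topspace (moduli_top 5). pullback_T c = c} = {c0} \<and>
    (\<exists>U. openin (moduli_top 5) U \<and>
         moduli_top 5 closure_of U = topspace (moduli_top 5) \<and>
         (\<forall>c\<in>U.
            (\<nexists>F. limitin conj_class_top (\<lambda>n. map_class ((pullback_T ^^ n) c)) F sequentially) \<and>
            (\<exists>a\<in>A. \<exists>b\<in>A. pullback_T a = b \<and> pullback_T b = a \<and> map_class a \<noteq> map_class b \<and>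
               limitin (moduli_top 5) (\<lambda>n. (pullback_T ^^ (2 * n)) c) a sequentially \<and>
               limitin (moduli_top 5) (\<lambda>n. (pullback_T ^^ (2 * n + 1)) c) b sequentially \<and>
               limitin conj_class_top (\<lambda>n. map_class ((pullback_T ^^ (2 * n)) c))
                 (map_class a) sequentially \<and>
               limitin conj_class_top (\<lambda>n. map_class ((pullback_T ^^ (2 * n + 1)) c))
                 (map_class b) sequentially)))"
proof (rule exI[of _ sym_classes], rule exI[of _ "sym_class (sqrt 2 - 1)"], intro conjI)
  show "sym_class (sqrt 2 - 1) \<in> sym_classes" unfolding sym_classes_def using sqrt2_bounds by simp
  show "\<exists>U. openin (moduli_top 5) U \<and>
         moduli_top 5 closure_of U = topspace (moduli_top 5) \<and>
         (\<forall>c\<in>U.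
            (\<nexists>F. limitin conj_class_top (\<lambda>n. map_class ((pullback_T ^^ n) c)) F sequentially) \<and>
            (\<exists>a\<in>sym_classes. \<exists>b\<in>sym_classes. pullback_T a = b \<and> pullback_T b = a \<and> map_class a \<noteq> map_class b \<and>
               limitin (moduli_top 5) (\<lambda>n. (pullback_T ^^ (2 * n)) c) a sequentially \<and>
               limitin (moduli_top 5) (\<lambda>n. (pullback_T ^^ (2 * n + 1)) c) b sequentially \<and>
               limitin conj_class_top (\<lambda>n. map_class ((pullback_T ^^ (2 * n)) c))
                 (map_class a) sequentially \<and>
               limitin conj_class_top (\<lambda>n. map_class ((pullback_T ^^ (2 * n + 1)) c))
                 (map_class b) sequentially))"
  proof (intro exI[of _ generic_classes] conjI openin_generic_classes generic_classes_dense ballI)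
    fix c assume "c \<in> generic_classes"
    then have c: "c \<in> topspace (moduli_top 5)" and ne: "cross_param c \<noteq> sqrt 2 - 1" by (auto simp: generic_classes_def)
    note bd = moduli_cross_param_bounds[OF c]
    \<comment> \<open>The first step produces the parameter \<open>cross_param c\<close>, so
      \<open>b\<close> is the odd limit and \<open>a\<close> the even one.\<close>
    define a b where "a = sym_class (tau (cross_param c))" and "b = sym_class (cross_param c)"
    have t: "tau (cross_param c) \<in> {0<..<1}" "cross_param c \<in> {0<..<1}" using tau_bounds bd by auto
    have ab: "a \<in> sym_classes" "b \<in> sym_classes" using t by (auto simp: a_def b_def sym_classes_def)
    have "tau (cross_param c) \<noteq> cross_param c" using ne tau_fixed bd by blast
    then have "a \<noteq> b" using sym_class_inj t unfolding a_def b_def by auto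
    then have J: "class_inv (map_class a) \<noteq> class_inv (map_class b)"
      using inj_onD[OF class_inv_map_class_inj, of a b] ab by auto
    have even: "(pullback_T ^^ (2 * n)) c = a" if n: "n \<ge> 1" for n
    proof -
      obtain m where "n = Suc m" using n by (cases n) auto
      then have "2 * n = 2 * m + 2" by simp
      then show ?thesis unfolding a_def by (simp only: pullback_T_iterate(2)[OF c])
    qed
    have odd: "(pullback_T ^^ (2 * n + 1)) c = b" for n
      using pullback_T_iterate(1)[OF c] by (simp add: b_def)
    have ev: "\<forall>\<^sub>F n in sequentially. (pullback_T ^^ (2 * n)) c = a"
      using even unfolding eventually_sequentially by blast
    have top: "map_class z \<in> topspace conj_class_top" if "z \<in> sym_classes" for z
      using continuous_map_image_subset_topspace[OF continuous_map_map_class]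
        that sym_classes_subset by (auto simp: image_subset_iff)
    show "\<nexists>F. limitin conj_class_top (\<lambda>n. map_class ((pullback_T ^^ n) c)) F sequentially"
    proof
      assume "\<exists>F. limitin conj_class_top (\<lambda>n. map_class ((pullback_T ^^ n) c)) F sequentially"
      then obtain F where F: "limitin conj_class_top (\<lambda>n. map_class ((pullback_T ^^ n) c)) F sequentially" by blast
      \<comment> \<open>A supposed limit is compared through the real invariant, since real limits
        are unique; the two subsequences then give it two different values.\<close>
      have lim: "(\<lambda>n. class_inv (map_class ((pullback_T ^^ n) c))) \<longlonglongrightarrow> class_inv F"
        using continuous_map_limit[OF continuous_map_class_inv F] by (simp add: o_def)
      have "(\<lambda>n. class_inv (map_class ((pullback_T ^^ (2 * n + 1)) c))) \<longlonglongrightarrow> class_inv F"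
        using LIMSEQ_subseq_LIMSEQ[OF lim, of "\<lambda>n. 2 * n + 1"] by (simp add: o_def strict_mono_def)
      then have 1: "class_inv F = class_inv (map_class b)"
        unfolding odd using LIMSEQ_unique tendsto_const by blast
      \<comment> \<open>The shift by one skips the starting class, for which \<open>even\<close>
        says nothing.\<close>
      have "(\<lambda>n. class_inv (map_class ((pullback_T ^^ (2 * (n + 1))) c))) \<longlonglongrightarrow> class_inv F"
        using LIMSEQ_subseq_LIMSEQ[OF lim, of "\<lambda>n. 2 * (n + 1)"] by (simp add: o_def strict_mono_def)
      then have "(\<lambda>n. class_inv (map_class a)) \<longlonglongrightarrow> class_inv F" using even[of "n + 1" for n] by simp
      then have "class_inv F = class_inv (map_class a)" using LIMSEQ_unique tendsto_const by blast
      then show False using 1 J by simp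
    qed
    show "\<exists>a\<in>sym_classes. \<exists>b\<in>sym_classes. pullback_T a = b \<and> pullback_T b = a \<and> map_class a \<noteq> map_class b \<and>
               limitin (moduli_top 5) (\<lambda>n. (pullback_T ^^ (2 * n)) c) a sequentially \<and>
               limitin (moduli_top 5) (\<lambda>n. (pullback_T ^^ (2 * n + 1)) c) b sequentially \<and>
               limitin conj_class_top (\<lambda>n. map_class ((pullback_T ^^ (2 * n)) c))
                 (map_class a) sequentially \<and>
               limitin conj_class_top (\<lambda>n. map_class ((pullback_T ^^ (2 * n + 1)) c))
                 (map_class b) sequentially"
    proof (rule bexI[OF _ ab(1)], rule bexI[OF _ ab(2)], intro conjI)
      show "pullback_T a = b" "pullback_T b = a"
        using pullback_T_sym_classes t tau_tau bd by (simp_all add: a_def b_def)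
      show "map_class a \<noteq> map_class b" using J by auto
      show "limitin (moduli_top 5) (\<lambda>n. (pullback_T ^^ (2 * n)) c) a sequentially"
        by (rule limitin_eventually) (use ab sym_classes_subset ev in auto)
      show "limitin (moduli_top 5) (\<lambda>n. (pullback_T ^^ (2 * n + 1)) c) b sequentially"
        unfolding odd using ab sym_classes_subset by auto
      show "limitin conj_class_top (\<lambda>n. map_class ((pullback_T ^^ (2 * n)) c)) (map_class a) sequentially"
        by (rule limitin_eventually) (use ab top ev in \<open>auto elim: eventually_mono\<close>)
      show "limitin conj_class_top (\<lambda>n. map_class ((pullback_T ^^ (2 * n + 1)) c)) (map_class b) sequentially"
        unfolding odd using ab top by auto
    qed
  qed
qed (simp_all add: global_attractor_sym_classes sym_classes_homeomorphic_real embedding_map_class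
    pullback_T_T_sym_classes pullback_T_fixed_points)

end
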